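(* Let $A\subset B$ be an infinite index $\mathrm{II}_1$-subfactor, let $n\geq 1$, and let $\mathcal{Q}_n$ be the von Neumann algebra of bounded $A-A$ bilinear operators on $\bigotimes_A^n L^2(B)$. Then the odd Jones projections $e_1,e_3,\dots,e_{2n-1}\in \mathcal{Q}_n$ are pairwise (Murray--von Neumann) equivalent in $\mathcal{Q}_n$. Hence $\mathcal{Q}_n$ is not abelian for $n\geq 2$.
   Context: $A\subset B$ is a unital inclusion of $\mathrm{II}_1$-factors, and $H=L^2(B)$ is the associated $A-A$ Hilbert bimodule. $H^n=\bigotimes_A^n H$ denotes the $n$-fold Connes relative tensor product over $A$. The centralizer algebra is $\mathcal{Q}_n=A'\cap (A^{\mathrm{op}})'\cap B(H^n)$, i.e. the bounded operators on $H^n$ commuting with the left and the right $A$-actions. Let $e_A$ denote the orthogonal projection of $L^2(B)$ onto $L^2(A)$ (an $A-A$ bilinear operator, the Jones projection). For $1\leq i\leq n$, the odd Jones projection $e_{2i-1}\in\mathcal{Q}_n$ is $$e_{2i-1}=\mathrm{id}_{H^{i-1}}\otimes_A e_A\otimes_A \mathrm{id}_{H^{n-i}}.$$ (If $(A_n)_{n\ge 0}$ is the Jones tower of $A_0=A\subset B=A_1$, then $L^2(A_n)\cong H^n$, $\mathcal{Q}_n\cong A_0'\cap A_{2n}$, and the projections above are identified with the projections $e_{2i-1}$ implementing the trace-preserving conditional expectations $A_{2i-1}\to A_{2i-2}$.) *)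

theory Defs
  imports "HOL-Analysis.Analysis"
begin

section \<open>Complex Hilbert spaces and bounded operators\<close>

text \<open>The inner product is linear in its first argument. The real Hilbert space structure of the
  library is the underlying one. Individual Hilbert spaces are closed complex subspaces
  of an ambient space of this class, so that a sequence of different Hilbert spaces can live in
  one type.\<close>

class chilbert_space = real_inner + complete_space +
  fixes scaleC :: "complex \<Rightarrow> 'a \<Rightarrow> 'a" (infixr "*\<^sub>C" 75)
    and cinner :: "'a \<Rightarrow> 'a \<Rightarrow> complex"
  assumes scaleC_add_right: "c *\<^sub>C (x + y) = c *\<^sub>C x + c *\<^sub>C y"
    and scaleC_add_left: "(c + d) *\<^sub>C x = c *\<^sub>C x + d *\<^sub>C x"
    and scaleC_scaleC: "c *\<^sub>C d *\<^sub>C x = (c * d) *\<^sub>C x"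
    and scaleC_of_real: "complex_of_real r *\<^sub>C x = r *\<^sub>R x"
    and cinner_commute: "cinner x y = cnj (cinner y x)"
    and cinner_add_left: "cinner (x + y) z = cinner x z + cinner y z"
    and cinner_scaleC_left: "cinner (c *\<^sub>C x) y = c * cinner x y"
    and inner_eq_Re_cinner: "inner x y = Re (cinner x y)"

definition hilbert :: "'k::chilbert_space set \<Rightarrow> bool" where
  "hilbert S \<longleftrightarrow> 0 \<in> S \<and> (\<forall>\<xi>\<in>S. \<forall>\<eta>\<in>S. \<xi> + \<eta> \<in> S) \<and> (\<forall>c. \<forall>\<xi>\<in>S. c *\<^sub>C \<xi> \<in> S) \<and> closed S"

text \<open>Operators on \<open>S\<close> are extensional functions (value \<open>undefined\<close> off \<open>S\<close>), so that equality of
  operators is equality on \<open>S\<close>. Their product is \<open>compose S\<close>, the identity is \<open>\<lambda>\<xi>\<in>S. \<xi>\<close>.\<close>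

definition bop :: "'k::chilbert_space set \<Rightarrow> ('k \<Rightarrow> 'k) set" where
  "bop S = {x \<in> extensional S. (\<forall>\<xi>\<in>S. x \<xi> \<in> S) \<and>
     (\<forall>\<xi>\<in>S. \<forall>\<eta>\<in>S. x (\<xi> + \<eta>) = x \<xi> + x \<eta>) \<and>
     (\<forall>c. \<forall>\<xi>\<in>S. x (c *\<^sub>C \<xi>) = c *\<^sub>C x \<xi>) \<and>
     (\<exists>K. \<forall>\<xi>\<in>S. norm (x \<xi>) \<le> K * norm \<xi>)}"

definition hadj :: "'k::chilbert_space set \<Rightarrow> ('k \<Rightarrow> 'k) \<Rightarrow> 'k \<Rightarrow> 'k" where
  "hadj S x = (THE y. y \<in> bop S \<and> (\<forall>\<xi>\<in>S. \<forall>\<eta>\<in>S. cinner (x \<xi>) \<eta> = cinner \<xi> (y \<eta>)))"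

definition oproj :: "'k::chilbert_space set \<Rightarrow> 'k set \<Rightarrow> 'k \<Rightarrow> 'k" where
  "oproj S T = (\<lambda>\<xi>\<in>S. THE \<eta>. \<eta> \<in> T \<and> (\<forall>\<zeta>\<in>T. cinner (\<xi> - \<eta>) \<zeta> = 0))"

section \<open>Von Neumann algebras and \<open>II\<^sub>1\<close>-factors\<close>

definition commutant :: "'k::chilbert_space set \<Rightarrow> ('k \<Rightarrow> 'k) set \<Rightarrow> ('k \<Rightarrow> 'k) set" where
  "commutant S M = {x \<in> bop S. \<forall>y\<in>M. \<forall>\<xi>\<in>S. x (y \<xi>) = y (x \<xi>)}"

definition von_neumann_algebra :: "'k::chilbert_space set \<Rightarrow> ('k \<Rightarrow> 'k) set \<Rightarrow> bool" where
  "von_neumann_algebra S M \<longleftrightarrow> hilbert S \<and> M \<subseteq> bop S \<and> (\<forall>x\<in>M. hadj S x \<in> M) \<and>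
     commutant S (commutant S M) = M"

definition factor :: "'k::chilbert_space set \<Rightarrow> ('k \<Rightarrow> 'k) set \<Rightarrow> bool" where
  "factor S M \<longleftrightarrow> von_neumann_algebra S M \<and> M \<inter> commutant S M = {\<lambda>\<xi>\<in>S. c *\<^sub>C \<xi> | c. True}"

definition infinite_dimensional :: "'k::chilbert_space set \<Rightarrow> ('k \<Rightarrow> 'k) set \<Rightarrow> bool" where
  "infinite_dimensional S M \<longleftrightarrow>
     \<not> (\<exists>F\<subseteq>M. finite F \<and> (\<forall>x\<in>M. \<exists>c. \<forall>\<xi>\<in>S. x \<xi> = (\<Sum>f\<in>F. c f *\<^sub>C f \<xi>)))"

text \<open>Faithful normal tracial states. Normality is ultraweak continuity: the ultraweakly continuous
  functionals are those of the form \<open>x \<mapsto> \<Sum>i. \<langle>x \<zeta>\<^sub>i, \<omega>\<^sub>i\<rangle>\<close> with square summable \<open>\<zeta>\<close>, \<open>\<omega>\<close>.\<close>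

definition tracial_state ::
    "'k::chilbert_space set \<Rightarrow> ('k \<Rightarrow> 'k) set \<Rightarrow> (('k \<Rightarrow> 'k) \<Rightarrow> complex) \<Rightarrow> bool" where
  "tracial_state S M \<tau> \<longleftrightarrow>
     (\<forall>x\<in>M. \<forall>y\<in>M. \<tau> (\<lambda>\<xi>\<in>S. x \<xi> + y \<xi>) = \<tau> x + \<tau> y) \<and>
     (\<forall>c. \<forall>x\<in>M. \<tau> (\<lambda>\<xi>\<in>S. c *\<^sub>C x \<xi>) = c * \<tau> x) \<and>
     \<tau> (\<lambda>\<xi>\<in>S. \<xi>) = 1 \<and>
     (\<forall>x\<in>M. \<tau> (compose S (hadj S x) x) \<in> \<real> \<and> 0 \<le> Re (\<tau> (compose S (hadj S x) x))) \<and>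
     (\<forall>x\<in>M. \<forall>y\<in>M. \<tau> (compose S x y) = \<tau> (compose S y x)) \<and>
     (\<forall>x\<in>M. \<tau> (compose S (hadj S x) x) = 0 \<longrightarrow> (\<forall>\<xi>\<in>S. x \<xi> = 0)) \<and>
     (\<exists>\<zeta> \<omega> :: nat \<Rightarrow> 'k. range \<zeta> \<subseteq> S \<and> range \<omega> \<subseteq> S \<and>
        summable (\<lambda>i. (norm (\<zeta> i))\<^sup>2) \<and> summable (\<lambda>i. (norm (\<omega> i))\<^sup>2) \<and>
        (\<forall>x\<in>M. (\<lambda>i. cinner (x (\<zeta> i)) (\<omega> i)) sums \<tau> x))"

definition II1_factor :: "'k::chilbert_space set \<Rightarrow> ('k \<Rightarrow> 'k) set \<Rightarrow> bool" where
  "II1_factor S M \<longleftrightarrow> factor S M \<and> infinite_dimensional S M \<and> (\<exists>\<tau>. tracial_state S M \<tau>)"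

definition is_projection :: "'k::chilbert_space set \<Rightarrow> ('k \<Rightarrow> 'k) \<Rightarrow> bool" where
  "is_projection S e \<longleftrightarrow> e \<in> bop S \<and> hadj S e = e \<and> compose S e e = e"

definition mvn_equiv ::
    "'k::chilbert_space set \<Rightarrow> ('k \<Rightarrow> 'k) set \<Rightarrow> ('k \<Rightarrow> 'k) \<Rightarrow> ('k \<Rightarrow> 'k) \<Rightarrow> bool" where
  "mvn_equiv S M e f \<longleftrightarrow> e \<in> M \<and> is_projection S e \<and> f \<in> M \<and> is_projection S f \<and>
     (\<exists>v\<in>M. compose S (hadj S v) v = e \<and> compose S v (hadj S v) = f)"

definition abelian :: "'k::chilbert_space set \<Rightarrow> ('k \<Rightarrow> 'k) set \<Rightarrow> bool" where
  "abelian S M \<longleftrightarrow> (\<forall>x\<in>M. \<forall>y\<in>M. compose S x y = compose S y x)"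

definition finite_vna :: "'k::chilbert_space set \<Rightarrow> ('k \<Rightarrow> 'k) set \<Rightarrow> bool" where
  "finite_vna S M \<longleftrightarrow>
     (\<forall>v\<in>M. compose S (hadj S v) v = (\<lambda>\<xi>\<in>S. \<xi>) \<longrightarrow> compose S v (hadj S v) = (\<lambda>\<xi>\<in>S. \<xi>))"

text \<open>The normalized trace of a finite factor (it is unique).\<close>

definition vtrace :: "'k::chilbert_space set \<Rightarrow> ('k \<Rightarrow> 'k) set \<Rightarrow> ('k \<Rightarrow> 'k) \<Rightarrow> complex" where
  "vtrace S M = (SOME \<tau>. tracial_state S M \<tau>)"

text \<open>The Murray--von Neumann coupling constant \<open>dim\<^sub>M(S)\<close> of a \<open>II\<^sub>1\<close>-factor \<open>M\<close> acting on \<open>S\<close>: the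
  quotient \<open>tr\<^sub>M [M'\<xi>] / tr\<^sub>M\<^sub>' [M\<xi>]\<close>, which does not depend on \<open>\<xi> \<noteq> 0\<close>, if \<open>M'\<close> is finite, and \<open>\<infinity>\<close>
  otherwise.\<close>

definition coupling_constant :: "'k::chilbert_space set \<Rightarrow> ('k \<Rightarrow> 'k) set \<Rightarrow> ennreal" where
  "coupling_constant S M =
     (if finite_vna S (commutant S M)
      then let \<xi> = (SOME \<xi>. \<xi> \<in> S \<and> \<xi> \<noteq> 0);
               p = oproj S (closure ((\<lambda>x. x \<xi>) ` commutant S M));
               q = oproj S (closure ((\<lambda>x. x \<xi>) ` M))
           in ennreal (Re (vtrace S M p) / Re (vtrace S (commutant S M) q))
      else \<infinity>)"

section \<open>Bimodules\<close>

text \<open>The algebras act as operators on all of a type \<open>'h\<close>. Here \<open>lact X a \<xi>\<close> is \<open>a \<xi>\<close> and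
  \<open>ract X a \<xi>\<close> is \<open>\<xi> a\<close>.\<close>

record ('h, 'k) bimod =
  hspace :: "'k set"
  lact :: "('h \<Rightarrow> 'h) \<Rightarrow> 'k \<Rightarrow> 'k"
  ract :: "('h \<Rightarrow> 'h) \<Rightarrow> 'k \<Rightarrow> 'k"

text \<open>\<open>X\<close> together with the inclusion \<open>hat\<close> of \<open>B\<close> into it is \<open>L\<^sup>2(B)\<close>: the Hilbert space completion of \<open>B\<close> for
  \<open>\<langle>x, y\<rangle> = \<tau>(y\<^sup>*x)\<close>, with the bounded extensions of left and right multiplication.\<close>

definition is_L2 :: "('h::chilbert_space \<Rightarrow> 'h) set \<Rightarrow> (('h \<Rightarrow> 'h) \<Rightarrow> complex) \<Rightarrow>
    ('h, 'k::chilbert_space) bimod \<Rightarrow> (('h \<Rightarrow> 'h) \<Rightarrow> 'k) \<Rightarrow> bool" where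
  "is_L2 B \<tau> X hat \<longleftrightarrow> hilbert (hspace X) \<and>
     (\<forall>x\<in>B. \<forall>y\<in>B. hat (\<lambda>\<xi>. x \<xi> + y \<xi>) = hat x + hat y) \<and>
     (\<forall>c. \<forall>x\<in>B. hat (\<lambda>\<xi>. c *\<^sub>C x \<xi>) = c *\<^sub>C hat x) \<and>
     (\<forall>x\<in>B. \<forall>y\<in>B. cinner (hat x) (hat y) = \<tau> (hadj UNIV y \<circ> x)) \<and>
     closure (hat ` B) = hspace X \<and>
     (\<forall>b\<in>B. lact X b \<in> bop (hspace X) \<and> (\<forall>x\<in>B. lact X b (hat x) = hat (b \<circ> x))) \<and>
     (\<forall>b\<in>B. ract X b \<in> bop (hspace X) \<and> (\<forall>x\<in>B. ract X b (hat x) = hat (x \<circ> b)))"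

text \<open>\<open>A' \<inter> (A\<^sup>o\<^sup>p)' \<inter> B(X)\<close>\<close>

definition centralizer ::
    "('h \<Rightarrow> 'h) set \<Rightarrow> ('h, 'k::chilbert_space) bimod \<Rightarrow> ('k \<Rightarrow> 'k) set" where
  "centralizer A X = commutant (hspace X) (lact X ` A \<union> ract X ` A)"

text \<open>The Jones index \<open>[B : A] = dim\<^sub>A L\<^sup>2(B)\<close>, where \<open>X\<close> is \<open>L\<^sup>2(B)\<close>.\<close>

definition jones_index :: "('h \<Rightarrow> 'h) set \<Rightarrow> ('h, 'k::chilbert_space) bimod \<Rightarrow> ennreal" where
  "jones_index A X = coupling_constant (hspace X) (lact X ` A)"

section \<open>The Connes relative tensor product\<close>

text \<open>The vectors \<open>\<xi>\<close> for which \<open>L\<^sub>\<xi> : a \<mapsto> \<xi> a\<close> extends to a bounded operator \<open>L\<^sup>2(A) \<rightarrow> X\<close>.\<close>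

definition bounded_vectors :: "('h::chilbert_space \<Rightarrow> 'h) set \<Rightarrow> (('h \<Rightarrow> 'h) \<Rightarrow> complex) \<Rightarrow>
    ('h, 'k::chilbert_space) bimod \<Rightarrow> 'k set" where
  "bounded_vectors A \<tau> X = {\<xi> \<in> hspace X.
     \<exists>K. \<forall>a\<in>A. norm (ract X a \<xi>) \<le> K * sqrt (Re (\<tau> (hadj UNIV a \<circ> a)))}"

text \<open>The \<open>A\<close>-valued inner product \<open>\<langle>\<xi>, \<eta>\<rangle>\<^sub>A = L\<^sub>\<xi>\<^sup>* L\<^sub>\<eta>\<close>, an operator on \<open>L\<^sup>2(A)\<close> commuting with the right
  action, hence an element \<open>a\<close> of \<open>A\<close>; the equation says \<open>\<langle>L\<^sub>\<eta> x, L\<^sub>\<xi> y\<rangle> = \<langle>a x, y\<rangle>\<close> in \<open>L\<^sup>2(A)\<close>.\<close>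

definition A_inner :: "('h::chilbert_space \<Rightarrow> 'h) set \<Rightarrow> (('h \<Rightarrow> 'h) \<Rightarrow> complex) \<Rightarrow>
    ('h, 'k::chilbert_space) bimod \<Rightarrow> 'k \<Rightarrow> 'k \<Rightarrow> 'h \<Rightarrow> 'h" where
  "A_inner A \<tau> X \<xi> \<eta> = (THE a. a \<in> A \<and>
     (\<forall>x\<in>A. \<forall>y\<in>A. cinner (ract X x \<eta>) (ract X y \<xi>) = \<tau> (hadj UNIV y \<circ> a \<circ> x)))"

text \<open>\<open>T\<close> with \<open>(\<xi>, \<eta>) \<mapsto> t \<xi> \<eta> = \<xi> \<otimes> \<eta>\<close> is \<open>X \<otimes>\<^sub>A Y\<close>: the separation and completion of the algebraic
  tensor product of the bounded vectors of \<open>X\<close> with \<open>Y\<close>, for the form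
  \<open>\<langle>\<xi>\<^sub>1 \<otimes> \<eta>\<^sub>1, \<xi>\<^sub>2 \<otimes> \<eta>\<^sub>2\<rangle> = \<langle>\<langle>\<xi>\<^sub>2, \<xi>\<^sub>1\<rangle>\<^sub>A \<eta>\<^sub>1, \<eta>\<^sub>2\<rangle>\<close>. The set of elementary tensors is closed under
  complex multiples, so its real span is its complex span.\<close>

definition is_connes_tensor :: "('h::chilbert_space \<Rightarrow> 'h) set \<Rightarrow> (('h \<Rightarrow> 'h) \<Rightarrow> complex) \<Rightarrow>
    ('h, 'k::chilbert_space) bimod \<Rightarrow> ('h, 'k) bimod \<Rightarrow> ('h, 'k) bimod \<Rightarrow> ('k \<Rightarrow> 'k \<Rightarrow> 'k) \<Rightarrow> bool"
  where
  "is_connes_tensor A \<tau> X Y T t \<longleftrightarrow>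
     (let X0 = bounded_vectors A \<tau> X in
      hilbert (hspace T) \<and>
      (\<forall>\<xi>\<in>X0. \<forall>\<eta>\<in>hspace Y. t \<xi> \<eta> \<in> hspace T) \<and>
      (\<forall>\<xi>\<in>X0. \<forall>\<xi>'\<in>X0. \<forall>\<eta>\<in>hspace Y. t (\<xi> + \<xi>') \<eta> = t \<xi> \<eta> + t \<xi>' \<eta>) \<and>
      (\<forall>\<xi>\<in>X0. \<forall>\<eta>\<in>hspace Y. \<forall>\<eta>'\<in>hspace Y. t \<xi> (\<eta> + \<eta>') = t \<xi> \<eta> + t \<xi> \<eta>') \<and>
      (\<forall>c. \<forall>\<xi>\<in>X0. \<forall>\<eta>\<in>hspace Y. t (c *\<^sub>C \<xi>) \<eta> = c *\<^sub>C t \<xi> \<eta> \<and> t \<xi> (c *\<^sub>C \<eta>) = c *\<^sub>C t \<xi> \<eta>) \<and>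
      (\<forall>\<xi>1\<in>X0. \<forall>\<xi>2\<in>X0. \<forall>\<eta>1\<in>hspace Y. \<forall>\<eta>2\<in>hspace Y.
         cinner (t \<xi>1 \<eta>1) (t \<xi>2 \<eta>2) = cinner (lact Y (A_inner A \<tau> X \<xi>2 \<xi>1) \<eta>1) \<eta>2) \<and>
      closure (span {t \<xi> \<eta> | \<xi> \<eta>. \<xi> \<in> X0 \<and> \<eta> \<in> hspace Y}) = hspace T \<and>
      (\<forall>a\<in>A. lact T a \<in> bop (hspace T) \<and>
         (\<forall>\<xi>\<in>X0. \<forall>\<eta>\<in>hspace Y. lact T a (t \<xi> \<eta>) = t (lact X a \<xi>) \<eta>)) \<and>
      (\<forall>a\<in>A. ract T a \<in> bop (hspace T) \<and>
         (\<forall>\<xi>\<in>X0. \<forall>\<eta>\<in>hspace Y. ract T a (t \<xi> \<eta>) = t \<xi> (ract Y a \<eta>))))"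

text \<open>\<open>x \<otimes>\<^sub>A y\<close> for bilinear operators \<open>x\<close> on \<open>X\<close> and \<open>y\<close> on \<open>Y\<close>.\<close>

definition op_tensor :: "('h::chilbert_space \<Rightarrow> 'h) set \<Rightarrow> (('h \<Rightarrow> 'h) \<Rightarrow> complex) \<Rightarrow>
    ('h, 'k::chilbert_space) bimod \<Rightarrow> ('h, 'k) bimod \<Rightarrow> ('h, 'k) bimod \<Rightarrow> ('k \<Rightarrow> 'k \<Rightarrow> 'k) \<Rightarrow>
    ('k \<Rightarrow> 'k) \<Rightarrow> ('k \<Rightarrow> 'k) \<Rightarrow> 'k \<Rightarrow> 'k" where
  "op_tensor A \<tau> X Y T t x y = (THE z. z \<in> bop (hspace T) \<and>
     (\<forall>\<xi>\<in>bounded_vectors A \<tau> X. \<forall>\<eta>\<in>hspace Y. z (t \<xi> \<eta>) = t (x \<xi>) (y \<eta>)))"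

text \<open>\<open>H m\<close> for \<open>1 \<le> m \<le> n\<close> are the tensor powers of \<open>H 1 = L\<^sup>2(B)\<close>, bracketed to the right, that is
  \<open>H (m + 1) = L\<^sup>2(B) \<otimes>\<^sub>A H m\<close> with elementary tensors given by \<open>t m\<close>.\<close>

definition tensor_powers :: "('h::chilbert_space \<Rightarrow> 'h) set \<Rightarrow> ('h \<Rightarrow> 'h) set \<Rightarrow>
    (('h \<Rightarrow> 'h) \<Rightarrow> complex) \<Rightarrow> (nat \<Rightarrow> ('h, 'k::chilbert_space) bimod) \<Rightarrow>
    (('h \<Rightarrow> 'h) \<Rightarrow> 'k) \<Rightarrow> (nat \<Rightarrow> 'k \<Rightarrow> 'k \<Rightarrow> 'k) \<Rightarrow> nat \<Rightarrow> bool" where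
  "tensor_powers A B \<tau> H hat t n \<longleftrightarrow> is_L2 B \<tau> (H 1) hat \<and>
     (\<forall>m. 1 \<le> m \<and> m < n \<longrightarrow> is_connes_tensor A \<tau> (H 1) (H m) (H (Suc m)) (t m))"

text \<open>\<open>jones_proj \<dots> n i\<close> is \<open>e\<^sub>2\<^sub>i\<^sub>-\<^sub>1 = id\<^bsup>i-1\<^esup> \<otimes> e\<^sub>A \<otimes> id\<^bsup>n-i\<^esup>\<close> on \<open>H n\<close>, for \<open>1 \<le> i \<le> n\<close>, computed along the
  bracketing above; \<open>e\<^sub>A\<close> projects \<open>L\<^sup>2(B)\<close> onto \<open>L\<^sup>2(A)\<close>, the closure of \<open>A\<close> in it.\<close>

primrec jones_proj :: "('h::chilbert_space \<Rightarrow> 'h) set \<Rightarrow>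
    (('h \<Rightarrow> 'h) \<Rightarrow> complex) \<Rightarrow> (nat \<Rightarrow> ('h, 'k::chilbert_space) bimod) \<Rightarrow>
    (('h \<Rightarrow> 'h) \<Rightarrow> 'k) \<Rightarrow> (nat \<Rightarrow> 'k \<Rightarrow> 'k \<Rightarrow> 'k) \<Rightarrow> nat \<Rightarrow> nat \<Rightarrow> 'k \<Rightarrow> 'k" where
  "jones_proj A \<tau> H hat t 0 i = undefined"
| "jones_proj A \<tau> H hat t (Suc m) i =
    (let eA = oproj (hspace (H 1)) (closure (hat ` A)) in
     if m = 0 then eA
     else if i = 1
     then op_tensor A \<tau> (H 1) (H m) (H (Suc m)) (t m) eA (\<lambda>\<xi>\<in>hspace (H m). \<xi>)
     else op_tensor A \<tau> (H 1) (H m) (H (Suc m)) (t m)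
            (\<lambda>\<xi>\<in>hspace (H 1). \<xi>) (jones_proj A \<tau> H hat t m (i - 1)))"

end

theory Submission
  imports Defs
begin

text \<open>The range of \<open>e\<^sub>2\<^sub>i\<^sub>-\<^sub>1\<close> is \<open>H\<^bsup>i-1\<^esup> \<otimes>\<^sub>A L\<^sup>2(A) \<otimes>\<^sub>A H\<^bsup>n-i\<^esup>\<close>, which is isomorphic to
  \<open>H\<^bsup>n-1\<^esup>\<close> as a bimodule: inserting the trace vector \<open>\<Omega>\<close> in the \<open>i\<close>-th slot is a bilinear
  isometry \<open>W\<^sub>i\<close> from \<open>H\<^bsup>n-1\<^esup>\<close> onto this range, and \<open>W\<^sub>j W\<^sub>i\<^sup>*\<close> is a partial isometry from
  \<open>e\<^sub>2\<^sub>i\<^sub>-\<^sub>1\<close> to \<open>e\<^sub>2\<^sub>j\<^sub>-\<^sub>1\<close>. In an abelian algebra equivalent projections coincide, whereas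
  \<open>e\<^sub>1\<close> and \<open>e\<^sub>3\<close> differ on \<open>\<xi> \<otimes> \<Omega> \<otimes> \<dots> \<otimes> \<Omega>\<close> for every bounded \<open>\<xi> \<noteq> 0\<close> orthogonal to \<open>L\<^sup>2(A)\<close>.
  Such \<open>\<xi>\<close> exists, since if \<open>L\<^sup>2(A)\<close> were all of \<open>L\<^sup>2(B)\<close>, the commutant of \<open>A\<close> would be finite
  with trace vector \<open>\<Omega>\<close>, and the index would be finite. That \<open>A\<close>-valued inner products take
  values in \<open>A\<close> rests on the theorem that left bounded vectors of \<open>L\<^sup>2(A)\<close> lie in \<open>A\<close>, where
  normality of the trace enters.\<close>

section \<open>Complex inner products\<close>

text \<open>The obstacle is that \<open>A\<close> is given by its double commutant on an ambient
  space that need not be \<open>L^2(A)\<close>, while the tensor product asks for elements of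
  \<open>A\<close> determined by inner products in \<open>L^2(B)\<close>. A vector of
  \<open>L^2(A)\<close> has to be turned into an operator on the ambient space. The bridge consists
  of the vectors u there for which norm (x u) is at most a constant times the trace norm of x: on
  them, convergence of hat (a n) in \<open>L^2\<close> becomes convergence of a n u. The limit
  operator must be bounded by a constant that does not depend on u; for this, left and right module
  maps are shown to commute, and a moment argument stands in for the square root of a positive
  operator. The powers are bracketed to the right, so the isometry for slot i + 1 is the identity
  tensored with the isometry for slot i of the shorter power, and no associativity isomorphism
  enters. The recursion for the last slot ends differently from the others: there the map u -> u
  \<otimes> \<Omega> is given on bounded u and extended by continuity.\<close>

lemma scaleC_one [simp]: "1 *\<^sub>C (x::'a::chilbert_space) = x"
  using scaleC_of_real[of 1 x] by simp

lemma scaleC_zero_left [simp]: "0 *\<^sub>C (x::'a::chilbert_space) = 0"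
  using scaleC_of_real[of 0 x] by simp

lemma scaleC_zero_right [simp]: "c *\<^sub>C (0::'a::chilbert_space) = 0"
  using scaleC_add_right[of c 0 0] by simp

lemma scaleC_minus_one [simp]: "(-1) *\<^sub>C (x::'a::chilbert_space) = - x"
  using scaleC_of_real[of "-1" x] by simp

lemma scaleC_minus_right: "c *\<^sub>C (- x) = - (c *\<^sub>C (x::'a::chilbert_space))"
  using scaleC_add_right[of c x "-x"] by (metis add.right_inverse add_eq_0_iff scaleC_zero_right)

lemma scaleC_diff_right: "c *\<^sub>C (x - y) = c *\<^sub>C x - c *\<^sub>C (y::'a::chilbert_space)"
  using scaleC_add_right[of c x "-y"] by (simp add: scaleC_minus_right)

lemma cinner_add_right: "cinner x (y + z) = cinner x y + cinner x z"
  by (metis cinner_add_left cinner_commute complex_cnj_add)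

lemma cinner_scaleC_right: "cinner x (c *\<^sub>C y) = cnj c * cinner x y"
  by (metis cinner_commute cinner_scaleC_left complex_cnj_mult)

lemma cinner_zero_left [simp]: "cinner 0 x = 0"
  using cinner_add_left[of 0 0 x] by simp

lemma cinner_zero_right [simp]: "cinner x 0 = 0"
  using cinner_add_right[of x 0 0] by simp

lemma cinner_minus_left: "cinner (- x) y = - cinner x y"
  using cinner_scaleC_left[of "-1" x y] by simp

lemma cinner_minus_right: "cinner x (- y) = - cinner x y"
  using cinner_scaleC_right[of x "-1" y] by simp

lemma cinner_diff_left: "cinner (x - y) z = cinner x z - cinner y z"
  using cinner_add_left[of x "-y" z] by (simp add: cinner_minus_left)

lemma cinner_diff_right: "cinner x (y - z) = cinner x y - cinner x z"
  using cinner_add_right[of x y "-z"] by (simp add: cinner_minus_right)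

lemma cinner_same: "cinner x x = complex_of_real ((norm x)\<^sup>2)"
proof -
  have "Im (cinner x x) = 0" using arg_cong[OF cinner_commute[of x x], of Im] by simp
  moreover have "Re (cinner x x) = (norm x)\<^sup>2"
    using inner_eq_Re_cinner[of x x] by (simp add: power2_norm_eq_inner)
  ultimately show ?thesis by (simp add: complex_eq_iff)
qed

lemma cinner_same_eq_0 [simp]: "cinner x x = 0 \<longleftrightarrow> x = 0"
  by (simp add: cinner_same)

text \<open>Recovers the complex product from the real one, which turns real orthogonality to a
  complex subspace into complex orthogonality.\<close>

lemma cinner_eq_inner: "cinner x y = Complex (inner x y) (inner x (\<i> *\<^sub>C y))"
  by (simp add: inner_eq_Re_cinner cinner_scaleC_right complex_eq_iff)

lemma norm_scaleC: "norm (c *\<^sub>C x) = cmod c * norm x"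
proof -
  have "complex_of_real ((norm (c *\<^sub>C x))\<^sup>2) = c * cnj c * complex_of_real ((norm x)\<^sup>2)"
    unfolding cinner_same[symmetric] by (simp add: cinner_scaleC_left cinner_scaleC_right)
  also have "\<dots> = complex_of_real ((cmod c * norm x)\<^sup>2)"
    by (simp add: complex_norm_square[symmetric] power_mult_distrib)
  finally have "(norm (c *\<^sub>C x))\<^sup>2 = (cmod c * norm x)\<^sup>2" using of_real_eq_iff by blast
  then show ?thesis by simp
qed

text \<open>A unimodular factor rotates the inner product onto the positive axis, which reduces the
  claim to the real inequality.\<close>

lemma cinner_Cauchy_Schwarz: "cmod (cinner x y) \<le> norm x * norm y"
proof -
  obtain c where c: "cmod c = 1" "complex_of_real (cmod (cinner x y)) = c * cinner x y"
  proof (cases "cinner x y = 0")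
    case False
    show ?thesis
    proof (rule that[of "cmod (cinner x y) / cinner x y"])
      show "cmod (cmod (cinner x y) / cinner x y) = 1" using False by (simp add: norm_divide)
    qed (use False in simp)
  qed (use that[of 1] in simp)
  then have "cmod (cinner x y) = Re (c * cinner x y)"
    by (metis Re_complex_of_real)
  also have "\<dots> = inner (c *\<^sub>C x) y" by (simp add: inner_eq_Re_cinner cinner_scaleC_left)
  also have "\<dots> \<le> norm (c *\<^sub>C x) * norm y" by (rule norm_cauchy_schwarz)
  also have "\<dots> = norm x * norm y" by (simp add: norm_scaleC c)
  finally show ?thesis .
qed

lemma scaleC_scaleR: "c *\<^sub>C (r *\<^sub>R x) = r *\<^sub>R (c *\<^sub>C (x::'a::chilbert_space))"
  by (simp add: scaleC_scaleC mult.commute flip: scaleC_of_real)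

lemma bounded_linear_scaleC: "bounded_linear (\<lambda>x::'a::chilbert_space. c *\<^sub>C x)"
  by (rule bounded_linear_intro[where K="cmod c"])
     (simp_all add: scaleC_add_right scaleC_scaleR norm_scaleC mult.commute)

lemma bounded_bilinear_cinner: "bounded_bilinear (cinner :: 'a::chilbert_space \<Rightarrow> _)"
proof (rule bounded_bilinear.intro)
  show "\<exists>K. \<forall>a b::'a. cmod (cinner a b) \<le> norm a * norm b * K"
    using cinner_Cauchy_Schwarz by (metis mult.right_neutral)
qed (simp_all add: cinner_add_left cinner_add_right cinner_scaleC_left cinner_scaleC_right
       scaleR_conv_of_real flip: scaleC_of_real)

lemmas tendsto_scaleC [tendsto_intros] = bounded_linear.tendsto[OF bounded_linear_scaleC]
lemmas tendsto_cinner [tendsto_intros] = bounded_bilinear.tendsto[OF bounded_bilinear_cinner]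
lemmas continuous_on_scaleC [continuous_intros] = bounded_linear.continuous_on[OF
    bounded_linear_scaleC]
lemmas continuous_on_cinner [continuous_intros] = bounded_bilinear.continuous_on[OF
    bounded_bilinear_cinner]

text \<open>Products house the graphs of operators, on which both the extension principle and the
  construction of trace bounded vectors rest.\<close>

instantiation prod :: (chilbert_space, chilbert_space) chilbert_space
begin
definition "c *\<^sub>C x = (c *\<^sub>C fst x, c *\<^sub>C snd x)"
definition "cinner x y = cinner (fst x) (fst y) + cinner (snd x) (snd y)"
instance
proof
  fix x y z :: "'a \<times> 'b" and c d :: complex and r :: real
  show "cinner x y = cnj (cinner y x)"
    by (metis cinner_commute cinner_prod_def complex_cnj_add)
qed (simp_all add: scaleC_prod_def cinner_prod_def scaleC_add_right scaleC_add_left scaleC_scaleC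
      scaleC_of_real scaleR_prod_def cinner_add_left cinner_scaleC_left algebra_simps
      inner_prod_def inner_eq_Re_cinner plus_prod_def)
end

section \<open>Square summable sequences\<close>

text \<open>Turns the two square summable sequences of a normal functional into single vectors, so
  that the trace becomes a vector functional of the amplified representation.\<close>

typedef (overloaded) ('a::chilbert_space) ell2 = "{f::nat \<Rightarrow> 'a. summable (\<lambda>i. (norm (f i))\<^sup>2)}"
  morphisms ell2_nth Abs_ell2
  by (rule exI[of _ "\<lambda>_. 0"]) simp

lemma ell2_eqI: "(\<And>i. ell2_nth x i = ell2_nth y i) \<Longrightarrow> x = y"
  by (metis ell2_nth_inject ext)

lemma ell2_summable: "summable (\<lambda>i. (norm (ell2_nth x i))\<^sup>2)"
  using ell2_nth[of x] by simp

lemma square_summable_cinner: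
  fixes f g :: "nat \<Rightarrow> 'a::chilbert_space"
  assumes "summable (\<lambda>i. (norm (f i))\<^sup>2)" "summable (\<lambda>i. (norm (g i))\<^sup>2)"
  shows "summable (\<lambda>i. cinner (f i) (g i))"
proof (rule summable_comparison_test'[where N=0])
  show "summable (\<lambda>i. (norm (f i))\<^sup>2 + (norm (g i))\<^sup>2)" using assms by (rule summable_add)
  show "cmod (cinner (f n) (g n)) \<le> (norm (f n))\<^sup>2 + (norm (g n))\<^sup>2" for n
  proof -
    have "cmod (cinner (f n) (g n)) \<le> norm (f n) * norm (g n)" by (rule cinner_Cauchy_Schwarz)
    also have "2 * \<dots> \<le> (norm (f n))\<^sup>2 + (norm (g n))\<^sup>2"
      using sum_squares_bound[of "norm (f n)" "norm (g n)"] by simp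
    finally show ?thesis by (smt (verit) norm_ge_zero)
  qed
qed

lemma square_summable_add:
  fixes f g :: "nat \<Rightarrow> 'a::chilbert_space"
  assumes "summable (\<lambda>i. (norm (f i))\<^sup>2)" "summable (\<lambda>i. (norm (g i))\<^sup>2)"
  shows "summable (\<lambda>i. (norm (f i + g i))\<^sup>2)"
proof -
  have "(norm (f i + g i))\<^sup>2 = (norm (f i))\<^sup>2 + (norm (g i))\<^sup>2 + 2 * Re (cinner (f i) (g i))" for i
    by (simp add: power2_norm_eq_inner inner_add_left inner_add_right inner_commute flip:
        inner_eq_Re_cinner)
  then show ?thesis
    using assms square_summable_cinner[OF assms]
    by (auto intro!: summable_add summable_mult summable_Re)
qed

lemma square_summable_scaleC:
  fixes f :: "nat \<Rightarrow> 'a::chilbert_space"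
  assumes "summable (\<lambda>i. (norm (f i))\<^sup>2)"
  shows "summable (\<lambda>i. (norm (c *\<^sub>C f i))\<^sup>2)"
  using assms by (auto simp: norm_scaleC power_mult_distrib intro: summable_mult)

text \<open>Real scalars and signs are written with \<open>*\<^sub>C\<close>, so that
  \<open>square_summable_add\<close> and \<open>square_summable_scaleC\<close> settle every
  operation.\<close>

instantiation ell2 :: (chilbert_space) real_inner
begin
definition "0 = Abs_ell2 (\<lambda>_. 0)"
definition "x + y = Abs_ell2 (\<lambda>i. ell2_nth x i + ell2_nth y i)"
definition "r *\<^sub>R x = Abs_ell2 (\<lambda>i. complex_of_real r *\<^sub>C ell2_nth x i)"
definition "- x = Abs_ell2 (\<lambda>i. (-1) *\<^sub>C ell2_nth x i)"
definition "x - y = Abs_ell2 (\<lambda>i. ell2_nth x i + (-1) *\<^sub>C ell2_nth y i)"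
definition "inner x y = (\<Sum>i. inner (ell2_nth x i) (ell2_nth y i))"
definition norm_ell2 :: "'a ell2 \<Rightarrow> real" where "norm_ell2 x = sqrt (inner x x)"
definition sgn_ell2 :: "'a ell2 \<Rightarrow> 'a ell2" where "sgn_ell2 x = scaleR (inverse (norm x)) x"
definition dist_ell2 :: "'a ell2 \<Rightarrow> 'a ell2 \<Rightarrow> real" where "dist_ell2 x y = norm (x - y)"
definition [code del]: "(uniformity :: ('a ell2 \<times> 'a ell2) filter) =
  (INF e\<in>{0<..}. principal {(x, y). dist x y < e})"
definition [code del]: "open (U :: 'a ell2 set) \<longleftrightarrow>
  (\<forall>x\<in>U. eventually (\<lambda>(x', y). x' = x \<longrightarrow> y \<in> U) uniformity)"

lemma ell2_nth_zero [simp]: "ell2_nth 0 i = 0"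
  by (simp add: zero_ell2_def Abs_ell2_inverse)

lemma ell2_nth_add [simp]: "ell2_nth (x + y) i = ell2_nth x i + ell2_nth y i"
  by (simp add: plus_ell2_def Abs_ell2_inverse square_summable_add ell2_summable)

lemma ell2_nth_scaleR [simp]: "ell2_nth (r *\<^sub>R x) i = r *\<^sub>R ell2_nth x i"
  unfolding scaleR_ell2_def
  by (subst Abs_ell2_inverse, simp only: mem_Collect_eq square_summable_scaleC square_summable_add
      ell2_summable, simp add: scaleC_of_real)

lemma ell2_nth_minus [simp]: "ell2_nth (- x) i = - ell2_nth x i"
  unfolding uminus_ell2_def
  by (subst Abs_ell2_inverse, simp only: mem_Collect_eq square_summable_scaleC square_summable_add
      ell2_summable, simp add: scaleC_of_real)

lemma ell2_nth_diff [simp]: "ell2_nth (x - y) i = ell2_nth x i - ell2_nth y i"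
  unfolding minus_ell2_def
  by (subst Abs_ell2_inverse, simp only: mem_Collect_eq square_summable_scaleC square_summable_add
      ell2_summable, simp add: scaleC_of_real)

lemma ell2_inner_sums: "(\<lambda>i. inner (ell2_nth x i) (ell2_nth y i)) sums inner x y"
  unfolding inner_ell2_def inner_eq_Re_cinner
  by (intro summable_sums summable_Re square_summable_cinner ell2_summable)

lemma ell2_norm_sums: "(\<lambda>i. (norm (ell2_nth x i))\<^sup>2) sums inner x x"
  using ell2_inner_sums[of x x] by (simp add: power2_norm_eq_inner)

instance
proof
  fix x y z :: "'a ell2" and r s :: real
  show "inner x y = inner y x"
    using ell2_inner_sums[of x y] ell2_inner_sums[of y x] by (simp add: inner_commute sums_unique2)
  show "inner (x + y) z = inner x z + inner y z"
    using ell2_inner_sums[of "x + y" z] sums_add[OF ell2_inner_sums[of x z] ell2_inner_sums[of y z]]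
    by (simp add: inner_add_left sums_unique2)
  show "inner (r *\<^sub>R x) y = r * inner x y"
    using ell2_inner_sums[of "r *\<^sub>R x" y] sums_mult[OF ell2_inner_sums[of x y], of r]
    by (simp add: sums_unique2)
  show "0 \<le> inner x x"
    using sums_le[OF _ sums_zero ell2_norm_sums[of x]] by simp
  show "inner x x = 0 \<longleftrightarrow> x = 0"
  proof
    assume "inner x x = 0"
    then have s: "(\<lambda>i. (norm (ell2_nth x i))\<^sup>2) sums 0" using ell2_norm_sums[of x] by simp
    have "(norm (ell2_nth x i))\<^sup>2 = 0" for i
      using suminf_eq_zero_iff[OF sums_summable[OF s]] sums_unique[OF s] by simp
    then show "x = 0" by (intro ell2_eqI) simp
  next
    assume "x = 0"
    then have "(\<lambda>i. (norm (ell2_nth x i))\<^sup>2) = (\<lambda>i. 0)" by simp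
    then show "inner x x = 0" using ell2_norm_sums[of x] by (simp add: sums_unique2[OF _ sums_zero])
  qed
  show "(uniformity :: ('a ell2 \<times> 'a ell2) filter) =
      (INF e\<in>{0<..}. principal {(x, y). dist x y < e})" by (rule uniformity_ell2_def)
  show "open U \<longleftrightarrow> (\<forall>x\<in>U. eventually (\<lambda>(x', y). x' = x \<longrightarrow> y \<in> U) uniformity)" for U :: "'a ell2 set"
    by (rule open_ell2_def)
qed (auto intro!: ell2_eqI simp: norm_ell2_def sgn_ell2_def dist_ell2_def scaleR_add_left
    scaleR_add_right)
end

lemma ell2_norm2_sums: "(\<lambda>i. (norm (ell2_nth x i))\<^sup>2) sums (norm x)\<^sup>2"
  using ell2_norm_sums[of x] by (simp add: power2_norm_eq_inner)

lemma norm_ell2_nth_le: "norm (ell2_nth x i) \<le> norm x"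
proof -
  have "(norm (ell2_nth x i))\<^sup>2 \<le> (norm x)\<^sup>2"
    using sum_le_suminf[OF ell2_summable, of "{i}" x] sums_unique[OF ell2_norm2_sums[of x]] by simp
  then show ?thesis by (simp add: power2_le_iff_abs_le)
qed

instance ell2 :: (chilbert_space) complete_space
proof
  fix X :: "nat \<Rightarrow> 'a ell2"
  assume X: "Cauchy X"
  have "Cauchy (\<lambda>n. ell2_nth (X n) i)" for i
  proof (rule metric_CauchyI)
    fix e :: real assume "e > 0"
    then obtain N where N: "\<And>m n. m \<ge> N \<Longrightarrow> n \<ge> N \<Longrightarrow> dist (X m) (X n) < e"
      using X by (meson metric_CauchyD)
    have "dist (ell2_nth (X m) i) (ell2_nth (X n) i) \<le> dist (X m) (X n)" for m n
      using norm_ell2_nth_le[of "X m - X n" i] by (simp add: dist_norm)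
    then show "\<exists>N. \<forall>m\<ge>N. \<forall>n\<ge>N. dist (ell2_nth (X m) i) (ell2_nth (X n) i) < e"
      using N by (meson order.strict_trans1)
  qed
  then have "\<exists>l. (\<lambda>n. ell2_nth (X n) i) \<longlonglongrightarrow> l" for i
    by (meson Cauchy_convergent convergentD)
  then obtain l where l: "\<And>i. (\<lambda>n. ell2_nth (X n) i) \<longlonglongrightarrow> l i" by metis
  \<comment> \<open>For finitely many coordinates the limit in n can be taken inside the sum; a
    bound uniform in k then passes to the series.\<close>
  have *: "\<exists>N. \<forall>m\<ge>N. \<forall>k. (\<Sum>i<k. (norm (ell2_nth (X m) i - l i))\<^sup>2) \<le> e\<^sup>2" if "e > 0" for e
  proof -
    obtain N where N: "\<And>m n. m \<ge> N \<Longrightarrow> n \<ge> N \<Longrightarrow> dist (X m) (X n) < e"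
      using X \<open>e > 0\<close> by (meson metric_CauchyD)
    have "(\<Sum>i<k. (norm (ell2_nth (X m) i - l i))\<^sup>2) \<le> e\<^sup>2" if "m \<ge> N" for m k
    proof (rule LIMSEQ_le_const2)
      show "(\<lambda>n. \<Sum>i<k. (norm (ell2_nth (X m) i - ell2_nth (X n) i))\<^sup>2)
          \<longlonglongrightarrow> (\<Sum>i<k. (norm (ell2_nth (X m) i - l i))\<^sup>2)"
        by (intro tendsto_intros l)
      have "(\<Sum>i<k. (norm (ell2_nth (X m) i - ell2_nth (X n) i))\<^sup>2) \<le> e\<^sup>2" if "n \<ge> N" for n
      proof -
        have "(\<Sum>i<k. (norm (ell2_nth (X m - X n) i))\<^sup>2) \<le> (norm (X m - X n))\<^sup>2"
          using sum_le_suminf[OF ell2_summable, of "{..<k}" "X m - X n"]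
            sums_unique[OF ell2_norm2_sums[of "X m - X n"]] by simp
        also have "\<dots> \<le> e\<^sup>2"
          using N[OF \<open>m \<ge> N\<close> \<open>n \<ge> N\<close>] by (intro power_mono) (auto simp: dist_norm)
        finally show ?thesis by simp
      qed
      then show "\<exists>N. \<forall>n\<ge>N. (\<Sum>i<k. (norm (ell2_nth (X m) i - ell2_nth (X n) i))\<^sup>2) \<le> e\<^sup>2" by blast
    qed
    then show ?thesis by blast
  qed
  have sm: "summable (\<lambda>i. (norm (ell2_nth (X m) i - l i))\<^sup>2)"
    if "\<forall>k. (\<Sum>i<k. (norm (ell2_nth (X m) i - l i))\<^sup>2) \<le> e\<^sup>2" for m e
    using that by (intro bounded_imp_summable[where B="e\<^sup>2"])
        (simp_all add: lessThan_Suc_atMost[symmetric] del: sum.lessThan_Suc)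
  \<comment> \<open>One error bound, here with e = 1, makes the limit square summable: it differs
    from \<open>X N\<close> by a square summable sequence.\<close>
  obtain N where "\<forall>k. (\<Sum>i<k. (norm (ell2_nth (X N) i - l i))\<^sup>2) \<le> 1\<^sup>2" using *[of 1] by auto
  from square_summable_add[OF sm[OF this] square_summable_scaleC[OF ell2_summable[of "X N"], of
      "-1"]]
  have "summable (\<lambda>i. (norm (l i))\<^sup>2)" by simp
  then have L: "ell2_nth (Abs_ell2 l) i = l i" for i by (simp add: Abs_ell2_inverse)
  have "X \<longlonglongrightarrow> Abs_ell2 l"
  proof (rule metric_LIMSEQ_I)
    fix e :: real assume "e > 0"
    then obtain N where N: "\<And>m k. m \<ge> N \<Longrightarrow> (\<Sum>i<k. (norm (ell2_nth (X m) i - l i))\<^sup>2) \<le> (e/2)\<^sup>2"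
      using *[of "e/2"] by auto
    have "dist (X m) (Abs_ell2 l) < e" if "m \<ge> N" for m
    proof -
      have "(norm (X m - Abs_ell2 l))\<^sup>2 = (\<Sum>i. (norm (ell2_nth (X m) i - l i))\<^sup>2)"
        using ell2_norm2_sums[of "X m - Abs_ell2 l"] by (simp add: sums_unique L)
      also have "\<dots> \<le> (e/2)\<^sup>2"
        by (rule suminf_le_const[OF sm[of _ "e/2"]]) (use N[OF that] in auto)
      finally have "norm (X m - Abs_ell2 l) \<le> e/2"
        using \<open>e > 0\<close> by (simp add: power2_le_iff_abs_le)
      then show ?thesis using \<open>e > 0\<close> by (simp add: dist_norm)
    qed
    then show "\<exists>N. \<forall>m\<ge>N. dist (X m) (Abs_ell2 l) < e" by blast
  qed
  then show "convergent X" by (rule convergentI)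
qed

instantiation ell2 :: (chilbert_space) chilbert_space
begin
definition "c *\<^sub>C x = Abs_ell2 (\<lambda>i. c *\<^sub>C ell2_nth x i)"
definition "cinner x y = (\<Sum>i. cinner (ell2_nth x i) (ell2_nth y i))"

lemma ell2_nth_scaleC [simp]: "ell2_nth (c *\<^sub>C x) i = c *\<^sub>C ell2_nth x i"
  by (simp add: scaleC_ell2_def Abs_ell2_inverse square_summable_scaleC ell2_summable)

lemma ell2_cinner_summable: "summable (\<lambda>i. cinner (ell2_nth x i) (ell2_nth y i))"
  by (intro square_summable_cinner ell2_summable)

instance
proof
  fix x y z :: "'a ell2" and c d :: complex and r :: real
  show "inner x y = Re (cinner x y)"
    by (simp add: inner_ell2_def cinner_ell2_def inner_eq_Re_cinner Re_suminf ell2_cinner_summable)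
  have "(\<lambda>i. cinner (ell2_nth x i) (ell2_nth y i)) sums cnj (cinner y x)"
    unfolding cinner_ell2_def
    using sums_cnj[THEN iffD2, OF summable_sums[OF ell2_cinner_summable[of y x]]]
    by (simp flip: cinner_commute)
  then show "cinner x y = cnj (cinner y x)"
    unfolding cinner_ell2_def by (rule sums_unique[symmetric])
  show "cinner (x + y) z = cinner x z + cinner y z"
    by (simp add: cinner_ell2_def cinner_add_left suminf_add ell2_cinner_summable)
  show "cinner (c *\<^sub>C x) y = c * cinner x y"
    by (simp add: cinner_ell2_def cinner_scaleC_left suminf_mult ell2_cinner_summable)
qed (auto intro!: ell2_eqI simp: scaleC_add_right scaleC_add_left scaleC_scaleC scaleC_of_real)
end

lemma cinner_swap: "cinner x y = cinner z w \<Longrightarrow> cinner y x = cinner w z"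
  by (metis cinner_commute)

lemma cinner_scaleR_left: "cinner (r *\<^sub>R x) y = complex_of_real r * cinner x y"
  by (simp add: cinner_scaleC_left flip: scaleC_of_real)

lemma cinner_scaleR_right: "cinner x (r *\<^sub>R y) = complex_of_real r * cinner x y"
  by (simp add: cinner_scaleC_right flip: scaleC_of_real)

section \<open>Closed subspaces and bounded operators\<close>

definition csubspace :: "'a::chilbert_space set \<Rightarrow> bool" where
  "csubspace S \<longleftrightarrow> 0 \<in> S \<and> (\<forall>x\<in>S. \<forall>y\<in>S. x + y \<in> S) \<and> (\<forall>c. \<forall>x\<in>S. c *\<^sub>C x \<in> S)"

lemma hilbert_iff: "hilbert S \<longleftrightarrow> csubspace S \<and> closed S"
  by (auto simp: hilbert_def csubspace_def)

lemma hilbert_csubspace: "hilbert S \<Longrightarrow> csubspace S"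
  by (simp add: hilbert_iff)

lemma csubspace_0: "csubspace S \<Longrightarrow> 0 \<in> S"
  and csubspace_add: "csubspace S \<Longrightarrow> x \<in> S \<Longrightarrow> y \<in> S \<Longrightarrow> x + y \<in> S"
  and csubspace_scaleC: "csubspace S \<Longrightarrow> x \<in> S \<Longrightarrow> c *\<^sub>C x \<in> S"
  by (auto simp: csubspace_def)

lemma csubspace_scaleR: "csubspace S \<Longrightarrow> x \<in> S \<Longrightarrow> r *\<^sub>R x \<in> S"
  using csubspace_scaleC[of S x "complex_of_real r"] by (simp add: scaleC_of_real)

lemma csubspace_diff: "csubspace S \<Longrightarrow> x \<in> S \<Longrightarrow> y \<in> S \<Longrightarrow> x - y \<in> S"
  using csubspace_add[of S x "(-1) *\<^sub>C y"] csubspace_scaleC[of S y "-1"] by simp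

lemma csubspace_subspace: "csubspace S \<Longrightarrow> subspace S"
  by (simp add: subspace_def csubspace_0 csubspace_add csubspace_scaleR)

lemma csubspace_closure: assumes "csubspace S" shows "csubspace (closure S)"
  unfolding csubspace_def
proof (intro conjI ballI allI)
  show "0 \<in> closure S" using csubspace_0[OF assms] closure_subset by blast
  fix x c assume "x \<in> closure S"
  then obtain f where f: "\<And>n. f n \<in> S" "f \<longlonglongrightarrow> x" by (metis closure_sequential)
  show "c *\<^sub>C x \<in> closure S"
    unfolding closure_sequential using f csubspace_scaleC[OF assms]
    by (intro exI[of _ "\<lambda>n. c *\<^sub>C f n"]) (auto intro!: tendsto_intros)
  fix y assume "y \<in> closure S"
  then obtain g where g: "\<And>n. g n \<in> S" "g \<longlonglongrightarrow> y" by (metis closure_sequential)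
  show "x + y \<in> closure S"
    unfolding closure_sequential using f g csubspace_add[OF assms]
    by (intro exI[of _ "\<lambda>n. f n + g n"]) (auto intro!: tendsto_intros)
qed

lemma hilbert_closure: "csubspace S \<Longrightarrow> hilbert (closure S)"
  by (simp add: hilbert_iff csubspace_closure)

text \<open>Here \<open>span\<close> is the real span; a generating set closed under complex
  multiples makes it a complex subspace.\<close>

lemma csubspace_span:
  assumes "\<And>c x. x \<in> D \<Longrightarrow> c *\<^sub>C x \<in> D"
  shows "csubspace (span D)"
  unfolding csubspace_def
proof (intro conjI ballI allI)
  fix x c assume "x \<in> span D"
  then show "c *\<^sub>C x \<in> span D"
  proof (induction rule: span_induct_alt)
    case (step r x y)
    then show ?case using assms[of x c]
      by (simp add: scaleC_add_right scaleC_scaleR span_add span_scale span_base)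
  qed (simp add: span_zero)
qed (auto simp: span_zero span_add)

lemma csubspace_UNIV [simp]: "csubspace UNIV"
  by (simp add: csubspace_def)

lemma hilbert_UNIV [simp]: "hilbert UNIV"
  by (simp add: hilbert_iff)

section \<open>Orthogonal decomposition and Riesz representation\<close>

lemma hilbert_projection_ex:
  assumes "hilbert S"
  shows "\<exists>\<eta>\<in>S. \<forall>\<zeta>\<in>S. cinner (u - \<eta>) \<zeta> = 0"
proof -
  have cs: "csubspace S" "closed S" using assms by (auto simp: hilbert_iff)
  have ne: "S \<noteq> {}" using csubspace_0[OF cs(1)] by blast
  define d where "d = infdist u S"
  have d0: "d \<ge> 0" by (simp add: d_def infdist_nonneg)
  have low: "d\<^sup>2 \<le> (norm (u - s))\<^sup>2" if "s \<in> S" for s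
    using infdist_le[OF that, of u] d0 by (simp add: d_def dist_norm power_mono)
  have "\<exists>s\<in>S. (norm (u - s))\<^sup>2 < d\<^sup>2 + 1 / Suc n" for n
  proof -
    have "d = sqrt (d\<^sup>2)" using d0 by simp
    also have "\<dots> < sqrt (d\<^sup>2 + 1 / Suc n)" by (rule real_sqrt_less_mono) simp
    finally have "Inf {dist u a | a. a \<in> S} < sqrt (d\<^sup>2 + 1 / Suc n)"
      unfolding d_def using ne by (simp add: infdist_def image_def setcompr_eq_image)
    then obtain s where "s \<in> S" "dist u s < sqrt (d\<^sup>2 + 1 / Suc n)"
      using cInf_lessD[of "{dist u a | a. a \<in> S}"] ne by auto
    then have "(dist u s)\<^sup>2 < (sqrt (d\<^sup>2 + 1 / Suc n))\<^sup>2"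
      by (intro power_strict_mono) auto
    then show ?thesis using \<open>s \<in> S\<close> by (intro bexI[of _ s]) (simp_all add: dist_norm)
  qed
  then obtain s where s: "\<And>n. s n \<in> S" "\<And>n. (norm (u - s n))\<^sup>2 < d\<^sup>2 + 1 / Suc n" by metis
  \<comment> \<open>The midpoint of two near-minimizers lies in S and is at distance at least d from
    u, so the parallelogram law forces them together.\<close>
  have par: "(norm (s m - s n))\<^sup>2 \<le> 2 * (1 / Suc m) + 2 * (1 / Suc n)" for m n
  proof -
    have "(1/2) *\<^sub>R (s m + s n) \<in> S" using s cs by (intro csubspace_scaleR csubspace_add)
    from low[OF this]
    have "d\<^sup>2 \<le> (norm (u - (1/2) *\<^sub>R (s m + s n)))\<^sup>2" .
    moreover have "4 * (norm (u - (1/2) *\<^sub>R (s m + s n)))\<^sup>2 + (norm (s m - s n))\<^sup>2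
        = 2 * (norm (u - s m))\<^sup>2 + 2 * (norm (u - s n))\<^sup>2"
      by (simp add: power2_norm_eq_inner inner_simps inner_commute algebra_simps)
    moreover have "(norm (u - s m))\<^sup>2 < d\<^sup>2 + 1 / Suc m" "(norm (u - s n))\<^sup>2 < d\<^sup>2 + 1 / Suc n"
      using s by auto
    ultimately show ?thesis by linarith
  qed
  have "Cauchy s"
  proof (rule metric_CauchyI)
    fix e :: real assume "e > 0"
    then obtain N where N: "1 / Suc N < e\<^sup>2 / 4" using nat_approx_posE[of "e\<^sup>2/4"] by auto
    have "dist (s m) (s n) < e" if "m \<ge> N" "n \<ge> N" for m n
    proof -
      have "1 / Suc m \<le> 1 / Suc N" "1 / Suc n \<le> 1 / Suc N"
        using that by (auto simp: field_simps)
      then have "(norm (s m - s n))\<^sup>2 < e\<^sup>2" using par[of m n] N by linarith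
      then show ?thesis using \<open>e > 0\<close> by (simp add: dist_norm power_less_imp_less_base)
    qed
    then show "\<exists>N. \<forall>m\<ge>N. \<forall>n\<ge>N. dist (s m) (s n) < e" by blast
  qed
  then obtain \<eta> where \<eta>: "s \<longlonglongrightarrow> \<eta>" using Cauchy_convergent convergentD by blast
  have \<eta>S: "\<eta> \<in> S" using cs(2) s(1) \<eta> by (metis closed_sequentially)
  have "(norm (u - \<eta>))\<^sup>2 \<le> d\<^sup>2 + 0"
  proof (rule LIMSEQ_le)
    show "(\<lambda>n. (norm (u - s n))\<^sup>2) \<longlonglongrightarrow> (norm (u - \<eta>))\<^sup>2" by (intro tendsto_intros \<eta>)
    show "(\<lambda>n. d\<^sup>2 + 1 / Suc n) \<longlonglongrightarrow> d\<^sup>2 + 0"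
      by (intro tendsto_intros LIMSEQ_Suc[OF lim_1_over_n])
    show "\<exists>N. \<forall>n\<ge>N. (norm (u - s n))\<^sup>2 \<le> d\<^sup>2 + 1 / Suc n" using s(2) by (meson less_imp_le)
  qed
  then have min: "(norm (u - \<eta>))\<^sup>2 \<le> (norm (u - z))\<^sup>2" if "z \<in> S" for z
    using low[OF that] by linarith
  have i0: "inner (u - \<eta>) \<zeta> = 0" if "\<zeta> \<in> S" for \<zeta>
  proof (cases "\<zeta> = 0")
    case False
    \<comment> \<open>The value of r minimizing the norm of u - \<eta> - r \<zeta>; since \<eta> is
      already optimal, the gain it produces must be zero.\<close>
    define r where "r = inner (u - \<eta>) \<zeta> / (norm \<zeta>)\<^sup>2"
    have "(norm (u - \<eta>))\<^sup>2 \<le> (norm (u - (\<eta> + r *\<^sub>R \<zeta>)))\<^sup>2"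
      by (intro min csubspace_add csubspace_scaleR cs \<eta>S that)
    also have "\<dots> = (norm (u - \<eta> - r *\<^sub>R \<zeta>))\<^sup>2" by (simp add: algebra_simps)
    also have "\<dots> = (norm (u - \<eta>))\<^sup>2 - 2 * r * inner (u - \<eta>) \<zeta> + r\<^sup>2 * (norm \<zeta>)\<^sup>2"
      unfolding power2_norm_eq_inner by (simp add: inner_diff_left inner_diff_right inner_commute
          power2_eq_square algebra_simps)
    also have "\<dots> = (norm (u - \<eta>))\<^sup>2 - (inner (u - \<eta>) \<zeta>)\<^sup>2 / (norm \<zeta>)\<^sup>2"
      using False by (simp add: r_def power2_eq_square field_simps)
    finally show ?thesis using False by (simp add: divide_le_0_iff)
  qed simp
  \<comment> \<open>Real orthogonality to the imaginary multiples of \<zeta> supplies the imaginary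
    part.\<close>
  show ?thesis
    using \<eta>S i0 csubspace_scaleC[OF cs(1)]
    by (intro bexI[of _ \<eta>] ballI) (simp_all add: cinner_eq_inner complex_eq_iff)
qed

text \<open>The product is linear in its first argument, so the functionals of the form
  \<open>cinner v\<close> are the conjugate linear ones. The representing vector is a multiple of a
  vector orthogonal to the kernel.\<close>

lemma riesz_representation:
  assumes S: "hilbert S"
    and add: "\<And>x y. x \<in> S \<Longrightarrow> y \<in> S \<Longrightarrow> f (x + y) = f x + f y"
    and scale: "\<And>c x. x \<in> S \<Longrightarrow> f (c *\<^sub>C x) = cnj c * f x"
    and bound: "\<And>x. x \<in> S \<Longrightarrow> cmod (f x) \<le> K * norm x"
  shows "\<exists>v\<in>S. \<forall>\<zeta>\<in>S. cinner v \<zeta> = f \<zeta>"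
proof (cases "\<forall>x\<in>S. f x = 0")
  case True
  then show ?thesis using S by (intro bexI[of _ 0]) (auto simp: hilbert_def)
next
  case False
  have cs: "csubspace S" "closed S" using S by (auto simp: hilbert_iff)
  have f0: "f 0 = 0" using scale[OF csubspace_0[OF cs(1)], of 0] by simp
  have diff: "f (x - y) = f x - f y" if "x \<in> S" "y \<in> S" for x y
    using add[OF that(1) csubspace_scaleC[OF cs(1) that(2)], of "-1"] scale[OF that(2), of "-1"]
        by simp
  define N where "N = {x\<in>S. f x = 0}"
  have "closed N"
    unfolding closed_sequential_limits
  proof (intro allI impI, elim conjE)
    fix x l assume x: "\<forall>n. x n \<in> N" "x \<longlonglongrightarrow> l"
    have lS: "l \<in> S" using x cs(2) closed_sequentially[of S x l] by (auto simp: N_def)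
    have "(\<lambda>n. K * norm (x n - l)) \<longlonglongrightarrow> K * norm (l - l)" by (intro tendsto_intros x)
    moreover have "cmod (f l) \<le> K * norm (x n - l)" for n
      using bound[of "x n - l"] diff[of "x n" l] x(1) lS csubspace_diff[OF cs(1)]
      by (simp add: N_def norm_minus_commute)
    ultimately have "cmod (f l) \<le> 0" using LIMSEQ_le_const by fastforce
    then show "l \<in> N" using lS by (simp add: N_def)
  qed
  then have N: "hilbert N"
    using cs add scale f0 by (auto simp: hilbert_iff csubspace_def N_def)
  obtain u where u: "u \<in> S" "f u \<noteq> 0" using False by blast
  obtain p where p: "p \<in> N" "\<And>\<zeta>. \<zeta> \<in> N \<Longrightarrow> cinner (u - p) \<zeta> = 0"
    using hilbert_projection_ex[OF N, of u] by blast
  define w where "w = u - p"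
  have wS: "w \<in> S" using u p csubspace_diff[OF cs(1)] by (auto simp: w_def N_def)
  have fw: "f w \<noteq> 0" using u p diff[of u p] by (auto simp: w_def N_def)
  then have w0: "w \<noteq> 0" using f0 by auto
  have "cinner ((f w / (norm w)\<^sup>2) *\<^sub>C w) \<zeta> = f \<zeta>" if "\<zeta> \<in> S" for \<zeta>
  proof -
    \<comment> \<open>The multiple of w cancels the value of f at \<zeta>; the conjugate compensates
      for the conjugate linearity of f.\<close>
    have "\<zeta> - cnj (f \<zeta> / f w) *\<^sub>C w \<in> N"
      using that wS fw csubspace_diff[OF cs(1)] csubspace_scaleC[OF cs(1)]
      by (simp add: N_def diff scale)
    from p(2)[OF this, folded w_def] have "cinner w \<zeta> = f \<zeta> / f w * (norm w)\<^sup>2"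
      by (simp add: cinner_diff_right cinner_scaleC_right cinner_same)
    then show ?thesis using fw w0 by (simp add: cinner_scaleC_left)
  qed
  then show ?thesis using csubspace_scaleC[OF cs(1) wS] by blast
qed

section \<open>Bounded linear maps between subspaces\<close>

definition blin :: "'a::chilbert_space set \<Rightarrow> 'b::chilbert_space set \<Rightarrow> ('a \<Rightarrow> 'b) \<Rightarrow> bool" where
  "blin S T f \<longleftrightarrow> (\<forall>u\<in>S. f u \<in> T) \<and> (\<forall>u\<in>S. \<forall>v\<in>S. f (u + v) = f u + f v) \<and>
     (\<forall>c. \<forall>u\<in>S. f (c *\<^sub>C u) = c *\<^sub>C f u) \<and> (\<exists>K. \<forall>u\<in>S. norm (f u) \<le> K * norm u)"

lemma bop_iff: "x \<in> bop S \<longleftrightarrow> x \<in> extensional S \<and> blin S S x"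
  by (auto simp: bop_def blin_def)

lemma bop_blin: "x \<in> bop S \<Longrightarrow> blin S S x"
  by (simp add: bop_iff)

lemma blin_in: "blin S T f \<Longrightarrow> u \<in> S \<Longrightarrow> f u \<in> T"
  and blin_add: "blin S T f \<Longrightarrow> u \<in> S \<Longrightarrow> v \<in> S \<Longrightarrow> f (u + v) = f u + f v"
  and blin_scaleC: "blin S T f \<Longrightarrow> u \<in> S \<Longrightarrow> f (c *\<^sub>C u) = c *\<^sub>C f u"
  by (auto simp: blin_def)

lemma blin_bound: assumes "blin S T f"
  obtains K where "K > 0" "\<And>u. u \<in> S \<Longrightarrow> norm (f u) \<le> K * norm u"
proof -
  obtain K where K: "\<forall>u\<in>S. norm (f u) \<le> K * norm u" using assms by (auto simp: blin_def)
  have "norm (f u) \<le> max K 1 * norm u" if "u \<in> S" for u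
    using K that mult_right_mono[of K "max K 1" "norm u"] by fastforce
  then show ?thesis using that[of "max K 1"] by auto
qed

lemma blinI:
  assumes "\<And>u. u \<in> S \<Longrightarrow> f u \<in> T"
    and "\<And>u v. u \<in> S \<Longrightarrow> v \<in> S \<Longrightarrow> f (u + v) = f u + f v"
    and "\<And>c u. u \<in> S \<Longrightarrow> f (c *\<^sub>C u) = c *\<^sub>C f u"
    and "\<And>u. u \<in> S \<Longrightarrow> norm (f u) \<le> K * norm u"
  shows "blin S T f"
  using assms unfolding blin_def by blast

lemma blin_diff: "csubspace S \<Longrightarrow> blin S T f \<Longrightarrow> u \<in> S \<Longrightarrow> v \<in> S \<Longrightarrow> f (u - v) = f u - f v"
  using blin_add[of S T f u "(-1) *\<^sub>C v"] blin_scaleC[of S T f v "-1"] csubspace_scaleC[of S v "-1"]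
  by simp

lemma blin_0: "csubspace S \<Longrightarrow> blin S T f \<Longrightarrow> f 0 = 0"
  using blin_diff[of S T f 0 0] csubspace_0[of S] by simp

lemma blin_scaleR: "blin S T f \<Longrightarrow> u \<in> S \<Longrightarrow> f (r *\<^sub>R u) = r *\<^sub>R f u"
  using blin_scaleC[of S T f u "complex_of_real r"] by (simp add: scaleC_of_real)

lemma blin_cong: "(\<And>u. u \<in> S \<Longrightarrow> f u = g u) \<Longrightarrow> csubspace S \<Longrightarrow> blin S T f \<longleftrightarrow> blin S T g"
  unfolding blin_def by (simp add: csubspace_add csubspace_scaleC)

lemma blin_restrict: "csubspace S \<Longrightarrow> blin S T (restrict f S) \<longleftrightarrow> blin S T f"
  by (rule blin_cong) auto

lemma restrict_bop: "csubspace S \<Longrightarrow> blin S S f \<Longrightarrow> restrict f S \<in> bop S"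
  by (simp add: bop_iff blin_restrict)

lemma blin_id: "blin S S (\<lambda>u. u)"
  by (rule blinI[where K=1]) auto

lemma blin_compose:
  assumes f: "blin S T f" and g: "blin T U g"
  shows "blin S U (\<lambda>u. g (f u))"
proof -
  obtain K where K: "K > 0" "\<And>u. u \<in> S \<Longrightarrow> norm (f u) \<le> K * norm u"
      by (rule blin_bound[OF f]) (rule that)
  obtain L where L: "L > 0" "\<And>u. u \<in> T \<Longrightarrow> norm (g u) \<le> L * norm u"
      by (rule blin_bound[OF g]) (rule that)
  show ?thesis
  proof (rule blinI[where K="L*K"])
    show "norm (g (f u)) \<le> L * K * norm u" if "u \<in> S" for u
      using order_trans[OF L(2)[OF blin_in[OF f that]] mult_left_mono[OF K(2)[OF that], of L]] L(1)
      by (simp add: mult.assoc)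
  qed (use f g in \<open>auto simp: blin_in blin_add blin_scaleC\<close>)
qed

lemma blin_lincomb:
  assumes T: "csubspace T" and f: "blin S T f" and g: "blin S T g"
  shows "blin S T (\<lambda>u. f u + c *\<^sub>C g u)"
proof -
  obtain K where K: "K > 0" "\<And>u. u \<in> S \<Longrightarrow> norm (f u) \<le> K * norm u"
      by (rule blin_bound[OF f]) (rule that)
  obtain L where L: "L > 0" "\<And>u. u \<in> S \<Longrightarrow> norm (g u) \<le> L * norm u"
      by (rule blin_bound[OF g]) (rule that)
  show ?thesis
  proof (rule blinI[where K="K + cmod c * L"])
    fix u assume u: "u \<in> S"
    have "norm (f u + c *\<^sub>C g u) \<le> norm (f u) + cmod c * norm (g u)"
      using norm_triangle_ineq[of "f u" "c *\<^sub>C g u"] by (simp add: norm_scaleC)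
    also have "\<dots> \<le> K * norm u + cmod c * (L * norm u)"
      by (intro add_mono mult_left_mono K L u) auto
    finally show "norm (f u + c *\<^sub>C g u) \<le> (K + cmod c * L) * norm u" by (simp add: algebra_simps)
  qed (simp_all add: csubspace_add[OF T] csubspace_scaleC[OF T] blin_in[OF f] blin_in[OF g]
        blin_add[OF f] blin_add[OF g] blin_scaleC[OF f] blin_scaleC[OF g]
        scaleC_add_right scaleC_scaleC mult.commute)
qed

text \<open>Serves both notions of boundedness that occur later: the trace bounded vectors of the
  ambient space and the bounded vectors of the bimodule \<open>L^2(B)\<close>.\<close>

lemma csubspace_bounded:
  assumes S: "csubspace S" and f: "\<And>x. x \<in> I \<Longrightarrow> blin S T (f x)"
  shows "csubspace {u\<in>S. \<exists>K. \<forall>x\<in>I. norm (f x u) \<le> K * c x}"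
  unfolding csubspace_def mem_Collect_eq
proof (intro conjI ballI allI)
  show "0 \<in> S" by (rule csubspace_0[OF S])
  show "\<exists>K. \<forall>x\<in>I. norm (f x 0) \<le> K * c x" using blin_0[OF S f] by (intro exI[of _ 0]) simp
  fix u v k assume "u \<in> {u\<in>S. \<exists>K. \<forall>x\<in>I. norm (f x u) \<le> K * c x}"
  then obtain K where K: "u \<in> S" "\<And>x. x \<in> I \<Longrightarrow> norm (f x u) \<le> K * c x" by auto
  show "k *\<^sub>C u \<in> S" by (rule csubspace_scaleC[OF S K(1)])
  have "norm (f x (k *\<^sub>C u)) \<le> (cmod k * K) * c x" if "x \<in> I" for x
    using mult_left_mono[OF K(2)[OF that], of "cmod k"] blin_scaleC[OF f[OF that] K(1)]
    by (simp add: norm_scaleC mult.assoc)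
  then show "\<exists>K. \<forall>x\<in>I. norm (f x (k *\<^sub>C u)) \<le> K * c x" by blast
  assume "v \<in> {u\<in>S. \<exists>K. \<forall>x\<in>I. norm (f x u) \<le> K * c x}"
  then obtain L where L: "v \<in> S" "\<And>x. x \<in> I \<Longrightarrow> norm (f x v) \<le> L * c x" by auto
  show "u + v \<in> S" by (rule csubspace_add[OF S K(1) L(1)])
  have "norm (f x (u + v)) \<le> (K + L) * c x" if "x \<in> I" for x
    using norm_triangle_ineq[of "f x u" "f x v"] K(2)[OF that] L(2)[OF that]
        blin_add[OF f[OF that] K(1) L(1)]
    by (simp add: distrib_right)
  then show "\<exists>K. \<forall>x\<in>I. norm (f x (u + v)) \<le> K * c x" by blast
qed

lemma blin_continuous_on: assumes S: "csubspace S" and f: "blin S T f" shows "continuous_on S f"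
proof -
  obtain K where K: "K > 0" "\<And>u. u \<in> S \<Longrightarrow> norm (f u) \<le> K * norm u"
      by (rule blin_bound[OF f]) (rule that)
  show ?thesis
  proof (rule continuous_onI)
    fix x e assume x: "x \<in> S" and "0 < (e::real)"
    have "dist (f y) (f x) \<le> e" if "y \<in> S" "dist y x < e / K" for y
      using K(2)[OF csubspace_diff[OF S that(1) x]] that(2) blin_diff[OF S f that(1) x] K(1)
      by (simp add: dist_norm field_simps)
    then show "\<exists>d>0. \<forall>x'\<in>S. dist x' x < d \<longrightarrow> dist (f x') (f x) \<le> e"
      using \<open>0 < e\<close> K(1) by (intro exI[of _ "e / K"]) auto
  qed
qed

lemma blin_tendsto:
  assumes "csubspace S" "blin S T f" "\<And>n. x n \<in> S" "l \<in> S" "x \<longlonglongrightarrow> l"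
  shows "(\<lambda>n. f (x n)) \<longlonglongrightarrow> f l"
  using blin_continuous_on[OF assms(1,2)] assms(3-5)
      by (auto simp: continuous_on_sequentially o_def)

lemma continuous_on_eq_dense:
  fixes f g :: "'a::metric_space \<Rightarrow> 'b::metric_space"
  assumes "continuous_on S f" "continuous_on S g" "D \<subseteq> S" "S \<subseteq> closure D"
    and "\<And>x. x \<in> D \<Longrightarrow> f x = g x" and "x \<in> S"
  shows "f x = g x"
proof -
  obtain s where s: "\<And>n. s n \<in> D" "s \<longlonglongrightarrow> x" using assms(4,6) by (metis closure_sequential subsetD)
  have "(\<lambda>n. f (s n)) \<longlonglongrightarrow> f x" "(\<lambda>n. g (s n)) \<longlonglongrightarrow> g x"
    using assms(1-3,6) s by (auto simp: continuous_on_sequentially o_def subset_eq)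
  then show ?thesis using assms(5) s(1) LIMSEQ_unique by auto
qed

lemma blin_eq_dense:
  assumes "csubspace S" "blin S T f" "blin S T' g" "D \<subseteq> S" "S \<subseteq> closure D"
    and "\<And>x. x \<in> D \<Longrightarrow> f x = g x" and "x \<in> S"
  shows "f x = g x"
  using assms by (intro continuous_on_eq_dense[of S f g D x]) (auto intro: blin_continuous_on)

lemma cinner_0_dense:
  assumes "S \<subseteq> closure D" "\<And>x. x \<in> D \<Longrightarrow> cinner z x = 0" "x \<in> S"
  shows "cinner z x = 0"
proof -
  have "\<And>D'. continuous_on D' (cinner z)" by (intro continuous_intros)
  then show ?thesis
    using assms closure_subset[of D] continuous_on_eq_dense[of "closure D" "cinner z" "\<lambda>_. 0" D x]
    by auto
qed

lemma eq_0_if_cinner_dense: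
  assumes "S \<subseteq> closure D" "\<And>x. x \<in> D \<Longrightarrow> cinner z x = 0" "z \<in> S"
  shows "z = 0"
  using cinner_0_dense[OF assms] by simp

lemma eq_if_cinner_right:
  assumes S: "csubspace S" and "u \<in> S" "v \<in> S" "\<And>y. y \<in> S \<Longrightarrow> cinner y u = cinner y v"
  shows "u = v"
proof -
  have "cinner (u - v) (u - v) = 0"
    using assms(4)[OF csubspace_diff[OF S assms(2,3)]] by (simp add: cinner_diff_right)
  then show ?thesis by simp
qed

section \<open>Adjoints\<close>

lemma blin_adjoint_ex:
  assumes S: "hilbert S" and f: "blin S T f"
  shows "\<exists>g. blin T S g \<and> (\<forall>u\<in>S. \<forall>v\<in>T. cinner (f u) v = cinner u (g v))"
proof -
  have cs: "csubspace S" by (rule hilbert_csubspace[OF S])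
  obtain K where K: "K > 0" "\<And>u. u \<in> S \<Longrightarrow> norm (f u) \<le> K * norm u"
      by (rule blin_bound[OF f]) (rule that)
  have "\<exists>z\<in>S. \<forall>u\<in>S. cinner z u = cinner v (f u)" for v
  proof (rule riesz_representation[OF S])
    show "cmod (cinner v (f x)) \<le> norm v * K * norm x" if "x \<in> S" for x
      using cinner_Cauchy_Schwarz[of v "f x"] mult_left_mono[OF K(2)[OF that], of "norm v"]
      by (simp add: algebra_simps)
  qed (use f in \<open>auto simp: blin_add blin_scaleC cinner_add_right cinner_scaleC_right\<close>)
  then obtain g where g: "\<And>v. g v \<in> S" "\<And>u v. u \<in> S \<Longrightarrow> cinner (g v) u = cinner v (f u)" by metis
  have uniq: "z = w" if "z \<in> S" "w \<in> S" "\<And>u. u \<in> S \<Longrightarrow> cinner z u = cinner w u" for z w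
    by (rule eq_if_cinner_right[OF cs that(1,2)]) (rule cinner_swap[OF that(3)])
  have "blin T S g"
  proof (rule blinI[where K=K])
    show "g (u + v) = g u + g v" for u v
      by (rule uniq) (auto simp: g csubspace_add[OF cs] cinner_add_left)
    show "g (c *\<^sub>C u) = c *\<^sub>C g u" for c u
      by (rule uniq) (auto simp: g csubspace_scaleC[OF cs] cinner_scaleC_left)
    \<comment> \<open>Cauchy-Schwarz for <g v, g v> = <v, f (g v)>, after which one factor norm (g
      v) is cancelled.\<close>
    show "norm (g v) \<le> K * norm v" for v
    proof -
      have "(norm (g v))\<^sup>2 = cmod (cinner (g v) (g v))" by (simp add: cinner_same norm_power)
      also have "\<dots> = cmod (cinner v (f (g v)))" by (simp add: g)
      also have "\<dots> \<le> norm v * (K * norm (g v))"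
        using cinner_Cauchy_Schwarz K(2)[OF g(1)] by (meson mult_left_mono norm_ge_zero order_trans)
      finally show ?thesis
        by (cases "norm (g v) = 0") (use K(1) in \<open>auto simp: power2_eq_square mult.commute
            mult.left_commute\<close>)
    qed
  qed (rule g)
  moreover have "cinner (f u) v = cinner u (g v)" if "u \<in> S" for u v
    by (metis cinner_commute g(2) that)
  ultimately show ?thesis by blast
qed

text \<open>Takes adjoints on both sides of W g' = g W, where f and f' are the adjoints of g and g'.
  Stated for plain functions so that it applies alike to commuting operators and to maps between two
  different modules.\<close>

lemma adjoint_intertwines:
  assumes S: "csubspace S" and W: "\<And>y. y \<in> S \<Longrightarrow> W y \<in> T" and V: "\<And>z. z \<in> T \<Longrightarrow> V z \<in> S"
    and WV: "\<And>y z. y \<in> S \<Longrightarrow> z \<in> T \<Longrightarrow> cinner (W y) z = cinner y (V z)"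
    and f: "\<And>z. z \<in> T \<Longrightarrow> f z \<in> T" and f': "\<And>z. z \<in> S \<Longrightarrow> f' z \<in> S" and g': "\<And>z. z \<in> S \<Longrightarrow> g' z \<in> S"
    and gf: "\<And>y z. y \<in> T \<Longrightarrow> z \<in> T \<Longrightarrow> cinner (g y) z = cinner y (f z)"
    and gf': "\<And>y z. y \<in> S \<Longrightarrow> z \<in> S \<Longrightarrow> cinner (g' y) z = cinner y (f' z)"
    and Wg: "\<And>y. y \<in> S \<Longrightarrow> W (g' y) = g (W y)" and z: "z \<in> T"
  shows "V (f z) = f' (V z)"
proof (rule eq_if_cinner_right[OF S V[OF f[OF z]] f'[OF V[OF z]]])
  fix y assume y: "y \<in> S"
  have "cinner y (V (f z)) = cinner (W (g' y)) z"
    using WV[OF y f[OF z]] gf[OF W[OF y] z] Wg[OF y] by simp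
  also have "\<dots> = cinner y (f' (V z))" using WV[OF g'[OF y] z] gf'[OF y V[OF z]] by simp
  finally show "cinner y (V (f z)) = cinner y (f' (V z))" .
qed

lemma hadj_unique:
  assumes S: "csubspace S" and "y \<in> bop S" "\<And>u v. u \<in> S \<Longrightarrow> v \<in> S \<Longrightarrow> cinner (x u) v = cinner u (y v)"
  shows "hadj S x = y"
  unfolding hadj_def
proof (rule the_equality)
  fix z assume z: "z \<in> bop S \<and> (\<forall>u\<in>S. \<forall>v\<in>S. cinner (x u) v = cinner u (z v))"
  show "z = y"
  proof (rule extensionalityI[of _ S])
    fix v assume v: "v \<in> S"
    have "z v \<in> S" "y v \<in> S" using z assms(2) v by (auto simp: bop_iff blin_in)
    then have d: "z v - y v \<in> S" by (rule csubspace_diff[OF S])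
    then have "cinner (z v - y v) (z v - y v) = 0"
      using z assms(3)[OF d v] v by (simp add: cinner_diff_right)
    then show "z v = y v" by simp
  qed (use z assms(2) in \<open>auto simp: bop_iff\<close>)
qed (use assms in auto)

lemma
  assumes S: "hilbert S" and x: "x \<in> bop S"
  shows hadj_bop: "hadj S x \<in> bop S"
    and cinner_hadj: "\<And>u v. u \<in> S \<Longrightarrow> v \<in> S \<Longrightarrow> cinner (x u) v = cinner u (hadj S x v)"
proof -
  have cs: "csubspace S" by (rule hilbert_csubspace[OF S])
  obtain g where g: "blin S S g" "\<forall>u\<in>S. \<forall>v\<in>S. cinner (x u) v = cinner u (g v)"
    using blin_adjoint_ex[OF S bop_blin[OF x]] by blast
  have "hadj S x = restrict g S"
    by (rule hadj_unique[OF cs]) (auto simp: g restrict_bop cs)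
  then show "hadj S x \<in> bop S" "\<And>u v. u \<in> S \<Longrightarrow> v \<in> S \<Longrightarrow> cinner (x u) v = cinner u (hadj S x v)"
    using g by (auto simp: restrict_bop cs)
qed

lemma cinner_hadj_left:
  assumes "hilbert S" "x \<in> bop S" "u \<in> S" "v \<in> S"
  shows "cinner (hadj S x u) v = cinner u (x v)"
  using cinner_hadj[OF assms(1,2,4,3)] by (metis cinner_commute)

lemma hadj_hadj: "hilbert S \<Longrightarrow> x \<in> bop S \<Longrightarrow> hadj S (hadj S x) = x"
  by (rule hadj_unique) (auto simp: hilbert_csubspace cinner_hadj_left)

lemma bop_compose: "csubspace S \<Longrightarrow> x \<in> bop S \<Longrightarrow> y \<in> bop S \<Longrightarrow> compose S x y \<in> bop S"
  unfolding compose_def by (intro restrict_bop blin_compose[of S S y S x]) (auto simp: bop_iff)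

lemma bop_eqI: "x \<in> bop S \<Longrightarrow> y \<in> bop S \<Longrightarrow> (\<And>u. u \<in> S \<Longrightarrow> x u = y u) \<Longrightarrow> x = y"
  by (rule extensionalityI[of _ S]) (auto simp: bop_iff)

text \<open>The map is given by its graph because the prescription on generators is not known in
  advance to be well defined; the norm bound yields single-valuedness and the extension to the
  closure at once.\<close>

lemma blin_graph_extension:
  fixes G :: "('a::chilbert_space \<times> 'b::chilbert_space) set"
  assumes G: "csubspace G" and bound: "\<And>a b. (a, b) \<in> G \<Longrightarrow> norm b \<le> K * norm a"
    and K: "0 \<le> K"
  obtains F where "blin (closure (fst ` G)) (closure (snd ` G)) F"
    "\<And>a b. (a, b) \<in> G \<Longrightarrow> F a = b"
    "\<And>a. a \<in> closure (fst ` G) \<Longrightarrow> (a, F a) \<in> closure G"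
    "\<And>a. a \<in> closure (fst ` G) \<Longrightarrow> norm (F a) \<le> K * norm a"
proof -
  have cG: "csubspace (closure G)" by (rule csubspace_closure[OF G])
  have cb: "norm b \<le> K * norm a" if ab: "(a, b) \<in> closure G" for a b
  proof -
    obtain s where s: "\<And>n. s n \<in> G" "s \<longlonglongrightarrow> (a, b)" using ab unfolding closure_sequential by blast
    have h1: "(\<lambda>n. norm (snd (s n))) \<longlonglongrightarrow> norm b"
      using tendsto_norm[OF tendsto_snd[OF s(2)]] by simp
    have h2: "(\<lambda>n. K * norm (fst (s n))) \<longlonglongrightarrow> K * norm a"
      using tendsto_mult_left[OF tendsto_norm[OF tendsto_fst[OF s(2)]], of K] by simp
    have h3: "norm (snd (s n)) \<le> K * norm (fst (s n))" for n
      using bound[of "fst (s n)" "snd (s n)"] s(1)[of n] by simp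
    show ?thesis by (rule LIMSEQ_le[OF h1 h2]) (use h3 in blast)
  qed
  \<comment> \<open>The difference of the two points is (0, b - b'), and the bound at 0 makes its
    second entry vanish.\<close>
  have uniq: "b = b'" if "(a, b) \<in> closure G" "(a, b') \<in> closure G" for a b b'
    using cb[of 0 "b - b'"] csubspace_diff[OF cG that] by simp
  have ex: "\<exists>b. (a, b) \<in> closure G" if a: "a \<in> closure (fst ` G)" for a
  proof -
    obtain s where s: "\<And>n. s n \<in> fst ` G" "s \<longlonglongrightarrow> a" using a by (metis closure_sequential)
    have "\<exists>b. (s n, b) \<in> G" for n using s(1)[of n] by fastforce
    then obtain r where r: "\<And>n. (s n, r n) \<in> G" by metis
    have le: "dist (r m) (r n) \<le> K * dist (s m) (s n)" for m n
      using bound[of "s m - s n" "r m - r n"] csubspace_diff[OF G r[of m] r[of n]]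
      by (simp add: dist_norm)
    have "Cauchy r"
    proof (rule metric_CauchyI)
      fix e :: real assume e: "e > 0"
      \<comment> \<open>The constant K may be 0, hence the divisor K + 1.\<close>
      obtain N where N: "\<And>m n. m \<ge> N \<Longrightarrow> n \<ge> N \<Longrightarrow> dist (s m) (s n) < e / (K + 1)"
        using LIMSEQ_imp_Cauchy[OF s(2)] e K
            by (meson metric_CauchyD divide_pos_pos add_nonneg_pos zero_less_one)
      have "dist (r m) (r n) < e" if "m \<ge> N" "n \<ge> N" for m n
      proof -
        have "(K + 1) * dist (s m) (s n) < e" using N[OF that] K by (simp add: field_simps)
        then have "K * dist (s m) (s n) + dist (s m) (s n) < e" by (simp add: distrib_right)
        then show ?thesis using le[of m n] zero_le_dist[of "s m" "s n"] by linarith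
      qed
      then show "\<exists>N. \<forall>m\<ge>N. \<forall>n\<ge>N. dist (r m) (r n) < e" by blast
    qed
    then obtain b where b: "r \<longlonglongrightarrow> b" using Cauchy_convergent convergentD by blast
    have "(\<lambda>n. (s n, r n)) \<longlonglongrightarrow> (a, b)" by (intro tendsto_Pair s b)
    then have "(a, b) \<in> closure G"
      unfolding closure_sequential using r by (intro exI[of _ "\<lambda>n. (s n, r n)"]) simp
    then show ?thesis by blast
  qed
  define F where "F a = (SOME b. (a, b) \<in> closure G)" for a
  have F: "(a, F a) \<in> closure G" if "a \<in> closure (fst ` G)" for a
    unfolding F_def using someI_ex[OF ex[OF that]] .
  have Feq: "F a = b" if "(a, b) \<in> closure G" for a b
    unfolding F_def using someI[of "\<lambda>b. (a, b) \<in> closure G", OF that] that uniq by blast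
  have "snd p \<in> closure (snd ` G)" if p: "p \<in> closure G" for p
  proof -
    obtain s where s: "\<And>n. s n \<in> G" "s \<longlonglongrightarrow> p" using p unfolding closure_sequential by blast
    then show ?thesis
      using tendsto_snd[OF s(2)] unfolding closure_sequential
          by (intro exI[of _ "\<lambda>n. snd (s n)"]) simp
  qed
  then have "F a \<in> closure (snd ` G)" if "a \<in> closure (fst ` G)" for a
    using F[OF that] by fastforce
  then have "blin (closure (fst ` G)) (closure (snd ` G)) F"
  proof (intro blinI[where K=K])
    fix u v c assume u: "u \<in> closure (fst ` G)"
    show "F (c *\<^sub>C u) = c *\<^sub>C F u"
      using csubspace_scaleC[OF cG F[OF u], of c] by (intro Feq) (simp add: scaleC_prod_def)
    assume "v \<in> closure (fst ` G)"
    then show "F (u + v) = F u + F v"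
      using csubspace_add[OF cG F[OF u] F[of v]] by (intro Feq) simp
  qed (use F cb in auto)
  then show ?thesis
    using that[of F] Feq F cb closure_subset by blast
qed

section \<open>Orthogonal projections\<close>

lemma
  assumes T: "hilbert T" and xi: "u \<in> S"
  shows oproj_in: "oproj S T u \<in> T"
    and oproj_orth: "\<zeta> \<in> T \<Longrightarrow> cinner (u - oproj S T u) \<zeta> = 0"
    and oproj_eqI: "v \<in> T \<Longrightarrow> (\<And>\<zeta>. \<zeta> \<in> T \<Longrightarrow> cinner (u - v) \<zeta> = 0) \<Longrightarrow> oproj S T u = v"
proof -
  let ?P = "\<lambda>v. v \<in> T \<and> (\<forall>\<zeta>\<in>T. cinner (u - v) \<zeta> = 0)"
  have cs: "csubspace T" by (rule hilbert_csubspace[OF T])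
  have uniq: "a = b" if "?P a" "?P b" for a b
  proof -
    have "a - b \<in> T" using that csubspace_diff[OF cs] by blast
    then have "cinner ((u - b) - (u - a)) (a - b) = 0" using that
        by (simp only: cinner_diff_left) simp
    then show ?thesis by simp
  qed
  obtain p where p: "?P p" using hilbert_projection_ex[OF T, of u] by blast
  have "(THE v. ?P v) = a" if "?P a" for a
    using that uniq by (intro the_equality) auto
  then have eq: "oproj S T u = a" if "?P a" for a using that xi by (simp add: oproj_def)
  show "oproj S T u \<in> T" using eq[OF p] p by simp
  show "\<zeta> \<in> T \<Longrightarrow> cinner (u - oproj S T u) \<zeta> = 0" using eq[OF p] p by simp
  show "v \<in> T \<Longrightarrow> (\<And>\<zeta>. \<zeta> \<in> T \<Longrightarrow> cinner (u - v) \<zeta> = 0) \<Longrightarrow> oproj S T u = v" using eq by blast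
qed

lemma oproj_same: "hilbert T \<Longrightarrow> T \<subseteq> S \<Longrightarrow> u \<in> T \<Longrightarrow> oproj S T u = u"
  by (rule oproj_eqI) auto

lemma oproj_norm_le: assumes "hilbert T" "u \<in> S" shows "norm (oproj S T u) \<le> norm u"
proof -
  let ?p = "oproj S T u"
  have "inner (u - ?p) ?p = 0"
    using oproj_orth[OF assms oproj_in[OF assms]] by (simp add: inner_eq_Re_cinner)
  then have "(norm ?p)\<^sup>2 = inner u ?p" by (simp add: inner_diff_left power2_norm_eq_inner)
  also have "\<dots> \<le> norm u * norm ?p" by (rule norm_cauchy_schwarz)
  finally show ?thesis by (cases "?p = 0") (auto simp: power2_eq_square)
qed

lemma oproj_blin:
  assumes S: "csubspace S" and T: "hilbert T" shows "blin S T (oproj S T)"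
proof (rule blinI[where K=1])
  have cs: "csubspace T" by (rule hilbert_csubspace[OF T])
  note o = oproj_in[OF T, of _ S] oproj_orth[OF T, of _ S]
  show "oproj S T (u + v) = oproj S T u + oproj S T v" if "u \<in> S" "v \<in> S" for u v
  proof (rule oproj_eqI[OF T csubspace_add[OF S that]])
    fix \<zeta> assume "\<zeta> \<in> T"
    then show "cinner (u + v - (oproj S T u + oproj S T v)) \<zeta> = 0"
      using o(2)[OF that(1)] o(2)[OF that(2)]
          by (simp add: cinner_diff_left cinner_add_left algebra_simps)
  qed (intro csubspace_add[OF cs] o that)
  show "oproj S T (c *\<^sub>C u) = c *\<^sub>C oproj S T u" if "u \<in> S" for c u
  proof (rule oproj_eqI[OF T csubspace_scaleC[OF S that]])
    fix \<zeta> assume "\<zeta> \<in> T"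
    then show "cinner (c *\<^sub>C u - c *\<^sub>C oproj S T u) \<zeta> = 0"
      using o(2)[OF that] by (simp add: cinner_scaleC_left flip: scaleC_diff_right)
  qed (intro csubspace_scaleC[OF cs] o that)
qed (use assms in \<open>auto simp: oproj_in oproj_norm_le\<close>)

lemma oproj_bop:
  assumes S: "csubspace S" and T: "hilbert T" "T \<subseteq> S" shows "oproj S T \<in> bop S"
proof -
  have "blin S S (oproj S T)"
    using oproj_blin[OF S T(1)] T(2) unfolding blin_def by blast
  then show ?thesis by (simp add: bop_iff oproj_def)
qed

lemma oproj_cinner:
  assumes T: "hilbert T" and "u \<in> S" "v \<in> S"
  shows "cinner (oproj S T u) v = cinner u (oproj S T v)"
proof -
  have "cinner (u - oproj S T u) (oproj S T v) = 0" "cinner (v - oproj S T v) (oproj S T u) = 0"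
    using oproj_orth[OF T] oproj_in[OF T] assms by auto
  then have "cinner u (oproj S T v) = cinner (oproj S T u) (oproj S T v)"
    "cinner (oproj S T u) v = cinner (oproj S T u) (oproj S T v)"
    by (metis cinner_diff_left right_minus_eq, metis cinner_commute cinner_diff_left right_minus_eq)
  then show ?thesis by simp
qed

lemma oproj_is_projection:
  assumes S: "hilbert S" and T: "hilbert T" "T \<subseteq> S" shows "is_projection S (oproj S T)"
proof -
  have cs: "csubspace S" by (rule hilbert_csubspace[OF S])
  have b: "oproj S T \<in> bop S" by (rule oproj_bop[OF cs T])
  have "hadj S (oproj S T) = oproj S T"
    by (rule hadj_unique[OF cs b]) (rule oproj_cinner[OF T(1)])
  moreover have "compose S (oproj S T) (oproj S T) = oproj S T"
    using b bop_compose[OF cs b b] oproj_in[OF T(1)] T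
    by (intro bop_eqI[of _ S]) (auto simp: compose_def oproj_same)
  ultimately show ?thesis using b by (simp add: is_projection_def)
qed

text \<open>Invariance of T under f and under its adjoint g makes T reducing: f also preserves the
  orthogonal complement.\<close>

lemma oproj_commute:
  assumes S: "csubspace S" and T: "hilbert T" "T \<subseteq> S" and f: "blin S S f"
    and inv: "\<And>\<zeta>. \<zeta> \<in> T \<Longrightarrow> f \<zeta> \<in> T" "\<And>\<zeta>. \<zeta> \<in> T \<Longrightarrow> g \<zeta> \<in> T"
    and adj: "\<And>u v. u \<in> S \<Longrightarrow> v \<in> S \<Longrightarrow> cinner (f u) v = cinner u (g v)"
    and xi: "u \<in> S"
  shows "oproj S T (f u) = f (oproj S T u)"
proof (rule oproj_eqI[OF T(1)])
  have p: "oproj S T u \<in> T" "oproj S T u \<in> S" using oproj_in[OF T(1) xi] T(2) by auto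
  show "f u \<in> S" by (rule blin_in[OF f xi])
  show "f (oproj S T u) \<in> T" using p inv by blast
  fix \<zeta> assume z: "\<zeta> \<in> T"
  have "cinner (f u - f (oproj S T u)) \<zeta> = cinner (f (u - oproj S T u)) \<zeta>"
    by (simp add: blin_diff[OF S f xi p(2)])
  also have "\<dots> = cinner (u - oproj S T u) (g \<zeta>)"
    using z T(2) csubspace_diff[OF S xi p(2)] by (intro adj) auto
  also have "\<dots> = 0" using oproj_orth[OF T(1) xi] inv(2)[OF z] by blast
  finally show "cinner (f u - f (oproj S T u)) \<zeta> = 0" .
qed

section \<open>Identities checked on spanning sets\<close>

lemma blin_eq_span:
  assumes S: "csubspace S" and f: "blin S T f" and g: "blin S T' g"
    and D: "D \<subseteq> S" "S \<subseteq> closure (span D)"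
    and eq: "\<And>x. x \<in> D \<Longrightarrow> f x = g x" and x: "x \<in> S"
  shows "f x = g x"
proof (rule blin_eq_dense[OF S f g _ D(2) _ x])
  have sub: "span D \<subseteq> S" by (rule span_minimal[OF D(1) csubspace_subspace[OF S]])
  then show "span D \<subseteq> S" .
  fix x assume "x \<in> span D"
  then have "x \<in> S \<and> f x = g x"
  proof (induction rule: span_induct_alt)
    case base
    show ?case using blin_0[OF S f] blin_0[OF S g] csubspace_0[OF S] by simp
  next
    case (step r x y)
    have xy: "x \<in> S" "y \<in> S" using step D(1) by auto
    have rx: "r *\<^sub>R x \<in> S" using csubspace_scaleR[OF S xy(1)] .
    show ?case
      unfolding blin_add[OF f rx xy(2)] blin_add[OF g rx xy(2)] blin_scaleR[OF f xy(1)]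
          blin_scaleR[OF g xy(1)]
      using eq[OF step(1)] step(2) csubspace_add[OF S rx xy(2)] by simp
  qed
  then show "f x = g x" by simp
qed

lemma cinner_0_span:
  assumes "S \<subseteq> closure (span D)" "\<And>x. x \<in> D \<Longrightarrow> cinner z x = 0" "x \<in> S"
  shows "cinner z x = 0"
proof (rule cinner_0_dense[OF assms(1) _ assms(3)])
  fix x assume "x \<in> span D"
  then show "cinner z x = 0"
    by (induction rule: span_induct_alt)
       (simp_all add: assms(2) cinner_add_right cinner_scaleC_right flip: scaleC_of_real)
qed

text \<open>The true adjoint h exists anyway, so it suffices to compare g with h: density of D shows
  that they agree on E, and density of E that they agree on T.\<close>

lemma cinner_adjoint_span:
  assumes S: "hilbert S" and f: "blin S T f" and T: "csubspace T" and g: "blin T S g"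
    and D: "D \<subseteq> S" "S \<subseteq> closure (span D)" and E: "E \<subseteq> T" "T \<subseteq> closure (span E)"
    and eq: "\<And>x y. x \<in> D \<Longrightarrow> y \<in> E \<Longrightarrow> cinner (f x) y = cinner x (g y)"
    and x: "x \<in> S" and y: "y \<in> T"
  shows "cinner (f x) y = cinner x (g y)"
proof -
  have cs: "csubspace S" by (rule hilbert_csubspace[OF S])
  obtain h where h: "blin T S h" "\<And>u v. u \<in> S \<Longrightarrow> v \<in> T \<Longrightarrow> cinner (f u) v = cinner u (h v)"
    using blin_adjoint_ex[OF S f] by blast
  have "h y = g y" if yE: "y \<in> E" for y
  proof -
    have "y \<in> T" using yE E(1) by blast
    then have d: "h y - g y \<in> S" using blin_in[OF g] blin_in[OF h(1)] csubspace_diff[OF cs] by blast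
    have "cinner (h y - g y) x = 0" if "x \<in> D" for x
    proof -
      have "cinner x (h y) = cinner x (g y)"
        using h(2)[of x y] eq[OF that yE] that D(1) \<open>y \<in> T\<close> by auto
      then show ?thesis by (subst cinner_commute) (simp add: cinner_diff_right)
    qed
    from cinner_0_span[OF D(2) this d] show ?thesis by simp
  qed
  then have "h y = g y" using blin_eq_span[OF T h(1) g E] y by blast
  then show ?thesis using h(2)[OF x y] by simp
qed

lemma blin_UNIV_bound: "blin UNIV T f \<Longrightarrow> \<exists>K>0. \<forall>u. norm (f u) \<le> K * norm u"
  by (erule blin_bound) auto

text \<open>The amplification of x to countably many copies of the space. For bounded linear x the
  image sequence is square summable, so that \<open>Abs_ell2\<close> is meaningful.\<close>

definition ell2_map :: "('a::chilbert_space \<Rightarrow> 'a) \<Rightarrow> 'a ell2 \<Rightarrow> 'a ell2" where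
  "ell2_map x z = Abs_ell2 (\<lambda>i. x (ell2_nth z i))"

lemma ell2_map_nth: assumes "blin UNIV UNIV x" shows "ell2_nth (ell2_map x z) i = x (ell2_nth z i)"
proof -
  obtain K where K: "K > 0" "\<And>u. norm (x u) \<le> K * norm u" using blin_UNIV_bound[OF assms] by blast
  have "summable (\<lambda>i. (norm (x (ell2_nth z i)))\<^sup>2)"
  proof (rule summable_comparison_test'[where N=0])
    show "summable (\<lambda>i. K\<^sup>2 * (norm (ell2_nth z i))\<^sup>2)" by (intro summable_mult ell2_summable)
    show "norm ((norm (x (ell2_nth z n)))\<^sup>2) \<le> K\<^sup>2 * (norm (ell2_nth z n))\<^sup>2" for n
      using power_mono[OF K(2)[of "ell2_nth z n"], of 2] by (simp add: power_mult_distrib)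
  qed
  then show ?thesis by (simp add: ell2_map_def Abs_ell2_inverse)
qed

lemma ell2_map_blin: assumes x: "blin UNIV UNIV x" shows "blin UNIV UNIV (ell2_map x)"
proof -
  obtain K where K: "K > 0" "\<And>u. norm (x u) \<le> K * norm u" using blin_UNIV_bound[OF x] by blast
  show ?thesis
  proof (rule blinI[where K=K])
    fix z
    have "(norm (ell2_map x z))\<^sup>2 \<le> K\<^sup>2 * (norm z)\<^sup>2"
    proof (rule sums_le[OF _ ell2_norm2_sums sums_mult[OF ell2_norm2_sums]])
      show "(norm (ell2_nth (ell2_map x z) i))\<^sup>2 \<le> K\<^sup>2 * (norm (ell2_nth z i))\<^sup>2" for i
        using power_mono[OF K(2)[of "ell2_nth z i"], of 2]
            by (simp add: power_mult_distrib ell2_map_nth[OF x])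
    qed
    then have "(norm (ell2_map x z))\<^sup>2 \<le> (K * norm z)\<^sup>2" by (simp add: power_mult_distrib)
    then show "norm (ell2_map x z) \<le> K * norm z" using K(1) by (simp add: power2_le_iff_abs_le)
  qed (auto intro!: ell2_eqI simp: ell2_map_nth[OF x] blin_add[OF x] blin_scaleC[OF x])
qed

lemma ell2_map_cinner:
  assumes "blin UNIV UNIV x" "blin UNIV UNIV y" "\<And>u v. cinner (x u) v = cinner u (y v)"
  shows "cinner (ell2_map x z) w = cinner z (ell2_map y w)"
  by (simp add: cinner_ell2_def ell2_map_nth assms)

text \<open>Iterating \<open>c\<^sub>k\<^sup>2 \<le> d c\<^sub>2\<^sub>k\<close> removes the constant \<open>C\<close>.\<close>

lemma moment_bound:
  fixes c :: "nat \<Rightarrow> real"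
  assumes c: "\<And>k. 0 \<le> c k" "\<And>k. (c k)\<^sup>2 \<le> d * c (2 * k)" "\<And>k. c k \<le> C * Q ^ k"
    and Q: "0 < Q" and d: "0 \<le> d"
  shows "c 1 \<le> Q * d"
proof (cases "d = 0")
  case True
  then show ?thesis using c(2)[of 1] by simp
next
  case False
  then have d: "d > 0" using d by simp
  show ?thesis
  proof (rule ccontr)
    assume "\<not> c 1 \<le> Q * d"
    define r where "r = c 1 / (Q * d)"
    have r: "r > 1" using \<open>\<not> c 1 \<le> Q * d\<close> Q d by (simp add: r_def field_simps)
    \<comment> \<open>An excess factor r over the claimed bound is squared at each step, so it
      reaches the power 2 ^ j.\<close>
    have low: "d * (Q * r) ^ (2 ^ j) \<le> c (2 ^ j)" for j
    proof (induction j)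
      case 0
      show ?case using Q d by (simp add: r_def)
    next
      case (Suc j)
      have "d * (d * (Q * r) ^ (2 ^ Suc j)) = (d * (Q * r) ^ (2 ^ j))\<^sup>2"
        by (simp add: power2_eq_square mult_2 power_add)
      also have "\<dots> \<le> (c (2 ^ j))\<^sup>2"
        using Q d r by (intro power_mono[OF Suc.IH]) simp
      also have "\<dots> \<le> d * c (2 * 2 ^ j)" by (rule c(2))
      finally show ?case using d by simp
    qed
    \<comment> \<open>Already r ^ n outgrows C / d, and the exponent reached above is the larger 2 ^
      n.\<close>
    obtain n where n: "C / d < r ^ n" using real_arch_pow[OF r] by blast
    have "d * r ^ (2 ^ n) * Q ^ (2 ^ n) \<le> C * Q ^ (2 ^ n)"
      using low[of n] c(3)[of "2 ^ n"] by (simp add: power_mult_distrib algebra_simps)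
    then have "d * r ^ (2 ^ n) \<le> C" using mult_right_le_imp_le zero_less_power[OF Q] by blast
    moreover have "d * r ^ n \<le> d * r ^ (2 ^ n)"
      using r d by (intro mult_left_mono power_increasing) auto
    moreover have "C < d * r ^ n" using n d by (simp add: field_simps)
    ultimately show False by linarith
  qed
qed

lemma compose_UNIV: "compose UNIV f g = f \<circ> g"
  by (auto simp: compose_def)

section \<open>The standard form of a tracial von Neumann algebra\<close>

locale vN_algebra =
  fixes M :: "('h::chilbert_space \<Rightarrow> 'h) set"
  assumes vn: "von_neumann_algebra UNIV M"
begin

abbreviation "adj \<equiv> hadj (UNIV :: 'h set)"

lemma M_bop: "x \<in> M \<Longrightarrow> x \<in> bop UNIV"
  using vn by (auto simp: von_neumann_algebra_def)

lemma M_blin: "x \<in> M \<Longrightarrow> blin UNIV UNIV x"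
  by (simp add: M_bop bop_blin)

text \<open>The closure properties below use this form of the double commutant condition; on a whole
  type extensionality imposes nothing.\<close>

lemma M_iff: "x \<in> M \<longleftrightarrow> blin UNIV UNIV x \<and> (\<forall>y\<in>commutant UNIV M. \<forall>u. x (y u) = y (x u))"
proof -
  have "M = commutant UNIV (commutant UNIV M)" using vn by (simp add: von_neumann_algebra_def)
  then have "x \<in> M \<longleftrightarrow> x \<in> commutant UNIV (commutant UNIV M)" by simp
  then show ?thesis by (simp only: commutant_def[of UNIV "commutant UNIV M"] bop_iff) auto
qed

lemma M_commute: "x \<in> M \<Longrightarrow> y \<in> commutant UNIV M \<Longrightarrow> x (y u) = y (x u)"
  by (simp add: M_iff)

lemma commutant_blin: "y \<in> commutant UNIV M \<Longrightarrow> blin UNIV UNIV y"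
  by (simp add: commutant_def bop_iff)

lemma M_id: "(\<lambda>u. u) \<in> M"
  by (simp add: M_iff blin_id)

lemma M_comp: "x \<in> M \<Longrightarrow> y \<in> M \<Longrightarrow> x \<circ> y \<in> M"
  using blin_compose[of UNIV UNIV y UNIV x] unfolding M_iff by (auto simp: o_def)

lemma M_lincomb: "x \<in> M \<Longrightarrow> y \<in> M \<Longrightarrow> (\<lambda>u. x u + c *\<^sub>C y u) \<in> M"
  unfolding M_iff[of "\<lambda>u. x u + c *\<^sub>C y u"]
  by (auto simp: blin_lincomb[OF csubspace_UNIV] M_blin M_commute
      blin_add[OF commutant_blin] blin_scaleC[OF commutant_blin])

lemma M_diff: "x \<in> M \<Longrightarrow> y \<in> M \<Longrightarrow> (\<lambda>u. x u - y u) \<in> M"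
  using M_lincomb[of x y "-1"] by simp

lemma M_scaleC: "x \<in> M \<Longrightarrow> (\<lambda>u. c *\<^sub>C x u) \<in> M"
  using M_lincomb[of x x "c - 1"] by (simp add: scaleC_add_left[of 1 "c - 1", symmetric,
      simplified])

lemma M_adj: "x \<in> M \<Longrightarrow> adj x \<in> M"
  using vn by (auto simp: von_neumann_algebra_def)

lemma adj_cinner: "x \<in> M \<Longrightarrow> cinner (x u) v = cinner u (adj x v)"
  by (rule cinner_hadj[OF hilbert_UNIV M_bop]) auto

lemma adj_eqI:
  assumes "y \<in> M" "\<And>u v. cinner (x u) v = cinner u (y v)"
  shows "adj x = y"
  by (rule hadj_unique) (auto simp: assms M_bop)

lemma adj_adj [simp]: "x \<in> M \<Longrightarrow> adj (adj x) = x"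
  by (rule hadj_hadj) (auto simp: M_bop)

lemma adj_comp: "x \<in> M \<Longrightarrow> y \<in> M \<Longrightarrow> adj (x \<circ> y) = adj y \<circ> adj x"
  by (rule adj_eqI) (auto simp: M_comp M_adj adj_cinner)

lemma adj_id [simp]: "adj (\<lambda>u. u) = (\<lambda>u. u)"
  by (rule adj_eqI) (auto simp: M_id)

lemma adj_diff: "x \<in> M \<Longrightarrow> y \<in> M \<Longrightarrow> adj (\<lambda>u. x u - y u) = (\<lambda>u. adj x u - adj y u)"
  by (rule adj_eqI) (auto simp: M_diff M_adj adj_cinner cinner_diff_left cinner_diff_right)

lemma commutant_adj: assumes y: "y \<in> commutant UNIV M" shows "adj y \<in> commutant UNIV M"
proof -
  have yb: "y \<in> bop UNIV" using y unfolding commutant_def by blast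
  have "adj y (x u) = x (adj y u)" if x: "x \<in> M" for x u
    by (rule adjoint_intertwines[where S=UNIV and T=UNIV and W=y and g="adj x" and g'="adj x"])
       (simp_all add: cinner_hadj[OF hilbert_UNIV yb] adj_cinner x M_adj M_commute[OF M_adj[OF x]
           y])
  then show ?thesis using hadj_bop[OF hilbert_UNIV yb] unfolding commutant_def by blast
qed

text \<open>Applied to maps such as x -> (hat x, \<dots>), whose images are the graphs to be closed;
  a single hypothesis covers sums and multiples.\<close>

lemma csubspace_image:
  fixes \<phi> :: "('h \<Rightarrow> 'h) \<Rightarrow> 'b::chilbert_space"
  assumes lin: "\<And>x y c. x \<in> M \<Longrightarrow> y \<in> M \<Longrightarrow> \<phi> (\<lambda>u. x u + c *\<^sub>C y u) = \<phi> x + c *\<^sub>C \<phi> y"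
  shows "csubspace (\<phi> ` M)"
  unfolding csubspace_def
proof (intro conjI ballI allI)
  have z: "(\<lambda>u. 0) \<in> M" "\<phi> (\<lambda>u. 0) = 0"
    using M_scaleC[OF M_id, of 0] lin[OF M_id M_id, of "-1"] by simp_all
  then show "0 \<in> \<phi> ` M" by force
  fix p q c assume "p \<in> \<phi> ` M"
  then obtain x where x: "p = \<phi> x" "x \<in> M" by (rule imageE)
  show "c *\<^sub>C p \<in> \<phi> ` M"
    using imageI[OF M_lincomb[OF z(1) x(2)], of \<phi> c] lin[OF z(1) x(2), of c] by (simp add: x z)
  assume "q \<in> \<phi> ` M"
  then obtain y where y: "q = \<phi> y" "y \<in> M" by (rule imageE)
  show "p + q \<in> \<phi> ` M"
    using imageI[OF M_lincomb[OF x(2) y(2)], of \<phi> 1] lin[OF x(2) y(2), of 1] by (simp add: x y)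
qed

end

locale L2_space = vN_algebra M for M :: "('h::chilbert_space \<Rightarrow> 'h) set" +
  fixes \<tau> :: "('h \<Rightarrow> 'h) \<Rightarrow> complex"
    and X :: "('h, 'k::chilbert_space) bimod" and hat :: "('h \<Rightarrow> 'h) \<Rightarrow> 'k"
  assumes tr: "tracial_state UNIV M \<tau>" and L2: "is_L2 M \<tau> X hat"
begin

abbreviation "S \<equiv> hspace X"
abbreviation "L \<equiv> lact X"
abbreviation "R \<equiv> ract X"
abbreviation "\<Omega> \<equiv> hat (\<lambda>u. u)"

lemma S_hilbert: "hilbert S"
  using L2 by (simp add: is_L2_def)

lemma S_csub: "csubspace S"
  by (rule hilbert_csubspace[OF S_hilbert])

lemma hat_add: "x \<in> M \<Longrightarrow> y \<in> M \<Longrightarrow> hat (\<lambda>u. x u + y u) = hat x + hat y"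
  and hat_scaleC: "x \<in> M \<Longrightarrow> hat (\<lambda>u. c *\<^sub>C x u) = c *\<^sub>C hat x"
  and cinner_hat: "x \<in> M \<Longrightarrow> y \<in> M \<Longrightarrow> cinner (hat x) (hat y) = \<tau> (adj y \<circ> x)"
  and S_closure: "S = closure (hat ` M)"
  and L_bop: "x \<in> M \<Longrightarrow> L x \<in> bop S" and R_bop: "x \<in> M \<Longrightarrow> R x \<in> bop S"
  and L_hat: "x \<in> M \<Longrightarrow> y \<in> M \<Longrightarrow> L x (hat y) = hat (x \<circ> y)"
  and R_hat: "x \<in> M \<Longrightarrow> y \<in> M \<Longrightarrow> R x (hat y) = hat (y \<circ> x)"
  using L2 unfolding is_L2_def by auto

lemma L_blin: "x \<in> M \<Longrightarrow> blin S S (L x)" and R_blin: "x \<in> M \<Longrightarrow> blin S S (R x)"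
  by (simp_all add: L_bop R_bop bop_blin)

lemma L_in: "x \<in> M \<Longrightarrow> u \<in> S \<Longrightarrow> L x u \<in> S" and R_in: "x \<in> M \<Longrightarrow> u \<in> S \<Longrightarrow> R x u \<in> S"
  by (meson L_blin R_blin blin_in)+

lemma hat_in: "x \<in> M \<Longrightarrow> hat x \<in> S"
  using closure_subset[of "hat ` M"] unfolding S_closure[symmetric] by auto

lemma hat_image: "hat ` M \<subseteq> S"
  using hat_in by blast

lemma hat_dense: "S \<subseteq> closure (hat ` M)" "S \<subseteq> closure (span (hat ` M))"
  using closure_mono[OF span_superset[of "hat ` M"]] unfolding S_closure[symmetric] by auto

lemma hat_diff: "x \<in> M \<Longrightarrow> y \<in> M \<Longrightarrow> hat (\<lambda>u. x u - y u) = hat x - hat y"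
  using hat_add[of x "\<lambda>u. (-1) *\<^sub>C y u"] hat_scaleC[of y "-1"] M_scaleC[of y "-1"] by simp

lemma hat_lincomb: "x \<in> M \<Longrightarrow> y \<in> M \<Longrightarrow> hat (\<lambda>u. x u + c *\<^sub>C y u) = hat x + c *\<^sub>C hat y"
  using hat_add[of x "\<lambda>u. c *\<^sub>C y u"] M_scaleC[of y c] by (simp add: hat_scaleC)

lemma \<tau>_commute: "x \<in> M \<Longrightarrow> y \<in> M \<Longrightarrow> \<tau> (x \<circ> y) = \<tau> (y \<circ> x)"
proof -
  assume "x \<in> M" "y \<in> M"
  moreover have "\<forall>x\<in>M. \<forall>y\<in>M. \<tau> (x \<circ> y) = \<tau> (y \<circ> x)"
    using tr unfolding tracial_state_def compose_UNIV by (elim conjE)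
  ultimately show ?thesis by blast
qed

lemma \<tau>_eq_cinner: "x \<in> M \<Longrightarrow> \<tau> x = cinner (hat x) \<Omega>"
  by (simp add: cinner_hat M_id o_def)

text \<open>Identifies the trace norm in the definition of \<open>bounded_vectors\<close> with
  \<open>norm (hat x)\<close>, the form in which the estimates below are written.\<close>

lemma \<tau>_norm: "x \<in> M \<Longrightarrow> sqrt (Re (\<tau> (adj x \<circ> x))) = norm (hat x)"
  by (simp add: cinner_same flip: cinner_hat)

lemma hat_eq_0: assumes "x \<in> M" "hat x = 0" shows "x = (\<lambda>u. 0)"
proof -
  have "\<tau> (adj x \<circ> x) = cinner (hat x) (hat x)" by (rule cinner_hat[OF assms(1,1), symmetric])
  also have "\<dots> = 0" unfolding assms(2) by simp
  finally have "\<tau> (adj x \<circ> x) = 0" .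
  moreover have "\<forall>x\<in>M. \<tau> (adj x \<circ> x) = 0 \<longrightarrow> (\<forall>u\<in>UNIV. x u = 0)"
    using tr unfolding tracial_state_def compose_UNIV by (elim conjE)
  ultimately show ?thesis using assms(1) by blast
qed

lemma hat_inj: assumes "x \<in> M" "y \<in> M" "hat x = hat y" shows "x = y"
proof -
  have "(\<lambda>u. x u - y u) = (\<lambda>u. 0)"
    using assms by (intro hat_eq_0) (simp_all add: M_diff hat_diff)
  then show ?thesis by (metis eq_iff_diff_eq_0 ext)
qed

text \<open>By the trace property the adjoint is isometric for the trace norm. This plays the part
  of the modular conjugation: it carries limits of \<open>hat (a n)\<close> to limits of
  \<open>hat (adj (a n))\<close>.\<close>

lemma norm_hat_adj: "x \<in> M \<Longrightarrow> norm (hat (adj x)) = norm (hat x)"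
  by (simp add: M_adj \<tau>_commute flip: \<tau>_norm)

lemma \<Omega>_in: "\<Omega> \<in> S" by (simp add: hat_in M_id)

lemma L_\<Omega>: "x \<in> M \<Longrightarrow> L x \<Omega> = hat x" and R_\<Omega>: "x \<in> M \<Longrightarrow> R x \<Omega> = hat x"
  by (simp_all add: L_hat R_hat M_id o_def)

lemma S_eqI:
  assumes "z \<in> S" "w \<in> S" "\<And>x. x \<in> M \<Longrightarrow> cinner z (hat x) = cinner w (hat x)"
  shows "z = w"
proof -
  have "z - w = 0"
    using assms by (intro eq_0_if_cinner_dense[OF hat_dense(1)] csubspace_diff[OF S_csub])
      (auto simp: cinner_diff_left)
  then show ?thesis by simp
qed

lemma S_blin_eqI:
  assumes "blin S T f" "blin S T' g" "\<And>x. x \<in> M \<Longrightarrow> f (hat x) = g (hat x)" "u \<in> S"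
  shows "f u = g u"
  using blin_eq_dense[OF S_csub assms(1,2) hat_image hat_dense(1)] assms(3,4) by blast

lemma L_comp: "x \<in> M \<Longrightarrow> y \<in> M \<Longrightarrow> u \<in> S \<Longrightarrow> L (x \<circ> y) u = L x (L y u)"
  by (rule S_blin_eqI[OF L_blin blin_compose[OF L_blin L_blin]]) (auto simp: M_comp L_hat o_assoc)

lemma R_comp: "x \<in> M \<Longrightarrow> y \<in> M \<Longrightarrow> u \<in> S \<Longrightarrow> R (x \<circ> y) u = R y (R x u)"
  by (rule S_blin_eqI[OF R_blin blin_compose[OF R_blin R_blin]]) (auto simp: M_comp R_hat o_assoc)

lemma L_R: "x \<in> M \<Longrightarrow> y \<in> M \<Longrightarrow> u \<in> S \<Longrightarrow> L x (R y u) = R y (L x u)"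
  by (rule S_blin_eqI[OF blin_compose[OF R_blin L_blin] blin_compose[OF L_blin R_blin]])
     (auto simp: M_comp R_hat L_hat o_assoc)

lemma L_id: "u \<in> S \<Longrightarrow> L (\<lambda>u. u) u = u"
  by (rule S_blin_eqI[OF L_blin blin_id]) (auto simp: M_id L_hat o_def)

lemma R_id: "u \<in> S \<Longrightarrow> R (\<lambda>u. u) u = u"
  by (rule S_blin_eqI[OF R_blin blin_id]) (auto simp: M_id R_hat o_def)

lemma L_adj:
  assumes "x \<in> M" "u \<in> S" "v \<in> S"
  shows "cinner (L x u) v = cinner u (L (adj x) v)"
  by (rule cinner_adjoint_span[OF S_hilbert L_blin S_csub L_blin hat_image hat_dense(2)
      hat_image hat_dense(2)])
     (use assms in \<open>auto simp: M_adj L_hat cinner_hat M_comp adj_comp o_assoc\<close>)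

lemma R_adj:
  assumes "x \<in> M" "u \<in> S" "v \<in> S"
  shows "cinner (R x u) v = cinner u (R (adj x) v)"
proof (rule cinner_adjoint_span[OF S_hilbert R_blin S_csub R_blin hat_image hat_dense(2)
    hat_image hat_dense(2)])
  fix u v assume "u \<in> hat ` M" "v \<in> hat ` M"
  then obtain y z where yz: "y \<in> M" "z \<in> M" "u = hat y" "v = hat z" by blast
  then show "cinner (R x u) v = cinner u (R (adj x) v)"
    using assms(1) \<tau>_commute[of "adj z \<circ> y" x]
    by (simp add: M_adj R_hat cinner_hat M_comp adj_comp o_assoc)
qed (use assms in \<open>auto simp: M_adj\<close>)

lemma hat_seq: assumes "z \<in> S" obtains a where "\<And>n. a n \<in> M" "(\<lambda>n. hat (a n)) \<longlonglongrightarrow> z"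
proof -
  obtain s where s: "\<And>n. s n \<in> hat ` M" "s \<longlonglongrightarrow> z"
    using assms unfolding S_closure closure_sequential by blast
  then have "\<forall>n. \<exists>x. x \<in> M \<and> s n = hat x" by blast
  then obtain a where "\<And>n. a n \<in> M" "\<And>n. s n = hat (a n)" by metis
  then show ?thesis using that[of a] s(2) by presburger
qed

text \<open>Approximate z itself by vectors \<open>hat (a n)\<close>. The maximum with 0 is for z =
  0, where K may be negative.\<close>

lemma norm_le_if_cinner_le:
  assumes z: "z \<in> S" and K: "\<And>x. x \<in> M \<Longrightarrow> cmod (cinner z (hat x)) \<le> K * norm (hat x)"
  shows "norm z \<le> max K 0"
proof -
  obtain a where a: "\<And>n. a n \<in> M" "(\<lambda>n. hat (a n)) \<longlonglongrightarrow> z" using hat_seq[OF z] by blast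
  have "(\<lambda>n. cmod (cinner z (hat (a n)))) \<longlonglongrightarrow> cmod (cinner z z)"
    "(\<lambda>n. K * norm (hat (a n))) \<longlonglongrightarrow> K * norm z" by (intro tendsto_intros a)+
  then have "cmod (cinner z z) \<le> K * norm z" by (rule LIMSEQ_le) (use K a(1) in blast)
  then have "norm z * norm z \<le> K * norm z" by (simp add: cinner_same norm_mult power2_eq_square)
  then show ?thesis by (cases "norm z = 0") auto
qed

lemma R_lincomb:
  assumes x: "x \<in> M" and y: "y \<in> M" and t: "t \<in> S"
  shows "R (\<lambda>u. x u + c *\<^sub>C y u) t = R x t + c *\<^sub>C R y t"
proof (rule S_blin_eqI[OF R_blin[OF M_lincomb[OF x y]] blin_lincomb[OF S_csub R_blin[OF x]
    R_blin[OF y]] _ t])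
  fix z assume z: "z \<in> M"
  have "z \<circ> (\<lambda>u. x u + c *\<^sub>C y u) = (\<lambda>u. (z \<circ> x) u + c *\<^sub>C (z \<circ> y) u)"
    by (auto simp: blin_add[OF M_blin[OF z]] blin_scaleC[OF M_blin[OF z]])
  then show "R (\<lambda>u. x u + c *\<^sub>C y u) (hat z) = R x (hat z) + c *\<^sub>C R y (hat z)"
    using x y z by (simp only: R_hat M_lincomb hat_lincomb M_comp)
qed

lemma hat_extension:
  fixes \<phi> :: "('h \<Rightarrow> 'h) \<Rightarrow> 'b::chilbert_space"
  assumes T: "closed T" and \<phi>T: "\<And>x. x \<in> M \<Longrightarrow> \<phi> x \<in> T"
    and lin: "\<And>x y c. x \<in> M \<Longrightarrow> y \<in> M \<Longrightarrow> \<phi> (\<lambda>u. x u + c *\<^sub>C y u) = \<phi> x + c *\<^sub>C \<phi> y"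
    and bound: "\<And>x. x \<in> M \<Longrightarrow> norm (\<phi> x) \<le> K * norm (hat x)"
  obtains F where "blin S T F" "\<And>x. x \<in> M \<Longrightarrow> F (hat x) = \<phi> x"
proof -
  let ?G = "(\<lambda>x. (hat x, \<phi> x)) ` M"
  have "csubspace ?G" by (rule csubspace_image) (simp add: hat_lincomb lin scaleC_prod_def)
  \<comment> \<open>The graph principle asks for a nonnegative constant, which K need not
    be.\<close>
  moreover have "norm b \<le> max K 0 * norm a" if ab: "(a, b) \<in> ?G" for a b
  proof -
    obtain x where x: "x \<in> M" "a = hat x" "b = \<phi> x" using ab by blast
    have "norm b \<le> K * norm a" using bound x by simp
    also have "\<dots> \<le> max K 0 * norm a" by (intro mult_right_mono) auto
    finally show ?thesis .
  qed
  ultimately obtain F where F: "blin (closure (fst ` ?G)) (closure (snd ` ?G)) F" "\<And>a b. (a, b)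
      \<in> ?G \<Longrightarrow> F a = b"
    by (rule blin_graph_extension[where K="max K 0"]) auto
  have "closure (snd ` ?G) \<subseteq> T" using \<phi>T T by (intro closure_minimal) auto
  moreover have "fst ` ?G = hat ` M" by force
  ultimately have "blin S T F" using F(1) unfolding blin_def by (auto simp flip: S_closure)
  then show ?thesis using that[of F] F(2) by blast
qed

section \<open>Left and right module maps on the standard space commute\<close>

lemma adjoint_commute:
  assumes f: "blin S S f" and g: "blin S S g"
    and fg: "\<And>u v. u \<in> S \<Longrightarrow> v \<in> S \<Longrightarrow> cinner (f u) v = cinner u (g v)"
    and h: "blin S S h" and k: "blin S S k"
    and hk: "\<And>u v. u \<in> S \<Longrightarrow> v \<in> S \<Longrightarrow> cinner (h u) v = cinner u (k v)"
    and comm: "\<And>u. u \<in> S \<Longrightarrow> f (h u) = h (f u)" and xi: "u \<in> S"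
  shows "g (k u) = k (g u)"
  by (rule adjoint_intertwines[where S=S and T=S and W=f and g=h and g'=h])
     (simp_all add: S_csub fg hk comm xi blin_in[OF f] blin_in[OF g] blin_in[OF h] blin_in[OF k])

lemma adjoint_limit:
  assumes f: "blin S S f" and g: "blin S S g"
    and fg: "\<And>u v. u \<in> S \<Longrightarrow> v \<in> S \<Longrightarrow> cinner (f u) v = cinner u (g v)"
    and comm: "(\<forall>y\<in>M. f (hat y) = R y (f \<Omega>)) \<or> (\<forall>y\<in>M. f (hat y) = L y (f \<Omega>))"
    and a: "\<And>n. a n \<in> M" "(\<lambda>n. hat (a n)) \<longlonglongrightarrow> f \<Omega>"
  shows "(\<lambda>n. hat (adj (a n))) \<longlonglongrightarrow> g \<Omega>"
proof -
  have fO: "f \<Omega> \<in> S" "g \<Omega> \<in> S" using \<Omega>_in blin_in[OF f] blin_in[OF g] by auto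
  have "dist (hat (adj (a m))) (hat (adj (a n))) = dist (hat (a m)) (hat (a n))" for m n
    using norm_hat_adj[OF M_diff[OF a(1)[of m] a(1)[of n]]] a(1)
    by (simp add: dist_norm adj_diff hat_diff M_adj)
  then have "Cauchy (\<lambda>n. hat (adj (a n)))"
    using LIMSEQ_imp_Cauchy[OF a(2)] by (simp add: Cauchy_def)
  then obtain s where s: "(\<lambda>n. hat (adj (a n))) \<longlonglongrightarrow> s" using Cauchy_convergent convergentD by blast
  have sS: "s \<in> S"
    using s S_hilbert a(1) by (intro closed_sequentially[of S "\<lambda>n. hat (adj (a n))" s])
        (auto simp: hilbert_iff hat_in M_adj)
  have "s = g \<Omega>"
  proof (rule S_eqI[OF sS fO(2)])
    fix y assume y: "y \<in> M"
    have l1: "(\<lambda>n. \<tau> (adj y \<circ> adj (a n))) \<longlonglongrightarrow> cinner s (hat y)"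
      using tendsto_cinner[OF s tendsto_const[of "hat y"]] y a(1) by (simp add: cinner_hat M_adj)
    have l2: "(\<lambda>n. cinner \<Omega> (R y (hat (a n)))) \<longlonglongrightarrow> cinner \<Omega> (R y (f \<Omega>))"
      "(\<lambda>n. cinner \<Omega> (L y (hat (a n)))) \<longlonglongrightarrow> cinner \<Omega> (L y (f \<Omega>))"
      by (intro tendsto_intros blin_tendsto[OF S_csub R_blin[OF y]]
          blin_tendsto[OF S_csub L_blin[OF y]] hat_in a fO)+
    have e: "cinner \<Omega> (R y (hat (a n))) = \<tau> (adj y \<circ> adj (a n))"
      "cinner \<Omega> (L y (hat (a n))) = \<tau> (adj y \<circ> adj (a n))" for n
      using \<tau>_commute[OF M_adj[OF y] M_adj[OF a(1)[of n]]] y a(1)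
      by (simp_all add: R_hat L_hat cinner_hat M_id M_comp adj_comp) (simp_all add: o_def)
    have "cinner s (hat y) = cinner \<Omega> (R y (f \<Omega>))" "cinner s (hat y) = cinner \<Omega> (L y (f \<Omega>))"
      by (rule LIMSEQ_unique[OF l1 l2(1)[unfolded e]], rule LIMSEQ_unique[OF l1 l2(2)[unfolded e]])
    then have "cinner s (hat y) = cinner \<Omega> (f (hat y))" using comm y by metis
    also have "\<dots> = cinner (g \<Omega>) (hat y)"
      using fg[OF hat_in[OF y] \<Omega>_in] by (rule cinner_swap)
    finally show "cinner s (hat y) = cinner (g \<Omega>) (hat y)" .
  qed
  then show ?thesis using s by simp
qed

lemma adjoint_commute_R:
  assumes f: "blin S S f" and g: "blin S S g"
    and fg: "\<And>u v. u \<in> S \<Longrightarrow> v \<in> S \<Longrightarrow> cinner (f u) v = cinner u (g v)"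
    and fR: "\<And>y u. y \<in> M \<Longrightarrow> u \<in> S \<Longrightarrow> f (R y u) = R y (f u)"
    and y: "y \<in> M" and xi: "u \<in> S"
  shows "g (R y u) = R y (g u)"
proof (rule adjoint_commute[OF f g fg R_blin R_blin])
  show "cinner (R (adj y) u') v = cinner u' (R y v)" if "u' \<in> S" "v \<in> S" for u' v
    using R_adj[OF M_adj[OF y] that] y by simp
qed (use y xi fR M_adj in auto)

lemma adjoint_commute_L:
  assumes f: "blin S S f" and g: "blin S S g"
    and fg: "\<And>u v. u \<in> S \<Longrightarrow> v \<in> S \<Longrightarrow> cinner (f u) v = cinner u (g v)"
    and fL: "\<And>y u. y \<in> M \<Longrightarrow> u \<in> S \<Longrightarrow> f (L y u) = L y (f u)"
    and y: "y \<in> M" and xi: "u \<in> S"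
  shows "g (L y u) = L y (g u)"
proof (rule adjoint_commute[OF f g fg L_blin L_blin])
  show "cinner (L (adj y) u') v = cinner u' (L y v)" if "u' \<in> S" "v \<in> S" for u' v
    using L_adj[OF M_adj[OF y] that] y by simp
qed (use y xi fL M_adj in auto)

text \<open>With \<open>hat (a\<^sub>n) \<longlonglongrightarrow> f \<Omega>\<close> and \<open>hat (b\<^sub>n) \<longlonglongrightarrow> h \<Omega>\<close>, the matrix coefficients of both products are
  limits of \<open>\<tau> (y\<^sup>* a\<^sub>n x b\<^sub>n)\<close>, by the trace property.\<close>

lemma commutation:
  assumes f: "blin S S f" and h: "blin S S h"
    and fR: "\<And>y u. y \<in> M \<Longrightarrow> u \<in> S \<Longrightarrow> f (R y u) = R y (f u)"
    and hL: "\<And>y u. y \<in> M \<Longrightarrow> u \<in> S \<Longrightarrow> h (L y u) = L y (h u)"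
    and xi: "u \<in> S"
  shows "f (h u) = h (f u)"
proof (rule S_blin_eqI[OF blin_compose[OF h f] blin_compose[OF f h] _ xi])
  fix x assume x: "x \<in> M"
  obtain g where g: "blin S S g" "\<And>u v. u \<in> S \<Longrightarrow> v \<in> S \<Longrightarrow> cinner (f u) v = cinner u (g v)"
    using blin_adjoint_ex[OF S_hilbert f] by blast
  obtain k where k: "blin S S k" "\<And>u v. u \<in> S \<Longrightarrow> v \<in> S \<Longrightarrow> cinner (h u) v = cinner u (k v)"
    using blin_adjoint_ex[OF S_hilbert h] by blast
  have gR: "g (R y u) = R y (g u)" if "y \<in> M" "u \<in> S" for y u
    by (rule adjoint_commute_R[OF f g fR that])
  have kL: "k (L y u) = L y (k u)" if "y \<in> M" "u \<in> S" for y u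
    by (rule adjoint_commute_L[OF h k hL that])
  have fh: "f (hat y) = R y (f \<Omega>)" and gh: "g (hat y) = R y (g \<Omega>)"
    and hh: "h (hat y) = L y (h \<Omega>)" and kh: "k (hat y) = L y (k \<Omega>)" if "y \<in> M" for y
    using fR[OF that \<Omega>_in] gR[OF that \<Omega>_in] hL[OF that \<Omega>_in] kL[OF that \<Omega>_in] that
    by (simp_all add: R_\<Omega> L_\<Omega>)
  note ins = blin_in[OF f \<Omega>_in] blin_in[OF g(1) \<Omega>_in] blin_in[OF h \<Omega>_in] blin_in[OF k(1) \<Omega>_in]
  obtain a where a: "\<And>n. a n \<in> M" "(\<lambda>n. hat (a n)) \<longlonglongrightarrow> f \<Omega>" using hat_seq[OF ins(1)] by blast
  obtain b where b: "\<And>n. b n \<in> M" "(\<lambda>n. hat (b n)) \<longlonglongrightarrow> h \<Omega>" using hat_seq[OF ins(3)] by blast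
  have a': "(\<lambda>n. hat (adj (a n))) \<longlonglongrightarrow> g \<Omega>" using adjoint_limit[OF f g _ a] fh by blast
  have b': "(\<lambda>n. hat (adj (b n))) \<longlonglongrightarrow> k \<Omega>" using adjoint_limit[OF h k _ b] hh by blast
  show "f (h (hat x)) = h (f (hat x))"
  proof (rule S_eqI)
    show "f (h (hat x)) \<in> S" "h (f (hat x)) \<in> S" using x
        by (simp_all add: hat_in blin_in[OF f] blin_in[OF h])
    fix y assume y: "y \<in> M"
    have "(\<lambda>n. cinner (L x (hat (b n))) (R y (hat (adj (a n))))) \<longlonglongrightarrow> cinner (L x (h \<Omega>)) (R y (g \<Omega>))"
      using x y by (intro tendsto_intros blin_tendsto[OF S_csub R_blin]
          blin_tendsto[OF S_csub L_blin] a' b ins hat_in M_adj a)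
    then have l1: "(\<lambda>n. cinner (L x (hat (b n))) (R y (hat (adj (a n))))) \<longlonglongrightarrow> cinner (h (hat x))
        (g (hat y))"
      using x y by (simp add: hh gh)
    have "(\<lambda>n. cinner (R x (hat (a n))) (L y (hat (adj (b n))))) \<longlonglongrightarrow> cinner (R x (f \<Omega>)) (L y (k \<Omega>))"
      using x y by (intro tendsto_intros blin_tendsto[OF S_csub R_blin]
          blin_tendsto[OF S_csub L_blin] a b' ins hat_in M_adj b)
    then have l2: "(\<lambda>n. cinner (R x (hat (a n))) (L y (hat (adj (b n))))) \<longlonglongrightarrow> cinner (f (hat x))
        (k (hat y))"
      using x y by (simp add: fh kh)
    have "cinner (L x (hat (b n))) (R y (hat (adj (a n)))) = cinner (R x (hat (a n)))
        (L y (hat (adj (b n))))" for n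
      using \<tau>_commute[of "b n" "adj y \<circ> a n \<circ> x"] x y a(1)[of n] b(1)[of n]
      by (simp add: L_hat R_hat M_adj cinner_hat M_comp adj_comp o_assoc)
    then have "cinner (h (hat x)) (g (hat y)) = cinner (f (hat x)) (k (hat y))"
      using LIMSEQ_unique[OF l1] l2 by simp
    then show "cinner (f (h (hat x))) (hat y) = cinner (h (f (hat x))) (hat y)"
      using x y by (simp add: g(2) k(2) hat_in blin_in[OF f] blin_in[OF h])
  qed
qed

text \<open>Projecting \<open>(\<Omega>, 0)\<close> onto the closed graph \<open>\<Gamma>\<close> of \<open>hat x \<mapsto> x \<omega>\<close>, where \<open>\<tau> x = \<langle>x \<theta>, \<omega>\<rangle>\<close>,
  produces vectors \<open>v\<close> with \<open>\<parallel>x v\<parallel> \<le> \<parallel>x\<parallel>\<^sub>2\<close>, without the polar decomposition of an unbounded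
  operator.\<close>

lemma separating_bounded_map:
  obtains \<rho> where "blin S UNIV \<rho>" "\<And>e. e \<in> S \<Longrightarrow> norm (\<rho> e) \<le> norm e"
    "\<And>x i. x \<in> M \<Longrightarrow> ell2_nth (\<rho> (hat x)) i = x (ell2_nth (\<rho> \<Omega>) i)"
    "\<And>z. z \<in> S \<Longrightarrow> \<rho> z = 0 \<Longrightarrow> z = 0"
proof -
  have "\<exists>\<zeta> \<omega> :: nat \<Rightarrow> 'h. range \<zeta> \<subseteq> UNIV \<and> range \<omega> \<subseteq> UNIV \<and>
        summable (\<lambda>i. (norm (\<zeta> i))\<^sup>2) \<and> summable (\<lambda>i. (norm (\<omega> i))\<^sup>2) \<and>
        (\<forall>x\<in>M. (\<lambda>i. cinner (x (\<zeta> i)) (\<omega> i)) sums \<tau> x)"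
    using tr unfolding tracial_state_def by (elim conjE)
  then obtain \<zeta> \<omega> :: "nat \<Rightarrow> 'h" where
    zs: "summable (\<lambda>i. (norm (\<zeta> i))\<^sup>2)" and os: "summable (\<lambda>i. (norm (\<omega> i))\<^sup>2)" and
    \<tau>s: "\<And>x. x \<in> M \<Longrightarrow> (\<lambda>i. cinner (x (\<zeta> i)) (\<omega> i)) sums \<tau> x" by blast
  define \<theta> where "\<theta> = Abs_ell2 \<zeta>"
  define w where "w = Abs_ell2 \<omega>"
  have nth: "ell2_nth \<theta> i = \<zeta> i" "ell2_nth w i = \<omega> i" for i
    using zs os by (simp_all add: \<theta>_def w_def Abs_ell2_inverse)
  note Db = ell2_map_blin[OF M_blin]
  have \<tau>D: "\<tau> x = cinner (ell2_map x \<theta>) w" if "x \<in> M" for x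
    using sums_unique[OF \<tau>s[OF that]] by (simp add: cinner_ell2_def ell2_map_nth[OF M_blin[OF
        that]] nth)
  have D_comp: "ell2_map (x \<circ> y) z = ell2_map x (ell2_map y z)" if "x \<in> M" "y \<in> M" for x y z
    using that by (intro ell2_eqI) (simp add: ell2_map_nth M_blin M_comp)
  have D_adj: "cinner (ell2_map x z) z' = cinner z (ell2_map (adj x) z')" if "x \<in> M" for x z z'
    by (rule ell2_map_cinner) (use that in \<open>auto simp: M_blin M_adj adj_cinner\<close>)
  define \<Gamma>0 where "\<Gamma>0 = (\<lambda>x. (hat x, ell2_map x w)) ` M"
  define \<Gamma> where "\<Gamma> = closure \<Gamma>0"
  have "ell2_map (\<lambda>e. x e + c *\<^sub>C y e) w = ell2_map x w + c *\<^sub>C ell2_map y w" if "x \<in> M" "y \<in> M"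
      for x y c
    using that by (intro ell2_eqI) (simp add: ell2_map_nth M_blin M_lincomb)
  then have "csubspace \<Gamma>0"
    unfolding \<Gamma>0_def by (intro csubspace_image) (simp add: hat_lincomb scaleC_prod_def)
  then have \<Gamma>: "hilbert \<Gamma>" unfolding \<Gamma>_def by (rule hilbert_closure)
  define T where "T = S \<times> (UNIV :: 'h ell2 set)"
  have Th: "hilbert T"
    using S_hilbert by (auto simp: T_def hilbert_def scaleC_prod_def zero_prod_def intro:
        closed_Times)
  have Tc: "csubspace T" by (rule hilbert_csubspace[OF Th])
  have "\<Gamma>0 \<subseteq> T" by (auto simp: \<Gamma>0_def T_def hat_in)
  then have \<Gamma>T: "\<Gamma> \<subseteq> T" unfolding \<Gamma>_def using Th by (intro closure_minimal) (auto simp: hilbert_iff)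
  \<comment> \<open>The diagonal action of M. It preserves the graph, so the projection onto
    \<Gamma> commutes with it; hence the coordinates of \<rho> (hat x) are those of \<rho> \<Omega>
    with x applied.\<close>
  define \<pi> where "\<pi> x = (\<lambda>p. (L x (fst p), ell2_map x (snd p)))" for x
  have \<pi>b: "blin T T (\<pi> x)" if x: "x \<in> M" for x
  proof -
    obtain K where K: "K > 0" "\<And>e. e \<in> S \<Longrightarrow> norm (L x e) \<le> K * norm e"
      by (rule blin_bound[OF L_blin[OF x]]) (rule that)
    obtain K' where K': "K' > 0" "\<And>e. norm (ell2_map x e) \<le> K' * norm e"
      using blin_UNIV_bound[OF Db[OF x]] by blast
    show ?thesis
    proof (rule blinI[where K="K + K'"])
      fix p assume p: "p \<in> T"
      have "norm (\<pi> x p) \<le> norm (L x (fst p)) + norm (ell2_map x (snd p))"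
        unfolding \<pi>_def by (rule norm_Pair_le)
      also have "\<dots> \<le> K * norm (fst p) + K' * norm (snd p)"
        using p by (intro add_mono K K') (auto simp: T_def)
      also have "\<dots> \<le> K * norm p + K' * norm p"
        using K(1) K'(1) norm_fst_le[of "fst p" "snd p"] norm_snd_le[of "snd p" "fst p"]
        by (intro add_mono mult_left_mono) auto
      finally show "norm (\<pi> x p) \<le> (K + K') * norm p" by (simp add: algebra_simps)
    qed (use blin_add[OF L_blin[OF x]] blin_scaleC[OF L_blin[OF x]] blin_add[OF Db[OF x]]
        blin_scaleC[OF Db[OF x]]
         L_in[OF x] in \<open>auto simp: \<pi>_def T_def scaleC_prod_def\<close>)
  qed
  have \<pi>adj: "cinner (\<pi> x p) q = cinner p (\<pi> (adj x) q)" if "x \<in> M" "p \<in> T" "q \<in> T" for x p q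
    using that L_adj[OF that(1), of "fst p" "fst q"]
        by (auto simp: \<pi>_def T_def cinner_prod_def D_adj)
  have \<pi>\<Gamma>: "\<pi> x p \<in> \<Gamma>" if x: "x \<in> M" and p: "p \<in> \<Gamma>" for x p
  proof -
    obtain s where s: "\<And>n. s n \<in> \<Gamma>0" "s \<longlonglongrightarrow> p" using p unfolding \<Gamma>_def closure_sequential by blast
    have "\<pi> x (s n) \<in> \<Gamma>0" for n
      using s(1)[of n] M_comp[OF x] by (auto simp: \<Gamma>0_def \<pi>_def L_hat x simp flip: D_comp)
    moreover have "(\<lambda>n. \<pi> x (s n)) \<longlonglongrightarrow> \<pi> x p"
      using s(1) \<open>\<Gamma>0 \<subseteq> T\<close> \<Gamma>T p by (intro blin_tendsto[OF Tc \<pi>b[OF x] _ _ s(2)]) auto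
    ultimately show ?thesis
      unfolding \<Gamma>_def closure_sequential by (intro exI[of _ "\<lambda>n. \<pi> x (s n)"]) simp
  qed
  define \<rho> where "\<rho> z = snd (oproj T \<Gamma> (z, 0))" for z
  have inT: "(z, 0) \<in> T" if "z \<in> S" for z using that by (simp add: T_def)
  have ob: "blin T \<Gamma> (oproj T \<Gamma>)" by (rule oproj_blin[OF Tc \<Gamma>])
  have \<rho>n: "norm (\<rho> z) \<le> norm z" if "z \<in> S" for z
  proof -
    have "norm (\<rho> z) \<le> norm (oproj T \<Gamma> (z, 0))"
      unfolding \<rho>_def using norm_snd_le[of "snd (oproj T \<Gamma> (z, 0))" "fst (oproj T \<Gamma> (z, 0))"]
          by simp
    also have "\<dots> \<le> norm (z, 0 :: 'h ell2)" by (rule oproj_norm_le[OF \<Gamma> inT[OF that]])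
    finally show ?thesis by simp
  qed
  show ?thesis
  proof (rule that[of \<rho>])
    show "blin S UNIV \<rho>"
    proof (rule blinI[where K=1])
      show "\<rho> (e + v) = \<rho> e + \<rho> v" if "e \<in> S" "v \<in> S" for e v
        using blin_add[OF ob inT[OF that(1)] inT[OF that(2)]] by (simp add: \<rho>_def)
      show "\<rho> (c *\<^sub>C e) = c *\<^sub>C \<rho> e" if "e \<in> S" for c e
        using blin_scaleC[OF ob inT[OF that], of c] by (simp add: \<rho>_def scaleC_prod_def)
    qed (auto simp: \<rho>n)
    show "norm (\<rho> e) \<le> norm e" if "e \<in> S" for e by (rule \<rho>n[OF that])
    show "ell2_nth (\<rho> (hat x)) i = x (ell2_nth (\<rho> \<Omega>) i)" if x: "x \<in> M" for x i
    proof -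
      have "ell2_map x 0 = 0"
        using x blin_0[OF csubspace_UNIV M_blin[OF x]]
            by (intro ell2_eqI) (simp add: ell2_map_nth M_blin)
      then have "(hat x, 0) = \<pi> x (\<Omega>, 0)" using x by (simp add: \<pi>_def L_\<Omega>)
      then have "oproj T \<Gamma> (hat x, 0) = \<pi> x (oproj T \<Gamma> (\<Omega>, 0))"
        using oproj_commute[OF Tc \<Gamma> \<Gamma>T \<pi>b[OF x] \<pi>\<Gamma>[OF x] \<pi>\<Gamma>[OF M_adj[OF x]] \<pi>adj[OF x]
            inT[OF \<Omega>_in]] by simp
      then show ?thesis using x by (simp add: \<rho>_def \<pi>_def ell2_map_nth M_blin)
    qed
    \<comment> \<open>If (z, 0) projects to (u, 0), then u = 0: along a sequence with hat x -> u and
      x \<omega> -> 0, the formula for \<tau> sends <hat y, hat x> = <y \<theta>, x \<omega>> to 0.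
      So (z, 0) is orthogonal to the graph, and z to every hat y.\<close>
    show "z = 0" if z: "z \<in> S" and "\<rho> z = 0" for z
    proof -
      define u where "u = fst (oproj T \<Gamma> (z, 0))"
      have u: "oproj T \<Gamma> (z, 0) = (u, 0)" using \<open>\<rho> z = 0\<close> by (simp add: u_def \<rho>_def prod_eq_iff)
      then have uG: "(u, 0) \<in> \<Gamma>" using oproj_in[OF \<Gamma> inT[OF z]] by simp
      then have uS: "u \<in> S" using \<Gamma>T by (auto simp: T_def)
      obtain s where s: "\<And>n. s n \<in> \<Gamma>0" "s \<longlonglongrightarrow> (u, 0)" using uG unfolding \<Gamma>_def closure_sequential
          by blast
      then have "\<forall>n. \<exists>x. x \<in> M \<and> s n = (hat x, ell2_map x w)" by (auto simp: \<Gamma>0_def)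
      then obtain x where x: "\<And>n. x n \<in> M" "\<And>n. s n = (hat (x n), ell2_map (x n) w)" by metis
      have l: "(\<lambda>n. hat (x n)) \<longlonglongrightarrow> u" "(\<lambda>n. ell2_map (x n) w) \<longlonglongrightarrow> 0"
        using tendsto_fst[OF s(2)] tendsto_snd[OF s(2)] by (simp_all add: x)
      have "cinner u (hat y) = 0" if y: "y \<in> M" for y
      proof -
        have "cinner (hat y) (hat (x n)) = cinner (ell2_map y \<theta>) (ell2_map (x n) w)" for n
          using x(1)[of n] y D_adj[of "adj (x n)" "ell2_map y \<theta>" w]
          by (simp add: cinner_hat \<tau>D M_comp M_adj D_comp)
        moreover have "(\<lambda>n. cinner (hat y) (hat (x n))) \<longlonglongrightarrow> cinner (hat y) u"
            by (intro tendsto_intros l)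
        moreover have "(\<lambda>n. cinner (ell2_map y \<theta>) (ell2_map (x n) w)) \<longlonglongrightarrow> cinner (ell2_map y \<theta>) 0"
          by (intro tendsto_intros l)
        ultimately have "cinner (hat y) u = cinner (ell2_map y \<theta>) 0" using LIMSEQ_unique by auto
        then show ?thesis by (subst cinner_commute) simp
      qed
      then have "u = 0" by (intro S_eqI uS csubspace_0 S_csub) simp
      then have "oproj T \<Gamma> (z, 0) = 0" using u by (simp add: zero_prod_def)
      then have "cinner (z, 0) (hat y, ell2_map y w) = 0" if "y \<in> M" for y
        using oproj_orth[OF \<Gamma> inT[OF z], of "(hat y, ell2_map y w)"] that closure_subset[of \<Gamma>0]
        by (auto simp: \<Gamma>0_def \<Gamma>_def)
      then show "z = 0" by (intro S_eqI z csubspace_0 S_csub) (simp add: cinner_prod_def)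
    qed
  qed
qed

text \<open>These are the u for which hat x -> x u extends to a bounded map from \<open>L^2\<close>
  to the ambient space.\<close>

definition tau_bounded :: "'h set" where
  "tau_bounded = {u. \<exists>K. \<forall>x\<in>M. norm (x u) \<le> K * norm (hat x)}"

lemma tau_bounded_csubspace: "csubspace tau_bounded"
  using csubspace_bounded[OF csubspace_UNIV M_blin, where I=M and f="\<lambda>x. x"
      and c="\<lambda>x. norm (hat x)"]
  by (simp add: tau_bounded_def)

lemma tau_bounded_commutant:
  assumes y: "y \<in> commutant UNIV M" and xi: "u \<in> tau_bounded" shows "y u \<in> tau_bounded"
proof -
  obtain K where K: "\<And>x. x \<in> M \<Longrightarrow> norm (x u) \<le> K * norm (hat x)" using xi
      by (auto simp: tau_bounded_def)
  obtain C where C: "C > 0" "\<And>u. norm (y u) \<le> C * norm u"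
      using blin_UNIV_bound[OF commutant_blin[OF y]] by blast
  have "norm (x (y u)) \<le> (C * K) * norm (hat x)" if "x \<in> M" for x
    using order_trans[OF C(2)[of "x u"] mult_left_mono[OF K[OF that], of C]] C(1)
        M_commute[OF that y]
    by (simp add: mult.assoc)
  then show ?thesis unfolding tau_bounded_def by blast
qed

text \<open>The closure is invariant under the commutant, so its projection p lies in M. The
  coordinates of \<rho> \<Omega> are trace bounded and thus fixed by p, which gives \<rho> (hat p) =
  \<rho> \<Omega>; injectivity of \<rho> and of hat yields p = 1.\<close>

lemma tau_bounded_dense: "closure tau_bounded = UNIV"
proof -
  obtain \<rho> where \<rho>: "blin S UNIV \<rho>" "\<And>u. u \<in> S \<Longrightarrow> norm (\<rho> u) \<le> norm u"
    "\<And>x i. x \<in> M \<Longrightarrow> ell2_nth (\<rho> (hat x)) i = x (ell2_nth (\<rho> \<Omega>) i)"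
    "\<And>z. z \<in> S \<Longrightarrow> \<rho> z = 0 \<Longrightarrow> z = 0" by (rule separating_bounded_map) (rule that)
  let ?T = "closure tau_bounded"
  let ?p = "oproj UNIV ?T"
  have T: "hilbert ?T" by (rule hilbert_closure[OF tau_bounded_csubspace])
  have inv: "y u \<in> ?T" if y: "y \<in> commutant UNIV M" and u: "u \<in> ?T" for y u
  proof -
    obtain s where s: "\<And>n. s n \<in> tau_bounded" "s \<longlonglongrightarrow> u" using u unfolding closure_sequential by blast
    have "(\<lambda>n. y (s n)) \<longlonglongrightarrow> y u"
      by (rule blin_tendsto[OF csubspace_UNIV commutant_blin[OF y] _ _ s(2)]) auto
    then show ?thesis
      unfolding closure_sequential using tau_bounded_commutant[OF y s(1)]
      by (intro exI[of _ "\<lambda>n. y (s n)"]) simp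
  qed
  have pb: "?p \<in> bop UNIV" by (rule oproj_bop[OF csubspace_UNIV T]) simp
  have "?p (y u) = y (?p u)" if y: "y \<in> commutant UNIV M" for y u
    by (rule oproj_commute[OF csubspace_UNIV T _ commutant_blin[OF y] inv[OF y]
        inv[OF commutant_adj[OF y]]])
       (use y in \<open>auto simp: commutant_def intro!: cinner_hadj[OF hilbert_UNIV]\<close>)
  then have pM: "?p \<in> M" using pb by (simp add: M_iff bop_iff)
  have "ell2_nth (\<rho> \<Omega>) i \<in> tau_bounded" for i
  proof -
    have "norm (x (ell2_nth (\<rho> \<Omega>) i)) \<le> 1 * norm (hat x)" if "x \<in> M" for x
      using norm_ell2_nth_le[of "\<rho> (hat x)" i] \<rho>(2)[OF hat_in[OF that]] \<rho>(3)[OF that, of i] by simp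
    then show ?thesis unfolding tau_bounded_def by blast
  qed
  then have "?p (ell2_nth (\<rho> \<Omega>) i) = ell2_nth (\<rho> \<Omega>) i" for i
    using closure_subset by (intro oproj_same[OF T]) auto
  then have "\<rho> (hat ?p) = \<rho> \<Omega>" by (intro ell2_eqI) (simp add: \<rho>(3)[OF pM])
  then have "\<rho> (hat ?p - \<Omega>) = 0" using blin_diff[OF S_csub \<rho>(1) hat_in[OF pM] \<Omega>_in] by simp
  then have "hat ?p = \<Omega>"
    using \<rho>(4)[OF csubspace_diff[OF S_csub hat_in[OF pM] \<Omega>_in]] by simp
  then have "?p = (\<lambda>u. u)" by (rule hat_inj[OF pM M_id])
  then have "u \<in> ?T" for u using oproj_in[OF T, of u UNIV] by (metis UNIV_I)
  then show ?thesis by blast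
qed

lemma tau_bounded_map:
  assumes "u \<in> tau_bounded"
  obtains F where "blin S UNIV F" "\<And>x. x \<in> M \<Longrightarrow> F (hat x) = x u"
proof -
  obtain K where K: "\<And>x. x \<in> M \<Longrightarrow> norm (x u) \<le> K * norm (hat x)" using assms
      by (auto simp: tau_bounded_def)
  show ?thesis by (rule hat_extension[of UNIV "\<lambda>x. x u" K]) (auto intro: K that)
qed

text \<open>Here f is left multiplication by t; as the extension of x -> t x it commutes with right
  multiplication.\<close>

lemma left_bounded_map:
  assumes t: "t \<in> S" and K: "\<And>x. x \<in> M \<Longrightarrow> norm (R x t) \<le> K * norm (hat x)"
  obtains f where "blin S S f" "\<And>x. x \<in> M \<Longrightarrow> f (hat x) = R x t"
    "\<And>y u. y \<in> M \<Longrightarrow> u \<in> S \<Longrightarrow> f (R y u) = R y (f u)"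
proof -
  obtain f where f: "blin S S f" "\<And>x. x \<in> M \<Longrightarrow> f (hat x) = R x t"
    using S_hilbert by (rule_tac hat_extension[of S "\<lambda>x. R x t" K])
        (auto simp: hilbert_iff R_in t R_lincomb K)
  have "f (R y u) = R y (f u)" if "y \<in> M" "u \<in> S" for y u
    by (rule S_blin_eqI[OF blin_compose[OF R_blin f(1)] blin_compose[OF f(1) R_blin] _ that(2)])
       (use that t in \<open>simp_all add: R_hat f(2) M_comp R_comp\<close>)
  then show ?thesis using that[of f] f by blast
qed

text \<open>The point is that C depends on f only, whereas the norm of F is uncontrolled. For G the
  adjoint of F, h = G F is a left module map, so it commutes with the right module maps f and N = f*
  f. This allows factors N to be moved past h, and the quantities norm (F (N^k \<Omega>)) satisfy
  the hypotheses of \<open>moment_bound\<close>.\<close>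

lemma tau_bounded_estimate:
  assumes f: "blin S S f" and fR: "\<And>y u. y \<in> M \<Longrightarrow> u \<in> S \<Longrightarrow> f (R y u) = R y (f u)"
  obtains C where "0 \<le> C" "\<And>u F. blin S UNIV F \<Longrightarrow> (\<And>x. x \<in> M \<Longrightarrow> F (hat x) = x u) \<Longrightarrow> norm (F (f \<Omega>)) \<le>
      C * norm u"
proof -
  obtain g where g: "blin S S g" "\<And>u v. u \<in> S \<Longrightarrow> v \<in> S \<Longrightarrow> cinner (f u) v = cinner u (g v)"
    using blin_adjoint_ex[OF S_hilbert f] by blast
  have gR: "g (R y u) = R y (g u)" if "y \<in> M" "u \<in> S" for y u
    by (rule adjoint_commute_R[OF f g fR that])
  define N where "N = (\<lambda>z. g (f z))"
  have Nb: "blin S S N" unfolding N_def by (rule blin_compose[OF f g(1)])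
  have NS: "N z \<in> S" if "z \<in> S" for z by (rule blin_in[OF Nb that])
  have N_sym: "cinner (N z) w = cinner z (N w)" if "z \<in> S" "w \<in> S" for z w
  proof -
    have "cinner (N z) w = cinner (f z) (f w)"
      unfolding N_def using g(2)[OF that(2) blin_in[OF f that(1)]] by (rule cinner_swap[symmetric])
    also have "\<dots> = cinner z (N w)" unfolding N_def by (rule g(2)[OF that(1) blin_in[OF f that(2)]])
    finally show ?thesis .
  qed
  obtain Q where Q: "Q > 0" "\<And>z. z \<in> S \<Longrightarrow> norm (N z) \<le> Q * norm z"
    by (rule blin_bound[OF Nb]) (rule that)
  have est: "norm (F (f \<Omega>)) \<le> sqrt Q * norm u"
    if F: "blin S UNIV F" and Fu: "\<And>x. x \<in> M \<Longrightarrow> F (hat x) = x u" for F u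
  proof -
    obtain G where G: "blin UNIV S G" "\<And>z v. z \<in> S \<Longrightarrow> cinner (F z) v = cinner z (G v)"
      using blin_adjoint_ex[OF S_hilbert F] by blast
    define h where "h = (\<lambda>z. G (F z))"
    have hb: "blin S S h" unfolding h_def by (rule blin_compose[OF F G(1)])
    have hS: "h z \<in> S" if "z \<in> S" for z by (rule blin_in[OF hb that])
    have FL: "F (L y z) = y (F z)" if "y \<in> M" "z \<in> S" for y z
      by (rule S_blin_eqI[OF blin_compose[OF L_blin F] blin_compose[OF F M_blin] _ that(2)])
         (use that in \<open>simp_all add: L_hat Fu M_comp\<close>)
    have GL: "G (y v) = L y (G v)" if y: "y \<in> M" for y v
      by (rule adjoint_intertwines[where S=S and T=UNIV and W=F and g="adj y" and g'="L (adj y)"])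
         (simp_all add: S_csub G(2) blin_in[OF G(1)] L_in y M_adj adj_cinner L_adj FL)
    have hL: "h (L y z) = L y (h z)" if "y \<in> M" "z \<in> S" for y z
      unfolding h_def by (simp add: FL[OF that] GL[OF that(1)])
    have hf: "f (h z) = h (f z)" if "z \<in> S" for z by (rule commutation[OF f hb fR hL that])
    have hg: "g (h z) = h (g z)" if "z \<in> S" for z by (rule commutation[OF g(1) hb gR hL that])
    have hN: "N (h z) = h (N z)" if "z \<in> S" for z
      unfolding N_def using hf[OF that] hg[OF blin_in[OF f that]] by simp
    have PS: "(N ^^ k) z \<in> S" if "z \<in> S" for k z
      by (induction k) (auto simp: that NS)
    have Ph: "(N ^^ k) (h z) = h ((N ^^ k) z)" if "z \<in> S" for k z
      by (induction k) (auto simp: that hN PS)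
    have Psym: "cinner ((N ^^ k) z) w = cinner z ((N ^^ k) w)" if "z \<in> S" "w \<in> S" for k z w
      using that
    proof (induction k arbitrary: w)
      case (Suc k)
      then show ?case by (simp add: N_sym PS NS) (simp add: funpow_swap1)
    qed simp
    have Pn: "norm ((N ^^ k) z) \<le> Q ^ k * norm z" if "z \<in> S" for k z
    proof (induction k)
      case (Suc k)
      have "norm ((N ^^ Suc k) z) \<le> Q * norm ((N ^^ k) z)" using Q(2)[OF PS[OF that]] by simp
      also have "\<dots> \<le> Q * (Q ^ k * norm z)" using Suc.IH Q(1) by (intro mult_left_mono) auto
      finally show ?case by simp
    qed simp
    have Fh: "cinner (F z) (F w) = cinner z (h w)" if "z \<in> S" for z w
      unfolding h_def by (rule G(2)[OF that])
    have F\<Omega>: "F \<Omega> = u" using Fu[OF M_id] by simp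
    obtain K where K: "K > 0" "\<And>z. z \<in> S \<Longrightarrow> norm (F z) \<le> K * norm z"
      by (rule blin_bound[OF F]) (rule that)
    define c where "c k = norm (F ((N ^^ k) \<Omega>))" for k
    \<comment> \<open>Moving N^k across turns the square of c k into <F (N^(2k) \<Omega>), u>. The
      crude constant \<open>K * norm \<Omega>\<close> depends on F but disappears from the
      conclusion; only Q, a bound for N, remains.\<close>
    have c1: "c 1 \<le> Q * norm u"
    proof (rule moment_bound[where C="K * norm \<Omega>"])
      fix k
      show "0 \<le> c k" by (simp add: c_def)
      have "(c k)\<^sup>2 = cmod (cinner (F ((N ^^ k) \<Omega>)) (F ((N ^^ k) \<Omega>)))"
        by (simp add: cinner_same c_def norm_power)
      also have "\<dots> = cmod (cinner ((N ^^ k) \<Omega>) ((N ^^ k) (h \<Omega>)))"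
        by (simp add: Fh PS \<Omega>_in Ph)
      also have "\<dots> = cmod (cinner ((N ^^ (2 * k)) \<Omega>) (h \<Omega>))"
        by (simp add: Psym[symmetric] PS \<Omega>_in hS mult_2 funpow_add)
      also have "\<dots> = cmod (cinner (F ((N ^^ (2 * k)) \<Omega>)) u)"
        using Fh[OF PS[OF \<Omega>_in], of _ \<Omega>] F\<Omega> by simp
      also have "\<dots> \<le> c (2 * k) * norm u"
        unfolding c_def by (rule cinner_Cauchy_Schwarz)
      finally show "(c k)\<^sup>2 \<le> norm u * c (2 * k)" by (simp add: mult.commute)
      have "c k \<le> K * norm ((N ^^ k) \<Omega>)" unfolding c_def by (rule K(2)[OF PS[OF \<Omega>_in]])
      also have "\<dots> \<le> K * (Q ^ k * norm \<Omega>)" using K(1) Pn[OF \<Omega>_in] by (intro mult_left_mono) auto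
      finally show "c k \<le> K * norm \<Omega> * Q ^ k" by (simp add: algebra_simps)
    qed (use Q in auto)
    have f\<Omega>: "f \<Omega> \<in> S" by (rule blin_in[OF f \<Omega>_in])
    have "cinner (F (f \<Omega>)) (F (f \<Omega>)) = cinner (f \<Omega>) (f (h \<Omega>))"
      by (simp add: Fh[OF f\<Omega>] hf[OF \<Omega>_in])
    also have "\<dots> = cinner \<Omega> (N (h \<Omega>))"
      unfolding N_def by (rule g(2)[OF \<Omega>_in blin_in[OF f hS[OF \<Omega>_in]]])
    also have "\<dots> = cinner u (F (N \<Omega>))"
      using Fh[OF \<Omega>_in, of "N \<Omega>"] F\<Omega> by (simp add: hN[OF \<Omega>_in])
    finally have "(norm (F (f \<Omega>)))\<^sup>2 = cmod (cinner u (F (N \<Omega>)))"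
      by (metis cinner_same norm_of_real abs_power2)
    also have "\<dots> \<le> norm u * c 1" using cinner_Cauchy_Schwarz[of u "F (N \<Omega>)"] by (simp add: c_def)
    also have "\<dots> \<le> norm u * (Q * norm u)" by (intro mult_left_mono c1) auto
    also have "\<dots> = (sqrt Q * norm u)\<^sup>2" using Q(1) by (simp add: power2_eq_square algebra_simps)
    finally show ?thesis by (rule power2_le_imp_le) (use Q(1) in auto)
  qed
  show ?thesis by (rule that[of "sqrt Q"]) (use Q(1) est in auto)
qed

text \<open>The candidate preimage of \<open>t\<close> acts on the dense set of trace bounded vectors as the limit
  of an approximating sequence.\<close>

theorem left_bounded_in_range:
  assumes t: "t \<in> S" and K: "\<And>x. x \<in> M \<Longrightarrow> norm (R x t) \<le> K * norm (hat x)"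
  shows "\<exists>a\<in>M. hat a = t"
proof -
  obtain f where f: "blin S S f" "\<And>x. x \<in> M \<Longrightarrow> f (hat x) = R x t"
    "\<And>y u. y \<in> M \<Longrightarrow> u \<in> S \<Longrightarrow> f (R y u) = R y (f u)"
    by (rule left_bounded_map[OF t K]) (auto intro: that)
  have f\<Omega>: "f \<Omega> = t" using f(2)[OF M_id] R_id[OF t] by simp
  obtain C where C: "0 \<le> C" "\<And>u F. blin S UNIV F \<Longrightarrow> (\<And>x. x \<in> M \<Longrightarrow> F (hat x) = x u) \<Longrightarrow> norm (F t) \<le>
      C * norm u"
    using tau_bounded_estimate[OF f(1,3)] unfolding f\<Omega> by blast
  obtain a where a: "\<And>n. a n \<in> M" "(\<lambda>n. hat (a n)) \<longlonglongrightarrow> t" using hat_seq[OF t] by blast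
  \<comment> \<open>For trace bounded u, \<open>a n u\<close> is the image of
    \<open>hat (a n)\<close> under a bounded map, so it converges; the limit is controlled by the C
    that serves all u.\<close>
  have lim: "\<exists>v. (\<lambda>n. a n u) \<longlonglongrightarrow> v \<and> norm v \<le> C * norm u" if xi: "u \<in> tau_bounded" for u
  proof -
    obtain F where F: "blin S UNIV F" "\<And>x. x \<in> M \<Longrightarrow> F (hat x) = x u"
      by (rule tau_bounded_map[OF xi]) (rule that)
    have "(\<lambda>n. F (hat (a n))) \<longlonglongrightarrow> F t"
      by (rule blin_tendsto[OF S_csub F(1) hat_in t a(2)]) (rule a)
    then show ?thesis using C(2)[OF F] F(2) a(1) by auto
  qed
  define G where "G = {(u, v). u \<in> tau_bounded \<and> (\<lambda>n. a n u) \<longlonglongrightarrow> v}"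
  have "csubspace G"
    unfolding csubspace_def
  proof (intro conjI ballI allI)
    show "0 \<in> G"
      using csubspace_0[OF tau_bounded_csubspace] blin_0[OF csubspace_UNIV M_blin[OF a(1)]]
      by (simp add: G_def zero_prod_def)
    fix p q c assume "p \<in> G"
    then obtain u v where p: "p = (u, v)" "u \<in> tau_bounded" "(\<lambda>n. a n u) \<longlonglongrightarrow> v" by (auto simp: G_def)
    show "c *\<^sub>C p \<in> G"
      using p csubspace_scaleC[OF tau_bounded_csubspace p(2)] tendsto_scaleC[OF p(3), of c]
      by (simp add: G_def scaleC_prod_def blin_scaleC[OF M_blin[OF a(1)]])
    assume "q \<in> G"
    then obtain u' v' where q: "q = (u', v')" "u' \<in> tau_bounded" "(\<lambda>n. a n u') \<longlonglongrightarrow> v'"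
        by (auto simp: G_def)
    show "p + q \<in> G"
      using p q csubspace_add[OF tau_bounded_csubspace p(2) q(2)] tendsto_add[OF p(3) q(3)]
      by (simp add: G_def blin_add[OF M_blin[OF a(1)]])
  qed
  moreover have "norm v \<le> C * norm u" if "(u, v) \<in> G" for u v
    using that lim[of u] LIMSEQ_unique by (auto simp: G_def)
  ultimately obtain b where b: "blin (closure (fst ` G)) (closure (snd ` G)) b" "\<And>u v. (u, v)
      \<in> G \<Longrightarrow> b u = v"
    by (rule blin_graph_extension[where K=C]) (auto simp: C)
  have "fst ` G = tau_bounded" using lim by (force simp: G_def)
  then have bb: "blin UNIV UNIV b" using b(1) unfolding blin_def by (simp add: tau_bounded_dense)
  have blim: "(\<lambda>n. a n u) \<longlonglongrightarrow> b u" if "u \<in> tau_bounded" for u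
    using lim[OF that] b(2)[of u] that by (auto simp: G_def)
  \<comment> \<open>The commutant preserves trace bounded vectors and commutes with each
    \<open>a n\<close>, so it commutes with the limit there, and by density everywhere.\<close>
  have "b (y u) = y (b u)" if y: "y \<in> commutant UNIV M" for y u
  proof (rule blin_eq_dense[OF csubspace_UNIV blin_compose[OF commutant_blin[OF y] bb]
      blin_compose[OF bb commutant_blin[OF y]]])
    show "UNIV \<subseteq> closure tau_bounded" by (simp add: tau_bounded_dense)
    fix u assume xi: "u \<in> tau_bounded"
    have "(\<lambda>n. y (a n u)) \<longlonglongrightarrow> y (b u)"
      by (rule blin_tendsto[OF csubspace_UNIV commutant_blin[OF y] _ _ blim[OF xi]]) auto
    then show "b (y u) = y (b u)"
      using LIMSEQ_unique[OF blim[OF tau_bounded_commutant[OF y xi]]]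
          by (simp add: M_commute[OF a(1) y])
  qed auto
  then have bM: "b \<in> M" using bb by (simp add: M_iff)
  obtain \<rho> where \<rho>: "blin S UNIV \<rho>" "\<And>u. u \<in> S \<Longrightarrow> norm (\<rho> u) \<le> norm u"
    "\<And>x i. x \<in> M \<Longrightarrow> ell2_nth (\<rho> (hat x)) i = x (ell2_nth (\<rho> \<Omega>) i)"
    "\<And>z. z \<in> S \<Longrightarrow> \<rho> z = 0 \<Longrightarrow> z = 0" by (rule separating_bounded_map) (rule that)
  \<comment> \<open>The coordinates of \<rho> \<Omega> are trace bounded, so b acts on them as the
    limit of the \<open>a n\<close>; by continuity of \<rho> that limit also gives the coordinates
    of \<rho> t.\<close>
  have "\<rho> (hat b) = \<rho> t"
  proof (rule ell2_eqI)
    fix i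
    have "norm (x (ell2_nth (\<rho> \<Omega>) i)) \<le> 1 * norm (hat x)" if "x \<in> M" for x
      using norm_ell2_nth_le[of "\<rho> (hat x)" i] \<rho>(2)[OF hat_in[OF that]] \<rho>(3)[OF that, of i] by simp
    then have "ell2_nth (\<rho> \<Omega>) i \<in> tau_bounded" unfolding tau_bounded_def by blast
    from blim[OF this] have l1: "(\<lambda>n. ell2_nth (\<rho> (hat (a n))) i) \<longlonglongrightarrow> ell2_nth (\<rho> (hat b)) i"
      by (simp add: \<rho>(3) a(1) bM)
    have "(\<lambda>n. \<rho> (hat (a n))) \<longlonglongrightarrow> \<rho> t"
      by (rule blin_tendsto[OF S_csub \<rho>(1) hat_in t a(2)]) (rule a)
    then have z0: "(\<lambda>n. norm (\<rho> (hat (a n)) - \<rho> t)) \<longlonglongrightarrow> 0" by (simp add: LIM_zero tendsto_norm_zero)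
    have le: "norm (ell2_nth (\<rho> (hat (a n))) i - ell2_nth (\<rho> t) i) \<le> norm (norm (\<rho> (hat (a n))
        - \<rho> t)) * 1" for n
      using norm_ell2_nth_le[of "\<rho> (hat (a n)) - \<rho> t" i] by simp
    have "(\<lambda>n. ell2_nth (\<rho> (hat (a n))) i - ell2_nth (\<rho> t) i) \<longlonglongrightarrow> 0"
      by (rule tendsto_0_le[OF z0 always_eventually]) (use le in blast)
    then have "(\<lambda>n. ell2_nth (\<rho> (hat (a n))) i) \<longlonglongrightarrow> ell2_nth (\<rho> t) i" by (simp add: LIM_zero_iff)
    then show "ell2_nth (\<rho> (hat b)) i = ell2_nth (\<rho> t) i" using LIMSEQ_unique[OF l1] by simp
  qed
  then have "\<rho> (hat b - t) = 0" using blin_diff[OF S_csub \<rho>(1) hat_in[OF bM] t] by simp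
  then have "hat b = t" using \<rho>(4)[OF csubspace_diff[OF S_csub hat_in[OF bM] t]] by simp
  then show ?thesis using bM by blast
qed

text \<open>The vector \<Omega> is a trace vector for the commutant as well: by
  \<open>adjoint_limit\<close>, v and its adjoint give \<Omega> images of equal norm. For an
  isometry v this forces v v* \<Omega> = \<Omega>, and \<Omega> is cyclic for the left action, with
  which v v* commutes.\<close>

lemma finite_vna_commutant: "finite_vna S (commutant S (L ` M))"
  unfolding finite_vna_def
proof (intro ballI impI)
  fix v assume v: "v \<in> commutant S (L ` M)" and iso: "compose S (hadj S v) v = (\<lambda>u\<in>S. u)"
  have vb: "v \<in> bop S" and vL: "\<And>y u. y \<in> M \<Longrightarrow> u \<in> S \<Longrightarrow> v (L y u) = L y (v u)"
    using v unfolding commutant_def by auto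
  define w where "w = hadj S v"
  have wb: "w \<in> bop S" unfolding w_def by (rule hadj_bop[OF S_hilbert vb])
  have vw: "cinner (v u) z = cinner u (w z)" if "u \<in> S" "z \<in> S" for u z
    unfolding w_def by (rule cinner_hadj[OF S_hilbert vb that])
  note vl = bop_blin[OF vb] and wl = bop_blin[OF wb]
  note vS = blin_in[OF vl] and wS = blin_in[OF wl]
  have wv: "w (v u) = u" if "u \<in> S" for u
    using fun_cong[OF iso, of u] that by (simp add: compose_def w_def)
  have wL: "w (L y u) = L y (w u)" if "y \<in> M" "u \<in> S" for y u
    by (rule adjoint_commute_L[OF vl wl vw vL that])
  have isom: "norm (v u) = norm u" if "u \<in> S" for u
  proof -
    have "cinner (v u) (v u) = cinner u u" using vw[OF that vS[OF that]] wv[OF that] by simp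
    then have "(norm (v u))\<^sup>2 = (norm u)\<^sup>2" unfolding cinner_same using of_real_eq_iff by blast
    then show ?thesis by simp
  qed
  obtain a where a: "\<And>n. a n \<in> M" "(\<lambda>n. hat (a n)) \<longlonglongrightarrow> v \<Omega>" using hat_seq[OF vS[OF \<Omega>_in]] by blast
  have vhat: "\<forall>y\<in>M. v (hat y) = L y (v \<Omega>)"
    using vL[OF _ \<Omega>_in] by (simp add: L_\<Omega>)
  have "(\<lambda>n. hat (adj (a n))) \<longlonglongrightarrow> w \<Omega>" using adjoint_limit[OF vl wl vw _ a] vhat by blast
  then have "(\<lambda>n. norm (hat (adj (a n)))) \<longlonglongrightarrow> norm (w \<Omega>)" by (rule tendsto_norm)
  moreover have "(\<lambda>n. norm (hat (adj (a n)))) \<longlonglongrightarrow> norm (v \<Omega>)"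
    using tendsto_norm[OF a(2)] by (simp add: norm_hat_adj a(1))
  ultimately have n: "norm (w \<Omega>) = norm \<Omega>" using LIMSEQ_unique isom[OF \<Omega>_in] by simp
  have w\<Omega>: "w \<Omega> \<in> S" "v (w \<Omega>) \<in> S" using wS vS \<Omega>_in by auto
  \<comment> \<open>All inner products among v (w \<Omega>) and \<Omega> equal the squared norm of
    \<Omega>, so the two vectors coincide.\<close>
  have "cinner (v (w \<Omega>)) \<Omega> = complex_of_real ((norm \<Omega>)\<^sup>2)"
    using vw[OF w\<Omega>(1) \<Omega>_in] n by (simp add: cinner_same)
  moreover have "cinner (v (w \<Omega>)) (v (w \<Omega>)) = complex_of_real ((norm \<Omega>)\<^sup>2)"
    using isom[OF w\<Omega>(1)] n by (simp add: cinner_same)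
  moreover have "cinner \<Omega> (v (w \<Omega>)) = complex_of_real ((norm \<Omega>)\<^sup>2)"
    using calculation(1) by (subst cinner_commute) simp
  ultimately have "cinner (v (w \<Omega>) - \<Omega>) (v (w \<Omega>) - \<Omega>) = 0"
    by (simp add: cinner_diff_left cinner_diff_right cinner_same[of \<Omega>])
  then have vw\<Omega>: "v (w \<Omega>) = \<Omega>" by simp
  have "v (w u) = u" if "u \<in> S" for u
  proof (rule S_blin_eqI[OF blin_compose[OF wl vl] blin_id _ that])
    fix x assume x: "x \<in> M"
    have "v (w (L x \<Omega>)) = L x (v (w \<Omega>))"
      using wL[OF x \<Omega>_in] vL[OF x w\<Omega>(1)] by simp
    then show "v (w (hat x)) = hat x" using x by (simp add: vw\<Omega> L_\<Omega>)
  qed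
  then show "compose S v (hadj S v) = (\<lambda>u\<in>S. u)" by (auto simp: compose_def w_def)
qed

end

section \<open>Inclusions and algebra-valued inner products\<close>

lemma blin_invariant_subset:
  assumes f: "blin S S f" and TS: "T \<subseteq> S" and inv: "\<And>u. u \<in> T \<Longrightarrow> f u \<in> T"
  shows "blin T T f"
proof -
  obtain K where K: "K > 0" "\<And>u. u \<in> S \<Longrightarrow> norm (f u) \<le> K * norm u"
    by (rule blin_bound[OF f]) (rule that)
  show ?thesis
    by (rule blinI[where K=K]) (simp_all add: inv blin_add[OF f] blin_scaleC[OF f] K subsetD[OF TS])
qed

text \<open>The invariant of the induction over tensor powers: \<open>X_bimodule\<close> starts it
  and \<open>T_bimodule\<close> hands it on. The law for the zero element is listed because the
  clauses do not include additivity of the left action in its algebra argument.\<close>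

definition hilbert_bimodule :: "('h::chilbert_space \<Rightarrow> 'h) set \<Rightarrow> ('h, 'k::chilbert_space)
    bimod \<Rightarrow> bool" where
  "hilbert_bimodule A Y \<longleftrightarrow> hilbert (hspace Y) \<and>
     (\<forall>a\<in>A. lact Y a \<in> bop (hspace Y) \<and> ract Y a \<in> bop (hspace Y)) \<and>
     (\<forall>a\<in>A. \<forall>u\<in>hspace Y. \<forall>v\<in>hspace Y.
        cinner (lact Y a u) v = cinner u (lact Y (hadj UNIV a) v) \<and>
        cinner (ract Y a u) v = cinner u (ract Y (hadj UNIV a) v)) \<and>
     (\<forall>a\<in>A. \<forall>b\<in>A. \<forall>u\<in>hspace Y. lact Y (a \<circ> b) u = lact Y a (lact Y b u) \<and>
        lact Y a (ract Y b u) = ract Y b (lact Y a u)) \<and>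
     (\<forall>u\<in>hspace Y. lact Y (\<lambda>u. u) u = u \<and> lact Y (\<lambda>u. 0) u = 0)"

lemma
  assumes "hilbert_bimodule A Y"
  shows bimod_hilbert: "hilbert (hspace Y)"
    and bimod_csub: "csubspace (hspace Y)"
    and bimod_lact: "a \<in> A \<Longrightarrow> blin (hspace Y) (hspace Y) (lact Y a)"
    and bimod_ract: "a \<in> A \<Longrightarrow> blin (hspace Y) (hspace Y) (ract Y a)"
    and bimod_lact_in: "a \<in> A \<Longrightarrow> u \<in> hspace Y \<Longrightarrow> lact Y a u \<in> hspace Y"
    and bimod_ract_in: "a \<in> A \<Longrightarrow> u \<in> hspace Y \<Longrightarrow> ract Y a u \<in> hspace Y"
    and bimod_lact_adj: "a \<in> A \<Longrightarrow> u \<in> hspace Y \<Longrightarrow> v \<in> hspace Y \<Longrightarrow>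
      cinner (lact Y a u) v = cinner u (lact Y (hadj UNIV a) v)"
    and bimod_ract_adj: "a \<in> A \<Longrightarrow> u \<in> hspace Y \<Longrightarrow> v \<in> hspace Y \<Longrightarrow>
      cinner (ract Y a u) v = cinner u (ract Y (hadj UNIV a) v)"
    and bimod_lact_comp: "a \<in> A \<Longrightarrow> b \<in> A \<Longrightarrow> u \<in> hspace Y \<Longrightarrow> lact Y (a \<circ> b) u = lact Y a (lact Y b u)"
    and bimod_commute: "a \<in> A \<Longrightarrow> b \<in> A \<Longrightarrow> u \<in> hspace Y \<Longrightarrow> lact Y a (ract Y b u) =
        ract Y b (lact Y a u)"
    and bimod_lact_id: "u \<in> hspace Y \<Longrightarrow> lact Y (\<lambda>u. u) u = u"
    and bimod_lact_0: "u \<in> hspace Y \<Longrightarrow> lact Y (\<lambda>u. 0) u = 0"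
proof -
  note h = assms[unfolded hilbert_bimodule_def]
  show "hilbert (hspace Y)" using h by blast
  then show "csubspace (hspace Y)" by (rule hilbert_csubspace)
  show l: "a \<in> A \<Longrightarrow> blin (hspace Y) (hspace Y) (lact Y a)"
    and r: "a \<in> A \<Longrightarrow> blin (hspace Y) (hspace Y) (ract Y a)" using h bop_blin by blast+
  show "a \<in> A \<Longrightarrow> u \<in> hspace Y \<Longrightarrow> lact Y a u \<in> hspace Y"
    and "a \<in> A \<Longrightarrow> u \<in> hspace Y \<Longrightarrow> ract Y a u \<in> hspace Y" using l r blin_in by blast+
qed (use assms in \<open>unfold hilbert_bimodule_def, blast+\<close>)

locale inclusion = L2_space B \<tau> X hat + A: vN_algebra A
  for A B :: "('h::chilbert_space \<Rightarrow> 'h) set" and \<tau> :: "('h \<Rightarrow> 'h) \<Rightarrow> complex"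
    and X :: "('h, 'k::chilbert_space) bimod" and hat :: "('h \<Rightarrow> 'h) \<Rightarrow> 'k" +
  assumes AB: "A \<subseteq> B"
begin

lemma A_B: "a \<in> A \<Longrightarrow> a \<in> B" using AB by blast

lemma X_bimodule: "hilbert_bimodule A X"
proof -
  have "L (\<lambda>u. 0) u = 0" if "u \<in> S" for u
  proof (rule S_blin_eqI[OF L_blin _ _ that, where T'=UNIV])
    show 0: "(\<lambda>u. 0) \<in> B" using M_scaleC[OF M_id, of 0] by simp
    show "blin S UNIV (\<lambda>u. 0 :: 'k)" by (rule blinI[where K=1]) auto
    fix x assume "x \<in> B"
    then show "L (\<lambda>u. 0) (hat x) = 0" using hat_scaleC[OF M_id, of 0] by (simp add: L_hat 0 o_def)
  qed
  then show ?thesis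
    unfolding hilbert_bimodule_def
    by (auto simp: A_B S_hilbert L_bop R_bop L_adj R_adj L_comp L_R L_id)
qed

definition SA :: "'k set" where "SA = closure (hat ` A)"

text \<open>This is \<open>L^2(A)\<close> inside \<open>L^2(B)\<close>. The actions are restricted
  to make them extensional on \<open>SA\<close>, as \<open>bop\<close> demands.\<close>

definition XA :: "('h, 'k) bimod" where
  "XA = X\<lparr>hspace := SA, lact := \<lambda>a. restrict (L a) SA, ract := \<lambda>a. restrict (R a) SA\<rparr>"

lemma XA_simps [simp]: "hspace XA = SA" "lact XA a = restrict (L a) SA" "ract XA a =
    restrict (R a) SA"
  by (simp_all add: XA_def)

lemma SA_S: "SA \<subseteq> S"
  unfolding SA_def using S_hilbert by (intro closure_minimal) (auto simp: hilbert_iff hat_in A_B)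

lemma hat_SA: "a \<in> A \<Longrightarrow> hat a \<in> SA"
  unfolding SA_def by (rule subsetD[OF closure_subset imageI])

lemma SA_hilbert: "hilbert SA"
  unfolding SA_def by (intro hilbert_closure A.csubspace_image) (simp add: hat_lincomb A_B)

lemma SA_csub: "csubspace SA"
  by (rule hilbert_csubspace[OF SA_hilbert])

lemma SA_invariant:
  assumes f: "blin S S f" and inv: "\<And>x. x \<in> A \<Longrightarrow> f (hat x) \<in> SA" and xi: "u \<in> SA"
  shows "f u \<in> SA"
proof -
  obtain s where s: "\<And>n. s n \<in> hat ` A" "s \<longlonglongrightarrow> u" using xi unfolding SA_def closure_sequential
      by blast
  have sS: "s n \<in> S" for n using s(1)[of n] hat_in[OF A_B] by auto
  have l: "(\<lambda>n. f (s n)) \<longlonglongrightarrow> f u"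
    by (rule blin_tendsto[OF S_csub f sS subsetD[OF SA_S xi] s(2)])
  have m: "f (s n) \<in> SA" for n
  proof -
    obtain x where "x \<in> A" "s n = hat x" using s(1)[of n] by (rule imageE)
    then show ?thesis using inv by simp
  qed
  have "closed SA" using SA_hilbert by (simp add: hilbert_iff)
  from closed_sequentially[OF this m l] show ?thesis .
qed

lemma L_SA: "a \<in> A \<Longrightarrow> u \<in> SA \<Longrightarrow> L a u \<in> SA"
  by (rule SA_invariant[OF L_blin]) (auto simp: A_B L_hat hat_SA A.M_comp)

lemma R_SA: "a \<in> A \<Longrightarrow> u \<in> SA \<Longrightarrow> R a u \<in> SA"
  by (rule SA_invariant[OF R_blin]) (auto simp: A_B R_hat hat_SA A.M_comp)

lemma tracial_state_A: "tracial_state UNIV A \<tau>"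
  unfolding tracial_state_def
proof (intro conjI)
  note c1 = tr[unfolded tracial_state_def]
  note c2 = c1[THEN conjunct2] note c3 = c2[THEN conjunct2] note c4 = c3[THEN conjunct2]
  note c5 = c4[THEN conjunct2] note c6 = c5[THEN conjunct2] note c7 = c6[THEN conjunct2]
  show "\<forall>x\<in>A. \<forall>y\<in>A. \<tau> (\<lambda>u\<in>UNIV. x u + y u) = \<tau> x + \<tau> y" using c1[THEN conjunct1] AB by blast
  show "\<forall>c. \<forall>x\<in>A. \<tau> (\<lambda>u\<in>UNIV. c *\<^sub>C x u) = c * \<tau> x" using c2[THEN conjunct1] AB by blast
  show "\<tau> (\<lambda>u\<in>UNIV. u) = 1" by (rule c3[THEN conjunct1])
  show "\<forall>x\<in>A. \<tau> (compose UNIV (adj x) x) \<in> \<real> \<and> 0 \<le> Re (\<tau> (compose UNIV (adj x) x))"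
    using c4[THEN conjunct1] AB by blast
  show "\<forall>x\<in>A. \<forall>y\<in>A. \<tau> (compose UNIV x y) = \<tau> (compose UNIV y x)" using c5[THEN conjunct1] AB
      by blast
  show "\<forall>x\<in>A. \<tau> (compose UNIV (adj x) x) = 0 \<longrightarrow> (\<forall>u\<in>UNIV. x u = 0)"
    using c6[THEN conjunct1] AB by blast
  obtain \<zeta> \<omega> where *: "range \<zeta> \<subseteq> UNIV" "range \<omega> \<subseteq> UNIV"
    "summable (\<lambda>i. (norm (\<zeta> i))\<^sup>2)" "summable (\<lambda>i. (norm (\<omega> i))\<^sup>2)"
    "\<forall>x\<in>B. (\<lambda>i. cinner (x (\<zeta> i)) (\<omega> i)) sums \<tau> x" using c7 by (elim exE conjE) (rule that)
  show "\<exists>\<zeta> \<omega> :: nat \<Rightarrow> 'h. range \<zeta> \<subseteq> UNIV \<and> range \<omega> \<subseteq> UNIV \<and>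
      summable (\<lambda>i. (norm (\<zeta> i))\<^sup>2) \<and> summable (\<lambda>i. (norm (\<omega> i))\<^sup>2) \<and>
      (\<forall>x\<in>A. (\<lambda>i. cinner (x (\<zeta> i)) (\<omega> i)) sums \<tau> x)"
    by (rule exI[of _ \<zeta>], rule exI[of _ \<omega>]) (use * A_B in simp)
qed

text \<open>Makes \<open>left_bounded_in_range\<close> available for \<open>A\<close>; the values of
  \<open>eA\<close> on bounded vectors and of the inner product \<open>AI\<close> become elements of
  \<open>A\<close> through it.\<close>

sublocale LA: L2_space A \<tau> XA hat
proof
  show "tracial_state UNIV A \<tau>" by (rule tracial_state_A)
  have LR: "restrict (L b) SA \<in> bop SA" "restrict (R b) SA \<in> bop SA" if b: "b \<in> A" for b
  proof -
    have "blin SA SA (L b)" "blin SA SA (R b)"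
      using blin_invariant_subset[OF L_blin[OF A_B[OF b]] SA_S L_SA[OF b]]
        blin_invariant_subset[OF R_blin[OF A_B[OF b]] SA_S R_SA[OF b]] by auto
    then show "restrict (L b) SA \<in> bop SA" "restrict (R b) SA \<in> bop SA"
      by (simp_all add: restrict_bop SA_csub)
  qed
  show "is_L2 A \<tau> XA hat"
    unfolding is_L2_def XA_simps
  proof (intro conjI)
    show "hilbert SA" by (rule SA_hilbert)
    show "closure (hat ` A) = SA" by (simp add: SA_def)
  qed (auto simp: LR hat_add hat_scaleC cinner_hat A_B hat_SA L_hat R_hat)
qed

section \<open>Bounded vectors and the projection onto \<open>L^2(A)\<close>\<close>

abbreviation "bv \<equiv> bounded_vectors A \<tau> X"
abbreviation "AI \<equiv> A_inner A \<tau> X"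
abbreviation "eA \<equiv> oproj S SA"

lemma bv_iff: "u \<in> bv \<longleftrightarrow> u \<in> S \<and> (\<exists>K. \<forall>a\<in>A. norm (R a u) \<le> K * norm (hat a))"
  unfolding bounded_vectors_def by (simp add: \<tau>_norm A_B)

lemma bv_S: "u \<in> bv \<Longrightarrow> u \<in> S" by (simp add: bv_iff)

lemma bv_S_sub: "bv \<subseteq> S" using bv_S by blast

lemma bvE:
  assumes "u \<in> bv" obtains K where "0 \<le> K" "\<And>a. a \<in> A \<Longrightarrow> norm (R a u) \<le> K * norm (hat a)"
proof -
  obtain K where K: "\<forall>a\<in>A. norm (R a u) \<le> K * norm (hat a)" using assms unfolding bv_iff
      by (elim conjE exE) (rule that)
  have "norm (R a u) \<le> max K 0 * norm (hat a)" if a: "a \<in> A" for a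
    by (rule order_trans[OF bspec[OF K a]]) (intro mult_right_mono, auto)
  then show ?thesis by (intro that[of "max K 0"]) auto
qed

lemma bvI: "u \<in> S \<Longrightarrow> (\<And>a. a \<in> A \<Longrightarrow> norm (R a u) \<le> K * norm (hat a)) \<Longrightarrow> u \<in> bv"
  unfolding bv_iff by (intro conjI exI[of _ K] ballI)

lemma bv_csub: "csubspace bv"
proof -
  have "bv = {u\<in>S. \<exists>K. \<forall>a\<in>A. norm (R a u) \<le> K * norm (hat a)}" 
    by (rule set_eqI) (simp only: mem_Collect_eq bv_iff)
  then show ?thesis using csubspace_bounded[OF S_csub, of A S R "\<lambda>a. norm (hat a)"]
      by (simp add: R_blin A_B)
qed

lemma bv_blin:
  assumes f: "blin S S f" and fR: "\<And>a. a \<in> A \<Longrightarrow> R a (f u) = f (R a u)" and xi: "u \<in> bv"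
  shows "f u \<in> bv"
proof -
  obtain K where K: "0 \<le> K" "\<And>a. a \<in> A \<Longrightarrow> norm (R a u) \<le> K * norm (hat a)"
      by (rule bvE[OF xi]) (rule that)
  obtain C where C: "C > 0" "\<And>u. u \<in> S \<Longrightarrow> norm (f u) \<le> C * norm u"
      by (rule blin_bound[OF f]) (rule that)
  show ?thesis
  proof (rule bvI[where K="C * K"])
    fix a assume a: "a \<in> A"
    have "norm (R a (f u)) \<le> C * norm (R a u)"
      using C(2)[OF R_in[OF A_B[OF a] bv_S[OF xi]]] fR[OF a] by simp
    also have "\<dots> \<le> C * (K * norm (hat a))" using C(1) K(2)[OF a] by (intro mult_left_mono) auto
    finally show "norm (R a (f u)) \<le> C * K * norm (hat a)" by (simp add: mult.assoc)
  qed (rule blin_in[OF f bv_S[OF xi]])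
qed

lemma bv_L: "a \<in> A \<Longrightarrow> u \<in> bv \<Longrightarrow> L a u \<in> bv"
  by (rule bv_blin[OF L_blin]) (auto simp: A_B L_R bv_S)

text \<open>Right multiplication of hat b by a is left multiplication of hat a by b, so a bound for
  \<open>L b\<close> serves.\<close>

lemma bv_hat: assumes "b \<in> B" shows "hat b \<in> bv"
proof -
  obtain C where C: "C > 0" "\<And>u. u \<in> S \<Longrightarrow> norm (L b u) \<le> C * norm u"
      by (rule blin_bound[OF L_blin[OF assms]]) (rule that)
  show ?thesis
  proof (rule bvI[OF hat_in[OF assms]])
    show "norm (R a (hat b)) \<le> C * norm (hat a)" if "a \<in> A" for a
      using C(2)[OF hat_in[OF A_B[OF that]]] by (simp add: R_hat L_hat A_B that assms)
  qed
qed

lemma bv_\<Omega>: "\<Omega> \<in> bv" by (rule bv_hat[OF M_id])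

lemma bv_dense: "S \<subseteq> closure bv" "S \<subseteq> closure (span bv)"
proof -
  have "hat ` B \<subseteq> bv" using bv_hat by (rule image_subsetI)
  then show "S \<subseteq> closure bv" by (rule subset_trans[OF hat_dense(1) closure_mono])
  then show "S \<subseteq> closure (span bv)" by (rule subset_trans[OF _ closure_mono[OF span_superset]])
qed

text \<open>Acting by c and then by a is acting by c a, and the trace norm of c a is at most a bound
  for \<open>L c\<close> times that of a.\<close>

lemma bv_R:
  assumes c: "c \<in> A" and xi: "u \<in> bv" shows "R c u \<in> bv"
proof -
  obtain K where K: "0 \<le> K" "\<And>a. a \<in> A \<Longrightarrow> norm (R a u) \<le> K * norm (hat a)"
      by (rule bvE[OF xi]) (rule that)
  obtain C where C: "C > 0" "\<And>u. u \<in> S \<Longrightarrow> norm (L c u) \<le> C * norm u"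
      by (rule blin_bound[OF L_blin[OF A_B[OF c]]]) (rule that)
  show ?thesis
  proof (rule bvI[where K="K * C"])
    fix a assume a: "a \<in> A"
    have "norm (R a (R c u)) = norm (R (c \<circ> a) u)" by (simp add: R_comp A_B a c bv_S xi)
    also have "\<dots> \<le> K * norm (L c (hat a))" using K(2)[OF A.M_comp[OF c a]]
        by (simp add: L_hat A_B a c)
    also have "\<dots> \<le> K * (C * norm (hat a))" using K(1) C(2)[OF hat_in[OF A_B[OF a]]]
        by (intro mult_left_mono) auto
    finally show "norm (R a (R c u)) \<le> K * C * norm (hat a)" by (simp add: mult.assoc)
  qed (rule R_in[OF A_B[OF c] bv_S[OF xi]])
qed

lemma eA_blin: "blin S S eA"
  using oproj_bop[OF S_csub SA_hilbert SA_S] by (rule bop_blin)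

lemma eA_in: "u \<in> S \<Longrightarrow> eA u \<in> SA"
  by (rule oproj_in[OF SA_hilbert])

lemma eA_L: "a \<in> A \<Longrightarrow> u \<in> S \<Longrightarrow> eA (L a u) = L a (eA u)"
  by (rule oproj_commute[OF S_csub SA_hilbert SA_S L_blin L_SA L_SA L_adj]) (auto simp: A_B A.M_adj)

lemma eA_R: "a \<in> A \<Longrightarrow> u \<in> S \<Longrightarrow> eA (R a u) = R a (eA u)"
  by (rule oproj_commute[OF S_csub SA_hilbert SA_S R_blin R_SA R_SA R_adj]) (auto simp: A_B A.M_adj)

lemma bv_eA: "u \<in> bv \<Longrightarrow> eA u \<in> bv"
  by (rule bv_blin[OF eA_blin]) (auto simp: eA_R bv_S)

text \<open>The conditional expectation, extended to bounded vectors: \<open>eA u\<close> is again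
  bounded and lies in \<open>L^2(A)\<close>, so it comes from an operator in
  \<open>A\<close>.\<close>

lemma eA_hat: assumes "u \<in> bv" obtains a where "a \<in> A" "eA u = hat a"
proof -
  obtain K where K: "0 \<le> K" "\<And>a. a \<in> A \<Longrightarrow> norm (R a (eA u)) \<le> K * norm (hat a)"
    by (rule bvE[OF bv_eA[OF assms]]) (rule that)
  have "eA u \<in> SA" by (rule eA_in[OF bv_S[OF assms]])
  then have "\<exists>a\<in>A. hat a = eA u" by (intro LA.left_bounded_in_range[where K=K]) (auto simp: K)
  then show ?thesis using that by metis
qed

section \<open>The \<open>A\<close>-valued inner product\<close>

lemma AI_unique:
  assumes "a \<in> A" "b \<in> A"
    and "\<And>x y. x \<in> A \<Longrightarrow> y \<in> A \<Longrightarrow> \<tau> (adj y \<circ> a \<circ> x) = \<tau> (adj y \<circ> b \<circ> x)"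
  shows "a = b"
proof (rule LA.hat_inj[OF assms(1,2)], rule LA.S_eqI)
  fix y assume "y \<in> A"
  then show "cinner (hat a) (hat y) = cinner (hat b) (hat y)"
    using assms(3)[OF A.M_id, of y] assms(1,2) by (simp add: cinner_hat A_B o_def)
qed (use assms in \<open>simp_all add: hat_SA\<close>)

lemma AI_eqI:
  assumes "a \<in> A" "\<And>x y. x \<in> A \<Longrightarrow> y \<in> A \<Longrightarrow> cinner (R x v) (R y u) = cinner (hat (a \<circ> x)) (hat y)"
  shows "AI u v = a"
  unfolding A_inner_def
proof (rule the_equality)
  show "a \<in> A \<and> (\<forall>x\<in>A. \<forall>y\<in>A. cinner (R x v) (R y u) = \<tau> (adj y \<circ> a \<circ> x))"
    using assms by (simp add: cinner_hat A_B A.M_comp o_assoc)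
  then show "b = a" if "b \<in> A \<and> (\<forall>x\<in>A. \<forall>y\<in>A. cinner (R x v) (R y u) = \<tau> (adj y \<circ> b \<circ> x))" for b
    using that by (intro AI_unique) auto
qed

text \<open>With F the operator \<open>L\<^sub>u\<close> from \<open>L^2(A)\<close>, Riesz produces
  the vector t that the adjoint of F assigns to v. The bounds for u and v make t left bounded, hence
  t = hat a, and this a represents the product of the adjoint of \<open>L\<^sub>u\<close> with
  \<open>L\<^sub>v\<close>.\<close>

lemma AI_ex:
  assumes xi: "u \<in> bv" and eta: "v \<in> bv"
  shows "\<exists>a\<in>A. \<forall>x\<in>A. \<forall>y\<in>A. cinner (R x v) (R y u) = cinner (hat (a \<circ> x)) (hat y)"
proof -
  obtain K where K: "0 \<le> K" "\<And>a. a \<in> A \<Longrightarrow> norm (R a u) \<le> K * norm (hat a)"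
      by (rule bvE[OF xi]) (rule that)
  obtain C where C: "0 \<le> C" "\<And>a. a \<in> A \<Longrightarrow> norm (R a v) \<le> C * norm (hat a)"
      by (rule bvE[OF eta]) (rule that)
  obtain F where F: "blin SA S F" "\<And>x. x \<in> A \<Longrightarrow> F (hat x) = R x u"
  proof (rule LA.hat_extension[of S "\<lambda>x. R x u" K])
    show "closed S" using S_hilbert by (simp add: hilbert_iff)
  qed (use xi in \<open>auto simp: R_in R_lincomb A_B K bv_S\<close>)
  obtain D where D: "D > 0" "\<And>z. z \<in> SA \<Longrightarrow> norm (F z) \<le> D * norm z"
      by (rule blin_bound[OF F(1)]) (rule that)
  have "\<exists>t\<in>SA. \<forall>\<zeta>\<in>SA. cinner t \<zeta> = cinner v (F \<zeta>)"
  proof (rule riesz_representation[OF SA_hilbert])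
    show "cmod (cinner v (F z)) \<le> norm v * D * norm z" if "z \<in> SA" for z
      using order_trans[OF cinner_Cauchy_Schwarz mult_left_mono[OF D(2)[OF that], of "norm v"]]
      by (simp add: mult.assoc)
  qed (auto simp: blin_add[OF F(1)] blin_scaleC[OF F(1)] cinner_add_right cinner_scaleC_right)
  then obtain t where t: "t \<in> SA" "\<And>\<zeta>. \<zeta> \<in> SA \<Longrightarrow> cinner t \<zeta> = cinner v (F \<zeta>)" by blast
  have tS: "t \<in> S" using t SA_S by blast
  have eq: "cinner (R x t) (hat y) = cinner (R x v) (R y u)" if x: "x \<in> A" and y: "y \<in> A" for x y
  proof -
    have "cinner (R x t) (hat y) = cinner t (R (adj x) (hat y))"
      by (rule R_adj[OF A_B[OF x] tS hat_in[OF A_B[OF y]]])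
    also have "\<dots> = cinner v (R (y \<circ> adj x) u)"
      using t(2)[OF hat_SA[OF A.M_comp[OF y A.M_adj[OF x]]]] F(2)[OF A.M_comp[OF y A.M_adj[OF x]]]
      by (simp add: R_hat A_B x y A.M_adj)
    also have "\<dots> = cinner v (R (adj x) (R y u))" by (simp add: R_comp A_B x y A.M_adj bv_S xi)
    also have "\<dots> = cinner (R x v) (R y u)"
      by (rule R_adj[symmetric]) (use x y xi eta in \<open>auto simp: A_B bv_S R_in\<close>)
    finally show ?thesis .
  qed
  have "\<exists>a\<in>A. hat a = t"
  proof (rule LA.left_bounded_in_range[where K="C * K"])
    fix x assume x: "x \<in> A"
    have "norm (R x t) \<le> max (C * K * norm (hat x)) 0"
    proof (rule LA.norm_le_if_cinner_le)
      fix y assume y: "y \<in> A"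
      have "cmod (cinner (R x t) (hat y)) \<le> norm (R x v) * norm (R y u)"
        unfolding eq[OF x y] by (rule cinner_Cauchy_Schwarz)
      also have "\<dots> \<le> (C * norm (hat x)) * (K * norm (hat y))"
        using C K x y by (intro mult_mono) auto
      finally show "cmod (cinner (R x t) (hat y)) \<le> C * K * norm (hat x) * norm (hat y)"
          by (simp add: algebra_simps)
    qed (use x t in \<open>simp add: R_SA\<close>)
    then show "norm (ract XA x t) \<le> C * K * norm (hat x)" using t(1) C(1) K(1) by simp
  qed (use t in simp)
  then obtain a where a: "a \<in> A" "hat a = t" by blast
  have "R x t = hat (a \<circ> x)" if "x \<in> A" for x using a that by (auto simp: R_hat A_B simp flip: a(2))
  then show ?thesis using a(1) eq by (intro bexI[of _ a]) simp_all
qed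

lemma
  assumes "u \<in> bv" "v \<in> bv"
  shows AI_in: "AI u v \<in> A"
    and AI_spec: "x \<in> A \<Longrightarrow> y \<in> A \<Longrightarrow> cinner (R x v) (R y u) = cinner (hat (AI u v \<circ> x)) (hat y)"
proof -
  obtain a where a: "a \<in> A" "\<forall>x\<in>A. \<forall>y\<in>A. cinner (R x v) (R y u) = cinner (hat (a \<circ> x)) (hat y)"
    using AI_ex[OF assms] by blast
  have "AI u v = a" by (rule AI_eqI) (use a in auto)
  then show "AI u v \<in> A" "x \<in> A \<Longrightarrow> y \<in> A \<Longrightarrow> cinner (R x v) (R y u) = cinner (hat (AI u v \<circ> x))
      (hat y)"
    using a by auto
qed

lemma AI_L:
  assumes "a \<in> A" "u \<in> bv" "v \<in> bv"
  shows "AI v (L a u) = AI (L (adj a) v) u"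
proof (rule AI_eqI)
  have b: "L (adj a) v \<in> bv" using assms by (simp add: bv_L A.M_adj)
  show "AI (L (adj a) v) u \<in> A" by (rule AI_in[OF b assms(2)])
  fix x y assume xy: "x \<in> A" "y \<in> A"
  have "cinner (R x (L a u)) (R y v) = cinner (L a (R x u)) (R y v)" using assms xy
      by (simp add: L_R A_B bv_S)
  also have "\<dots> = cinner (R x u) (L (adj a) (R y v))"
    by (rule L_adj) (use assms xy in \<open>auto simp: A_B R_in bv_S\<close>)
  also have "\<dots> = cinner (R x u) (R y (L (adj a) v))" using assms xy
      by (simp add: L_R A_B bv_S A.M_adj)
  also have "\<dots> = cinner (hat (AI (L (adj a) v) u \<circ> x)) (hat y)" by (rule AI_spec[OF b assms(2) xy])
  finally show "cinner (R x (L a u)) (R y v) = cinner (hat (AI (L (adj a) v) u \<circ> x)) (hat y)" .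
qed

lemma AI_R:
  assumes "c \<in> A" "u \<in> bv" "v \<in> bv"
  shows "AI v (R c u) = AI v u \<circ> c"
proof (rule AI_eqI)
  show "AI v u \<circ> c \<in> A" by (intro A.M_comp AI_in assms)
  fix x y assume xy: "x \<in> A" "y \<in> A"
  have "cinner (R x (R c u)) (R y v) = cinner (R (c \<circ> x) u) (R y v)"
    using assms xy by (simp add: R_comp A_B bv_S)
  also have "\<dots> = cinner (hat (AI v u \<circ> (c \<circ> x))) (hat y)"
    by (rule AI_spec[OF assms(3,2) A.M_comp[OF assms(1) xy(1)] xy(2)])
  finally show "cinner (R x (R c u)) (R y v) = cinner (hat (AI v u \<circ> c \<circ> x)) (hat y)"
      by (simp add: o_assoc)
qed

lemma AI_\<Omega>_hat: "c \<in> A \<Longrightarrow> AI \<Omega> (hat c) = c"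
  by (rule AI_eqI) (auto simp: R_hat A_B M_id o_def)

text \<open>Since \<open>eA\<close> is right \<open>A\<close>-linear, u - eA u stays orthogonal to
  \<open>SA\<close> under right multiplication; scalar orthogonality thus becomes
  \<open>A\<close>-valued orthogonality.\<close>

lemma AI_\<Omega>_orth:
  assumes "u \<in> bv" shows "AI \<Omega> (u - eA u) = (\<lambda>u. 0)"
proof (rule AI_eqI)
  show "(\<lambda>u. 0) \<in> A" using A.M_scaleC[OF A.M_id, of 0] by simp
  fix x y assume xy: "x \<in> A" "y \<in> A"
  have xS: "u \<in> S" "eA u \<in> S" using assms bv_S eA_in SA_S by blast+
  have "R x (u - eA u) = R x u - eA (R x u)"
    using xy xS by (simp add: blin_diff[OF S_csub R_blin] A_B eA_R)
  then have "cinner (R x (u - eA u)) (hat y) = 0"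
    using oproj_orth[OF SA_hilbert R_in[OF A_B[OF xy(1)] xS(1)] hat_SA[OF xy(2)]] by simp
  moreover have "hat (\<lambda>u. 0) = 0" using hat_scaleC[OF M_id, of 0] by simp
  ultimately show "cinner (R x (u - eA u)) (R y \<Omega>) = cinner (hat ((\<lambda>u. 0) \<circ> x)) (hat y)"
    using xy by (simp add: R_\<Omega> A_B o_def)
qed

text \<open>The scalar product is the trace of the \<open>A\<close>-valued one. It is phrased with
  \<Omega> to match the inner product of tensors u \<otimes> \<Omega>.\<close>

lemma \<tau>_AI: "u \<in> bv \<Longrightarrow> v \<in> bv \<Longrightarrow> cinner v u = cinner (L (AI u v) \<Omega>) \<Omega>"
  using AI_spec[of u v "\<lambda>u. u" "\<lambda>u. u"] AI_in[of u v]
  by (simp add: A.M_id R_id bv_S L_\<Omega> A_B o_def)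

lemma SA_neq_S:
  assumes "jones_index A X = \<infinity>" shows "SA \<noteq> S"
proof
  assume "SA = S"
  have "L2_space A \<tau> X hat"
  proof
    show "tracial_state UNIV A \<tau>" by (rule tracial_state_A)
    show "is_L2 A \<tau> X hat"
      using L2 AB \<open>SA = S\<close> unfolding is_L2_def SA_def by blast
  qed
  from L2_space.finite_vna_commutant[OF this]
  \<comment> \<open>In the finite branch the coupling constant is \<open>ennreal\<close> of a real
    number, hence different from \<infinity>.\<close>
  have "jones_index A X \<noteq> \<infinity>"
    by (simp add: jones_index_def coupling_constant_def Let_def)
  then show False using assms by simp
qed

end

section \<open>Isometries between bimodules\<close>

text \<open>Families with equal Gram matrices are related by an isometry. The index set allows
  repetitions in p, so consistency is a consequence of the equal inner products; the scaling
  hypothesis makes the real spans complex.\<close>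

lemma isometry_extension:
  fixes p :: "'i \<Rightarrow> 'a::chilbert_space" and q :: "'i \<Rightarrow> 'b::chilbert_space"
  assumes inner: "\<And>i j. i \<in> I \<Longrightarrow> j \<in> I \<Longrightarrow> cinner (q i) (q j) = cinner (p i) (p j)"
    and scale: "\<And>c i. i \<in> I \<Longrightarrow> \<exists>j\<in>I. p j = c *\<^sub>C p i \<and> q j = c *\<^sub>C q i"
  obtains W where "blin (closure (span (p ` I))) (closure (span (q ` I))) W"
    "\<And>i. i \<in> I \<Longrightarrow> W (p i) = q i"
    "\<And>x y. x \<in> closure (span (p ` I)) \<Longrightarrow> y \<in> closure (span (p ` I)) \<Longrightarrow> cinner (W x) (W y) =
        cinner x y"
proof -
  let ?D = "(\<lambda>i. (p i, q i)) ` I"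
  let ?G = "span ?D"
  have G: "csubspace ?G"
  proof (rule csubspace_span)
    fix c x assume "x \<in> ?D"
    then obtain i where i: "i \<in> I" "x = (p i, q i)" by (rule imageE)
    obtain j where "j \<in> I" "p j = c *\<^sub>C p i" "q j = c *\<^sub>C q i" using scale[OF i(1), of c]
        by (elim bexE conjE)
    then have "j \<in> I" "c *\<^sub>C x = (p j, q j)" using i(2) by (simp_all add: scaleC_prod_def)
    then show "c *\<^sub>C x \<in> ?D" by simp
  qed
  have iso1: "cinner (snd x) (q j) = cinner (fst x) (p j)" if "x \<in> ?G" "j \<in> I" for x j
    using that(1)
  proof (induction rule: span_induct_alt)
    case (step c x y)
    then show ?case using inner[OF _ that(2)]
      by (auto simp: cinner_add_left cinner_scaleR_left)
  qed simp
  have iso: "cinner (snd x) (snd y) = cinner (fst x) (fst y)" if "x \<in> ?G" "y \<in> ?G" for x y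
    using that(2)
  proof (induction rule: span_induct_alt)
    case (step c y z)
    then show ?case using iso1[OF that(1)]
      by (auto simp: cinner_add_right cinner_scaleR_right)
  qed simp
  have "norm b \<le> 1 * norm a" if "(a, b) \<in> ?G" for a b
    using iso[OF that that] by (simp add: cinner_same flip: of_real_power)
  then obtain W where W: "blin (closure (fst ` ?G)) (closure (snd ` ?G)) W"
    "\<And>a b. (a, b) \<in> ?G \<Longrightarrow> W a = b" "\<And>a. a \<in> closure (fst ` ?G) \<Longrightarrow> (a, W a) \<in> closure ?G"
    by (rule blin_graph_extension[OF G]) (auto intro: that)
  have f: "fst ` ?G = span (p ` I)"
    using linear_span_image[OF bounded_linear.linear[OF bounded_linear_fst], of ?D]
        by (simp add: image_image)
  have s: "snd ` ?G = span (q ` I)"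
    using linear_span_image[OF bounded_linear.linear[OF bounded_linear_snd], of ?D]
        by (simp add: image_image)
  show ?thesis
  proof (rule that[of W])
    show "blin (closure (span (p ` I))) (closure (span (q ` I))) W" using W(1) unfolding f s .
    show "W (p i) = q i" if "i \<in> I" for i
      by (rule W(2)[OF span_base]) (use that in simp)
    fix x y assume x: "x \<in> closure (span (p ` I))" and y: "y \<in> closure (span (p ` I))"
    have "(x, W x) \<in> closure ?G" "(y, W y) \<in> closure ?G" using W(3) x y unfolding f by auto
    then obtain u v where u: "\<And>n. u n \<in> ?G" "u \<longlonglongrightarrow> (x, W x)" and v: "\<And>n. v n \<in> ?G" "v \<longlonglongrightarrow> (y, W y)"
      unfolding closure_sequential by (elim exE conjE) (rule that, auto)
    have "(\<lambda>n. cinner (snd (u n)) (snd (v n))) \<longlonglongrightarrow> cinner (W x) (W y)"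
      using tendsto_cinner[OF tendsto_snd[OF u(2)] tendsto_snd[OF v(2)]] by simp
    moreover have "(\<lambda>n. cinner (fst (u n)) (fst (v n))) \<longlonglongrightarrow> cinner x y"
      using tendsto_cinner[OF tendsto_fst[OF u(2)] tendsto_fst[OF v(2)]] by simp
    ultimately show "cinner (W x) (W y) = cinner x y"
      using iso[OF u(1) v(1)] LIMSEQ_unique by auto
  qed
qed

text \<open>Preimages of a convergent sequence are Cauchy, as W preserves distances.\<close>

lemma isometry_range_closed:
  assumes S: "hilbert S" and W: "blin S T W"
    and iso: "\<And>x y. x \<in> S \<Longrightarrow> y \<in> S \<Longrightarrow> cinner (W x) (W y) = cinner x y"
  shows "hilbert (W ` S)"
proof -
  have cs: "csubspace S" by (rule hilbert_csubspace[OF S])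
  have n: "norm (W x) = norm x" if "x \<in> S" for x
  proof -
    have "(norm (W x))\<^sup>2 = (norm x)\<^sup>2" using iso[OF that that]
        unfolding cinner_same of_real_eq_iff .
    then show ?thesis by simp
  qed
  have "closed (W ` S)"
    unfolding closed_sequential_limits
  proof (intro allI impI, elim conjE)
    fix z l assume z: "\<forall>n. z n \<in> W ` S" and l: "z \<longlonglongrightarrow> l"
    have "\<forall>n. \<exists>x. x \<in> S \<and> z n = W x" using z by auto
    then obtain x where x: "\<And>n. x n \<in> S" "\<And>n. z n = W (x n)" by metis
    have "dist (x m) (x n) = dist (z m) (z n)" for m n
      using n[OF csubspace_diff[OF cs x(1)[of m] x(1)[of n]]] blin_diff[OF cs W x(1)[of m]
          x(1)[of n]]
      by (simp add: dist_norm x(2))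
    then have "Cauchy x" using LIMSEQ_imp_Cauchy[OF l] by (simp add: Cauchy_def)
    then obtain y where y: "x \<longlonglongrightarrow> y" using Cauchy_convergent convergentD by blast
    have "closed S" using S by (simp add: hilbert_iff)
    from closed_sequentially[OF this x(1) y] have yS: "y \<in> S" .
    have "z = (\<lambda>n. W (x n))" using x(2) by auto
    then have "z \<longlonglongrightarrow> W y" using blin_tendsto[OF cs W x(1) yS y] by simp
    then have "l = W y" using l LIMSEQ_unique by auto
    then show "l \<in> W ` S" using yS by simp
  qed
  moreover have "csubspace (W ` S)"
    unfolding csubspace_def
  proof (intro conjI ballI allI)
    show "0 \<in> W ` S" using blin_0[OF cs W] csubspace_0[OF cs] by (metis imageI)
    fix u v c assume "u \<in> W ` S"
    then obtain x where x: "u = W x" "x \<in> S" by (rule imageE)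
    show "c *\<^sub>C u \<in> W ` S"
      using imageI[OF csubspace_scaleC[OF cs x(2)], of W c] by (simp add: x blin_scaleC[OF W])
    assume "v \<in> W ` S"
    then obtain y where y: "v = W y" "y \<in> S" by (rule imageE)
    show "u + v \<in> W ` S"
      using imageI[OF csubspace_add[OF cs x(2) y(2)], of W] by (simp add: x y blin_add[OF W])
  qed
  ultimately show ?thesis by (simp add: hilbert_iff)
qed

definition bimod_isometry :: "('h::chilbert_space \<Rightarrow> 'h) set \<Rightarrow> ('h, 'k::chilbert_space) bimod \<Rightarrow>
    ('h, 'k) bimod \<Rightarrow> ('k \<Rightarrow> 'k) \<Rightarrow> bool" where
  "bimod_isometry A Y T W \<longleftrightarrow> blin (hspace Y) (hspace T) W \<and>
     (\<forall>x\<in>hspace Y. \<forall>y\<in>hspace Y. cinner (W x) (W y) = cinner x y) \<and>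
     (\<forall>a\<in>A. \<forall>x\<in>hspace Y. W (lact Y a x) = lact T a (W x) \<and> W (ract Y a x) = ract T a (W x))"

lemma
  assumes "bimod_isometry A Y T W"
  shows bimod_isometry_blin: "blin (hspace Y) (hspace T) W"
    and bimod_isometry_cinner: "x \<in> hspace Y \<Longrightarrow> y \<in> hspace Y \<Longrightarrow> cinner (W x) (W y) = cinner x y"
    and bimod_isometry_lact: "a \<in> A \<Longrightarrow> x \<in> hspace Y \<Longrightarrow> W (lact Y a x) = lact T a (W x)"
    and bimod_isometry_ract: "a \<in> A \<Longrightarrow> x \<in> hspace Y \<Longrightarrow> W (ract Y a x) = ract T a (W x)"
  using assms unfolding bimod_isometry_def by auto

lemma bimod_isometry_range:
  assumes Y: "hilbert_bimodule A Y" and W: "bimod_isometry A Y T W"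
  shows "hilbert (W ` hspace Y)" "W ` hspace Y \<subseteq> hspace T"
proof -
  show "hilbert (W ` hspace Y)"
    by (rule isometry_range_closed[OF bimod_hilbert[OF Y] bimod_isometry_blin[OF W]])
       (rule bimod_isometry_cinner[OF W])
  show "W ` hspace Y \<subseteq> hspace T"
    by (rule image_subsetI) (rule blin_in[OF bimod_isometry_blin[OF W]])
qed

lemma bimod_isometry_adjoint:
  assumes A: "\<And>a. a \<in> A \<Longrightarrow> hadj UNIV a \<in> A \<and> hadj UNIV (hadj UNIV a) = a"
    and Y: "hilbert_bimodule A Y" and T: "hilbert_bimodule A T" and W: "bimod_isometry A Y T W"
  obtains V where "blin (hspace T) (hspace Y) V"
    "\<And>y z. y \<in> hspace Y \<Longrightarrow> z \<in> hspace T \<Longrightarrow> cinner (W y) z = cinner y (V z)"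
    "\<And>y. y \<in> hspace Y \<Longrightarrow> V (W y) = y"
    "\<And>z. z \<in> hspace T \<Longrightarrow> W (V z) = oproj (hspace T) (W ` hspace Y) z"
    "\<And>a z. a \<in> A \<Longrightarrow> z \<in> hspace T \<Longrightarrow> V (lact T a z) = lact Y a (V z)"
    "\<And>a z. a \<in> A \<Longrightarrow> z \<in> hspace T \<Longrightarrow> V (ract T a z) = ract Y a (V z)"
proof -
  note Wb = bimod_isometry_blin[OF W] and cs = bimod_csub[OF Y]
  obtain V where V: "blin (hspace T) (hspace Y) V"
    "\<And>y z. y \<in> hspace Y \<Longrightarrow> z \<in> hspace T \<Longrightarrow> cinner (W y) z = cinner y (V z)"
    using blin_adjoint_ex[OF bimod_hilbert[OF Y] Wb] by blast
  show ?thesis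
  proof (rule that[OF V])
    show "V (W y) = y" if y: "y \<in> hspace Y" for y
      by (rule eq_if_cinner_right[OF cs]) (use y blin_in[OF Wb y] in \<open>auto simp: blin_in[OF V(1)]
          bimod_isometry_cinner[OF W] simp flip: V(2)\<close>)
    show "W (V z) = oproj (hspace T) (W ` hspace Y) z" if z: "z \<in> hspace T" for z
    proof (rule oproj_eqI[OF bimod_isometry_range(1)[OF Y W] z, symmetric])
      have Vz: "V z \<in> hspace Y" by (rule blin_in[OF V(1) z])
      then show "W (V z) \<in> W ` hspace Y" by simp
      fix w assume "w \<in> W ` hspace Y"
      then obtain y where y: "w = W y" "y \<in> hspace Y" by (rule imageE)
      have "cinner (W y) (z - W (V z)) = 0"
        using V(2)[OF y(2) z] bimod_isometry_cinner[OF W y(2) Vz] by (simp add: cinner_diff_right)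
      then show "cinner (z - W (V z)) w = 0" unfolding y(1) by (subst cinner_commute) simp
    qed
    fix a z assume a: "a \<in> A" and z: "z \<in> hspace T"
    have a': "hadj UNIV a \<in> A" "hadj UNIV (hadj UNIV a) = a" using A[OF a] by auto
    show "V (lact T a z) = lact Y a (V z)"
      by (rule adjoint_intertwines[where S="hspace Y" and T="hspace T" and W=W
          and g="lact T (hadj UNIV a)"
            and g'="lact Y (hadj UNIV a)"])
         (simp_all add: cs blin_in[OF Wb] blin_in[OF V(1)] V(2) bimod_lact_in[OF T]
             bimod_lact_in[OF Y] a a' z
           bimod_lact_adj[OF T a'(1)] bimod_lact_adj[OF Y a'(1)] bimod_isometry_lact[OF W])
    show "V (ract T a z) = ract Y a (V z)"
      by (rule adjoint_intertwines[where S="hspace Y" and T="hspace T" and W=W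
          and g="ract T (hadj UNIV a)"
            and g'="ract Y (hadj UNIV a)"])
         (simp_all add: cs blin_in[OF Wb] blin_in[OF V(1)] V(2) bimod_ract_in[OF T]
             bimod_ract_in[OF Y] a a' z
           bimod_ract_adj[OF T a'(1)] bimod_ract_adj[OF Y a'(1)] bimod_isometry_ract[OF W])
  qed
qed

lemma centralizerI:
  assumes "x \<in> bop (hspace T)"
    and "\<And>a z. a \<in> A \<Longrightarrow> z \<in> hspace T \<Longrightarrow> x (lact T a z) = lact T a (x z)"
    and "\<And>a z. a \<in> A \<Longrightarrow> z \<in> hspace T \<Longrightarrow> x (ract T a z) = ract T a (x z)"
  shows "x \<in> centralizer A T"
  using assms unfolding centralizer_def commutant_def by auto

lemma centralizer_hadj:
  assumes A: "\<And>a. a \<in> A \<Longrightarrow> hadj UNIV a \<in> A \<and> hadj UNIV (hadj UNIV a) = a"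
    and T: "hilbert_bimodule A T" and v: "v \<in> centralizer A T"
  shows "hadj (hspace T) v \<in> centralizer A T"
proof -
  have vb: "v \<in> bop (hspace T)"
    and vl: "\<And>a z. a \<in> A \<Longrightarrow> z \<in> hspace T \<Longrightarrow> v (lact T a z) = lact T a (v z)"
    and vr: "\<And>a z. a \<in> A \<Longrightarrow> z \<in> hspace T \<Longrightarrow> v (ract T a z) = ract T a (v z)"
    using v unfolding centralizer_def commutant_def by auto
  note h = bimod_hilbert[OF T] and cs = bimod_csub[OF T]
  let ?w = "hadj (hspace T) v"
  have wb: "?w \<in> bop (hspace T)" by (rule hadj_bop[OF h vb])
  note vS = blin_in[OF bop_blin[OF vb]] and wS = blin_in[OF bop_blin[OF wb]]
  show ?thesis
  proof (rule centralizerI[OF wb])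
    fix a z assume a: "a \<in> A" and z: "z \<in> hspace T"
    have a': "hadj UNIV a \<in> A" "hadj UNIV (hadj UNIV a) = a" using A[OF a] by auto
    show "?w (lact T a z) = lact T a (?w z)"
      by (rule adjoint_intertwines[where S="hspace T" and T="hspace T" and W=v
          and g="lact T (hadj UNIV a)"
            and g'="lact T (hadj UNIV a)"])
         (simp_all add: cs vS wS cinner_hadj[OF h vb] bimod_lact_in[OF T]
             a a' z bimod_lact_adj[OF T a'(1)] vl)
    show "?w (ract T a z) = ract T a (?w z)"
      by (rule adjoint_intertwines[where S="hspace T" and T="hspace T" and W=v
          and g="ract T (hadj UNIV a)"
            and g'="ract T (hadj UNIV a)"])
         (simp_all add: cs vS wS cinner_hadj[OF h vb] bimod_ract_in[OF T]
             a a' z bimod_ract_adj[OF T a'(1)] vr)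
  qed
qed

lemma mvn_equiv_bimod_isometry_ranges:
  assumes A: "\<And>a. a \<in> A \<Longrightarrow> hadj UNIV a \<in> A \<and> hadj UNIV (hadj UNIV a) = a"
    and Y: "hilbert_bimodule A Y" and T: "hilbert_bimodule A T"
    and U: "bimod_isometry A Y T U" and W: "bimod_isometry A Y T W"
  shows "mvn_equiv (hspace T) (centralizer A T)
    (oproj (hspace T) (U ` hspace Y)) (oproj (hspace T) (W ` hspace Y))"
proof -
  have cT: "csubspace (hspace T)" by (rule bimod_csub[OF T])
  obtain V where V: "blin (hspace T) (hspace Y) V"
    "\<And>y z. y \<in> hspace Y \<Longrightarrow> z \<in> hspace T \<Longrightarrow> cinner (U y) z = cinner y (V z)"
    "\<And>y. y \<in> hspace Y \<Longrightarrow> V (U y) = y"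
    "\<And>z. z \<in> hspace T \<Longrightarrow> U (V z) = oproj (hspace T) (U ` hspace Y) z"
    "\<And>a z. a \<in> A \<Longrightarrow> z \<in> hspace T \<Longrightarrow> V (lact T a z) = lact Y a (V z)"
    "\<And>a z. a \<in> A \<Longrightarrow> z \<in> hspace T \<Longrightarrow> V (ract T a z) = ract Y a (V z)"
    by (rule bimod_isometry_adjoint[OF A Y T U]) (assumption, rule that)
  obtain V' where V': "blin (hspace T) (hspace Y) V'"
    "\<And>y z. y \<in> hspace Y \<Longrightarrow> z \<in> hspace T \<Longrightarrow> cinner (W y) z = cinner y (V' z)"
    "\<And>y. y \<in> hspace Y \<Longrightarrow> V' (W y) = y"
    "\<And>z. z \<in> hspace T \<Longrightarrow> W (V' z) = oproj (hspace T) (W ` hspace Y) z"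
    "\<And>a z. a \<in> A \<Longrightarrow> z \<in> hspace T \<Longrightarrow> V' (lact T a z) = lact Y a (V' z)"
    "\<And>a z. a \<in> A \<Longrightarrow> z \<in> hspace T \<Longrightarrow> V' (ract T a z) = ract Y a (V' z)"
    by (rule bimod_isometry_adjoint[OF A Y T W]) (assumption, rule that)
  note Ub = bimod_isometry_blin[OF U] and Wb = bimod_isometry_blin[OF W]
  note ins = blin_in[OF V(1)] blin_in[OF V'(1)] blin_in[OF Ub] blin_in[OF Wb]
  note rU = bimod_isometry_range[OF Y U] and rW = bimod_isometry_range[OF Y W]
  let ?P = "oproj (hspace T) (U ` hspace Y)"
  let ?Q = "oproj (hspace T) (W ` hspace Y)"
  have P: "?P \<in> centralizer A T"
    by (rule centralizerI[OF oproj_bop[OF cT rU]])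
       (simp_all add: bimod_lact_in[OF T] bimod_ract_in[OF T] ins V(5,6)
          bimod_isometry_lact[OF U] bimod_isometry_ract[OF U] flip: V(4))
  have Q: "?Q \<in> centralizer A T"
    by (rule centralizerI[OF oproj_bop[OF cT rW]])
       (simp_all add: bimod_lact_in[OF T] bimod_ract_in[OF T] ins V'(5,6)
          bimod_isometry_lact[OF W] bimod_isometry_ract[OF W] flip: V'(4))
  \<comment> \<open>With V and V' the adjoints of U and W, the map W V has adjoint U V'; V' W = 1
    and V U = 1 collapse the two products to U V and W V'.\<close>
  define v where "v = restrict (\<lambda>z. W (V z)) (hspace T)"
  define v' where "v' = restrict (\<lambda>z. U (V' z)) (hspace T)"
  have vb: "v \<in> bop (hspace T)" unfolding v_def
      by (rule restrict_bop[OF cT blin_compose[OF V(1) Wb]])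
  have v'b: "v' \<in> bop (hspace T)" unfolding v'_def
      by (rule restrict_bop[OF cT blin_compose[OF V'(1) Ub]])
  have vz: "v z = W (V z)" "v' z = U (V' z)" if "z \<in> hspace T" for z using that
      by (simp_all add: v_def v'_def)
  have vc: "v \<in> centralizer A T"
    by (rule centralizerI[OF vb])
       (simp_all add: vz bimod_lact_in[OF T] bimod_ract_in[OF T] ins V(5,6)
          bimod_isometry_lact[OF W] bimod_isometry_ract[OF W])
  have "hadj (hspace T) v = v'"
  proof (rule hadj_unique[OF cT v'b])
    fix x z assume x: "x \<in> hspace T" and z: "z \<in> hspace T"
    have "cinner (W (V x)) z = cinner (V x) (V' z)" by (rule V'(2)[OF ins(1)[OF x] z])
    also have "\<dots> = cinner x (U (V' z))"
      using V(2)[OF ins(2)[OF z] x] by (rule cinner_swap[symmetric])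
    finally show "cinner (v x) z = cinner x (v' z)" using x z by (simp add: vz)
  qed
  moreover have "compose (hspace T) v' v = ?P"
    by (rule bop_eqI[OF bop_compose[OF cT v'b vb] oproj_bop[OF cT rU]])
       (simp add: compose_def vz ins V'(3) V(4))
  moreover have "compose (hspace T) v v' = ?Q"
    by (rule bop_eqI[OF bop_compose[OF cT vb v'b] oproj_bop[OF cT rW]])
       (simp add: compose_def vz ins V(3) V'(4))
  ultimately show ?thesis
    unfolding mvn_equiv_def
    using P Q vc oproj_is_projection[OF bimod_hilbert[OF T] rU]
        oproj_is_projection[OF bimod_hilbert[OF T] rW]
    by blast
qed

text \<open>Covers n = 1: the source of the isometries would be the zeroth power, which is not among
  the spaces \<open>H m\<close> in use, but there is only one projection.\<close>

lemma mvn_equiv_refl: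
  assumes "e \<in> M" "is_projection S e" shows "mvn_equiv S M e e"
  using assms unfolding mvn_equiv_def is_projection_def by (intro conjI bexI[of _ e]) auto

section \<open>Tensor powers\<close>

text \<open>Couples the two facts carried through the recursion: being the range projection of an
  isometry from the shorter power gives equivalence, and the action on elementary tensors serves to
  tell projections apart.\<close>

definition (in inclusion) slot_proj :: "('h, 'k) bimod \<Rightarrow> ('h, 'k) bimod \<Rightarrow> ('k \<Rightarrow> 'k \<Rightarrow> 'k) \<Rightarrow>
    ('k \<Rightarrow> 'k) \<Rightarrow> ('k \<Rightarrow> 'k) \<Rightarrow> ('k \<Rightarrow> 'k) \<Rightarrow> bool" where
  "slot_proj Y T t x y P \<longleftrightarrow> (\<exists>W. bimod_isometry A Y T W \<and> P = oproj (hspace T) (W ` hspace Y)) \<and>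
     (\<forall>u\<in>bv. \<forall>v\<in>hspace Y. P (t u v) = t (x u) (y v))"

locale tensor = inclusion A B \<tau> X hat
  for A B :: "('h::chilbert_space \<Rightarrow> 'h) set" and \<tau> :: "('h \<Rightarrow> 'h) \<Rightarrow> complex"
    and X :: "('h, 'k::chilbert_space) bimod" and hat :: "('h \<Rightarrow> 'h) \<Rightarrow> 'k" +
  fixes Y T :: "('h, 'k) bimod" and t :: "'k \<Rightarrow> 'k \<Rightarrow> 'k"
  assumes Y: "hilbert_bimodule A Y" and ct: "is_connes_tensor A \<tau> X Y T t"
begin

lemma T_hilbert: "hilbert (hspace T)"
  and t_in: "u \<in> bv \<Longrightarrow> v \<in> hspace Y \<Longrightarrow> t u v \<in> hspace T"
  and t_add_left: "u \<in> bv \<Longrightarrow> u' \<in> bv \<Longrightarrow> v \<in> hspace Y \<Longrightarrow> t (u + u') v = t u v + t u' v"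
  and t_add_right: "u \<in> bv \<Longrightarrow> v \<in> hspace Y \<Longrightarrow> v' \<in> hspace Y \<Longrightarrow> t u (v + v') = t u v + t u v'"
  and t_scale_left: "u \<in> bv \<Longrightarrow> v \<in> hspace Y \<Longrightarrow> t (c *\<^sub>C u) v = c *\<^sub>C t u v"
  and t_scale_right: "u \<in> bv \<Longrightarrow> v \<in> hspace Y \<Longrightarrow> t u (c *\<^sub>C v) = c *\<^sub>C t u v"
  and t_cinner: "u \<in> bv \<Longrightarrow> u' \<in> bv \<Longrightarrow> v \<in> hspace Y \<Longrightarrow> v' \<in> hspace Y \<Longrightarrow>
    cinner (t u v) (t u' v') = cinner (lact Y (AI u' u) v) v'"
  and T_closure: "closure (span {t u v | u v. u \<in> bv \<and> v \<in> hspace Y}) = hspace T"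
  and T_lact_bop: "a \<in> A \<Longrightarrow> lact T a \<in> bop (hspace T)"
  and T_lact: "a \<in> A \<Longrightarrow> u \<in> bv \<Longrightarrow> v \<in> hspace Y \<Longrightarrow> lact T a (t u v) = t (L a u) v"
  and T_ract_bop: "a \<in> A \<Longrightarrow> ract T a \<in> bop (hspace T)"
  and T_ract: "a \<in> A \<Longrightarrow> u \<in> bv \<Longrightarrow> v \<in> hspace Y \<Longrightarrow> ract T a (t u v) = t u (ract Y a v)"
  using ct unfolding is_connes_tensor_def Let_def by meson+

abbreviation "tensors \<equiv> {t u v | u v. u \<in> bv \<and> v \<in> hspace Y}"

lemma T_csub: "csubspace (hspace T)"
  by (rule hilbert_csubspace[OF T_hilbert])

lemma tensors_in: "tensors \<subseteq> hspace T"
  using t_in by auto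

lemma tensors_dense: "hspace T \<subseteq> closure (span tensors)"
  by (simp add: T_closure)

lemma T_blin_eqI:
  assumes "blin (hspace T) U f" "blin (hspace T) U' g"
    and "\<And>u v. u \<in> bv \<Longrightarrow> v \<in> hspace Y \<Longrightarrow> f (t u v) = g (t u v)" and "z \<in> hspace T"
  shows "f z = g z"
  by (rule blin_eq_span[OF T_csub assms(1,2) tensors_in tensors_dense _ assms(4)]) (use assms(3)
      in auto)

lemma T_cinner_0I:
  assumes "\<And>u v. u \<in> bv \<Longrightarrow> v \<in> hspace Y \<Longrightarrow> cinner z (t u v) = 0" and "z \<in> hspace T"
  shows "z = 0"
  using cinner_0_span[OF tensors_dense _ assms(2), of z] assms(1) by auto

text \<open>The bimodule laws are checked on elementary tensors and extended by density; for the
  adjoints this happens in both arguments.\<close>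

lemma T_bimodule: "hilbert_bimodule A T"
proof -
  have lb: "blin (hspace T) (hspace T) (lact T a)" and rb: "blin (hspace T) (hspace T) (ract T a)"
      if "a \<in> A" for a
    using T_lact_bop[OF that] T_ract_bop[OF that] by (simp_all add: bop_blin)
  note rY = bimod_ract_in[OF Y] and lY = bimod_lact_in[OF Y]
  have ladj: "cinner (lact T a x) y = cinner x (lact T (adj a) y)"
    if a: "a \<in> A" and "x \<in> hspace T" "y \<in> hspace T" for a x y
  proof (rule cinner_adjoint_span[OF T_hilbert lb[OF a] T_csub lb[OF A.M_adj[OF a]]
        tensors_in tensors_dense tensors_in tensors_dense])
    fix x y assume "x \<in> tensors" "y \<in> tensors"
    then obtain u v u' v' where *: "x = t u v" "y = t u' v'" "u \<in> bv" "u' \<in> bv" "v \<in> hspace Y"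
        "v' \<in> hspace Y"
      by auto
    then show "cinner (lact T a x) y = cinner x (lact T (adj a) y)"
      using a by (simp add: T_lact A.M_adj t_cinner bv_L AI_L)
  qed (use that in auto)
  \<comment> \<open>The inner product of tensors lets an element of \<open>A\<close> act on Y from
    the left, so the right action must be moved past it.\<close>
  have radj: "cinner (ract T a x) y = cinner x (ract T (adj a) y)"
    if a: "a \<in> A" and "x \<in> hspace T" "y \<in> hspace T" for a x y
  proof (rule cinner_adjoint_span[OF T_hilbert rb[OF a] T_csub rb[OF A.M_adj[OF a]]
        tensors_in tensors_dense tensors_in tensors_dense])
    fix x y assume "x \<in> tensors" "y \<in> tensors"
    then obtain u v u' v' where *: "x = t u v" "y = t u' v'" "u \<in> bv" "u' \<in> bv" "v \<in> hspace Y"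
        "v' \<in> hspace Y"
      by auto
    then show "cinner (ract T a x) y = cinner x (ract T (adj a) y)"
      using a AI_in[of u' u]
      by (simp add: T_ract A.M_adj t_cinner rY lY bimod_commute[OF Y] bimod_ract_adj[OF Y])
  qed (use that in auto)
  have comp: "lact T (a \<circ> b) x = lact T a (lact T b x)" if "a \<in> A" "b \<in> A" "x \<in> hspace T" for a b x
    by (rule T_blin_eqI[OF lb blin_compose[OF lb lb] _ that(3)])
       (use that in \<open>auto simp: A.M_comp T_lact bv_L L_comp A_B bv_S\<close>)
  have comm: "lact T a (ract T b x) = ract T b (lact T a x)" if "a \<in> A" "b \<in> A" "x \<in> hspace T"
      for a b x
    by (rule T_blin_eqI[OF blin_compose[OF rb lb] blin_compose[OF lb rb] _ that(3)])
       (use that in \<open>auto simp: T_lact T_ract bv_L rY\<close>)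
  have id: "lact T (\<lambda>u. u) x = x" if "x \<in> hspace T" for x
    by (rule T_blin_eqI[OF lb blin_id _ that]) (auto simp: A.M_id T_lact L_id bv_S)
  have zero: "lact T (\<lambda>u. 0) x = 0" if "x \<in> hspace T" for x
  proof (rule T_blin_eqI[OF lb _ _ that])
    show 0: "(\<lambda>u. 0) \<in> A" using A.M_scaleC[OF A.M_id, of 0] by simp
    show "blin (hspace T) UNIV (\<lambda>u. 0 :: 'k)" by (rule blinI[where K=1]) auto
    fix u v assume "u \<in> bv" "v \<in> hspace Y"
    then show "lact T (\<lambda>u. 0) (t u v) = 0"
      using t_scale_left[of u v 0] by (simp add: T_lact 0 bimod_lact_0[OF X_bimodule] bv_S)
  qed
  show ?thesis
    unfolding hilbert_bimodule_def
    by (intro conjI ballI T_hilbert T_lact_bop T_ract_bop ladj radj comp comm id zero)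
qed

text \<open>Not a clause of \<open>is_connes_tensor\<close> but a consequence of its form: by right
  linearity of \<open>AI\<close> in its second argument, the difference is orthogonal to every
  elementary tensor.\<close>

lemma t_balanced:
  assumes a: "a \<in> A" and xi: "u \<in> bv" and eta: "v \<in> hspace Y"
  shows "t (R a u) v = t u (lact Y a v)"
proof -
  note i = bv_R[OF a xi] bimod_lact_in[OF Y a eta]
  have "t (R a u) v - t u (lact Y a v) = 0"
  proof (rule T_cinner_0I)
    show "t (R a u) v - t u (lact Y a v) \<in> hspace T"
      by (intro csubspace_diff[OF T_csub] t_in i xi eta)
    show "cinner (t (R a u) v - t u (lact Y a v)) (t u' v') = 0" if "u' \<in> bv" "v' \<in> hspace Y"
        for u' v'
      using that i a xi eta AI_in[OF that(1) xi]
      by (simp add: cinner_diff_left t_cinner AI_R bimod_lact_comp[OF Y])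
  qed
  then show ?thesis by simp
qed

lemma t_blin: assumes xi: "u \<in> bv" shows "blin (hspace Y) (hspace T) (t u)"
proof -
  obtain C where C: "C > 0" "\<And>v. v \<in> hspace Y \<Longrightarrow> norm (lact Y (AI u u) v) \<le> C * norm v"
    by (rule blin_bound[OF bimod_lact[OF Y AI_in[OF xi xi]]]) (rule that)
  show ?thesis
  \<comment> \<open>The squared norm of t u v is the matrix coefficient at v of <u, u>_A, whose
    action C bounds; hence the square root.\<close>
  proof (rule blinI[where K="sqrt C"])
    fix v assume eta: "v \<in> hspace Y"
    have "(norm (t u v))\<^sup>2 = cmod (cinner (t u v) (t u v))" by (simp add: cinner_same norm_power)
    also have "\<dots> \<le> norm (lact Y (AI u u) v) * norm v"
      unfolding t_cinner[OF xi xi eta eta] by (rule cinner_Cauchy_Schwarz)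
    also have "\<dots> \<le> C * norm v * norm v" by (intro mult_right_mono C eta) auto
    also have "\<dots> = (sqrt C * norm v)\<^sup>2" using C(1) by (simp add: power2_eq_square algebra_simps)
    finally show "norm (t u v) \<le> sqrt C * norm v" by (rule power2_le_imp_le) (use C(1) in auto)
  qed (auto simp: t_in t_add_right t_scale_right xi)
qed

text \<open>A bounded operator is determined by its values on elementary tensors, so the description
  in \<open>op_tensor\<close> has at most one solution, and the orthogonality hypothesis says that
  the projection onto P is one.\<close>

lemma op_tensor_eq_oproj:
  assumes P: "hilbert P" "P \<subseteq> hspace T"
    and "in": "\<And>u v. u \<in> bv \<Longrightarrow> v \<in> hspace Y \<Longrightarrow> t (x u) (y v) \<in> P"
    and orth: "\<And>u v \<zeta>. u \<in> bv \<Longrightarrow> v \<in> hspace Y \<Longrightarrow> \<zeta> \<in> P \<Longrightarrow> cinner (t u v - t (x u) (y v)) \<zeta> = 0"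
  shows "op_tensor A \<tau> X Y T t x y = oproj (hspace T) P"
    and "u \<in> bv \<Longrightarrow> v \<in> hspace Y \<Longrightarrow> op_tensor A \<tau> X Y T t x y (t u v) = t (x u) (y v)"
proof -
  have e: "oproj (hspace T) P (t u v) = t (x u) (y v)" if "u \<in> bv" "v \<in> hspace Y" for u v
    by (rule oproj_eqI[OF P(1) t_in[OF that] "in"[OF that] orth[OF that]])
  have b: "oproj (hspace T) P \<in> bop (hspace T)" by (rule oproj_bop[OF T_csub P])
  show o: "op_tensor A \<tau> X Y T t x y = oproj (hspace T) P"
    unfolding op_tensor_def
  proof (rule the_equality)
    fix z assume z: "z \<in> bop (hspace T) \<and> (\<forall>u\<in>bv. \<forall>v\<in>hspace Y. z (t u v) = t (x u) (y v))"
    then have zb: "z \<in> bop (hspace T)" by simp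
    show "z = oproj (hspace T) P"
    proof (rule bop_eqI[OF zb b])
      show "z \<zeta> = oproj (hspace T) P \<zeta>" if "\<zeta> \<in> hspace T" for \<zeta>
        by (rule T_blin_eqI[OF bop_blin[OF zb] bop_blin[OF b] _ that]) (use z e in simp)
    qed
  qed (use b e in simp)
  show "u \<in> bv \<Longrightarrow> v \<in> hspace Y \<Longrightarrow> op_tensor A \<tau> X Y T t x y (t u v) = t (x u) (y v)"
    unfolding o by (rule e)
qed

text \<open>For \<zeta> in D, moving the \<open>A\<close>-valued product of the first legs to the
  other side pairs v - P v with an element of \<open>A\<close> applied to \<zeta>. This stays in D
  by left invariance, so the pairing is 0.\<close>

lemma op_tensor_right:
  assumes D: "hilbert D" "D \<subseteq> hspace Y" and inv: "\<And>a \<zeta>. a \<in> A \<Longrightarrow> \<zeta> \<in> D \<Longrightarrow> lact Y a \<zeta> \<in> D"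
    and Q: "hilbert Q" "Q \<subseteq> hspace T" and QD: "Q \<subseteq> closure (span {t u \<zeta> | u \<zeta>. u \<in> bv \<and> \<zeta> \<in> D})"
    and DQ: "\<And>u \<zeta>. u \<in> bv \<Longrightarrow> \<zeta> \<in> D \<Longrightarrow> t u \<zeta> \<in> Q"
  defines "P \<equiv> oproj (hspace Y) D"
  shows "op_tensor A \<tau> X Y T t (\<lambda>u\<in>S. u) P = oproj (hspace T) Q"
    and "u \<in> bv \<Longrightarrow> v \<in> hspace Y \<Longrightarrow> op_tensor A \<tau> X Y T t (\<lambda>u\<in>S. u) P (t u v) = t u (P v)"
proof -
  have PD: "P v \<in> D" if "v \<in> hspace Y" for v unfolding P_def by (rule oproj_in[OF D(1) that])
  have i: "t ((\<lambda>u\<in>S. u) u) (P v) \<in> Q" if "u \<in> bv" "v \<in> hspace Y" for u v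
    using DQ[OF that(1) PD[OF that(2)]] bv_S[OF that(1)] by simp
  have o: "cinner (t u v - t ((\<lambda>u\<in>S. u) u) (P v)) w = 0"
    if xi: "u \<in> bv" and eta: "v \<in> hspace Y" and w: "w \<in> Q" for u v w
  proof -
    have PY: "P v \<in> hspace Y" using PD[OF eta] D(2) by auto
    have dY: "v - P v \<in> hspace Y" by (rule csubspace_diff[OF bimod_csub[OF Y] eta PY])
    have "cinner (t u (v - P v)) w = 0"
    proof (rule cinner_0_span[OF QD _ w])
      fix w assume "w \<in> {t u \<zeta> | u \<zeta>. u \<in> bv \<and> \<zeta> \<in> D}"
      then obtain u' \<zeta> where w: "w = t u' \<zeta>" "u' \<in> bv" "\<zeta> \<in> D" by auto
      then have zY: "\<zeta> \<in> hspace Y" using D(2) by auto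
      have c: "AI u' u \<in> A" by (rule AI_in[OF w(2) xi])
      have "cinner (t u (v - P v)) w = cinner (v - P v) (lact Y (adj (AI u' u)) \<zeta>)"
        using bimod_lact_adj[OF Y c dY zY] by (simp add: w t_cinner xi dY zY)
      also have "\<dots> = 0" unfolding P_def by (rule oproj_orth[OF D(1) eta inv[OF A.M_adj[OF c] w(3)]])
      finally show "cinner (t u (v - P v)) w = 0" .
    qed
    moreover have "t u v - t u (P v) = t u (v - P v)"
      by (rule blin_diff[OF bimod_csub[OF Y] t_blin[OF xi] eta PY, symmetric])
    ultimately show ?thesis using bv_S[OF xi] by simp
  qed
  show "op_tensor A \<tau> X Y T t (\<lambda>u\<in>S. u) P = oproj (hspace T) Q"
      by (rule op_tensor_eq_oproj(1)[OF Q i o])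
  show "op_tensor A \<tau> X Y T t (\<lambda>u\<in>S. u) P (t u v) = t u (P v)" if "u \<in> bv" "v \<in> hspace Y"
    using op_tensor_eq_oproj(2)[OF Q i o that] by (simp only: restrict_apply'[OF bv_S[OF that(1)]])
qed

lemma AI_\<Omega>_\<Omega>: "AI \<Omega> \<Omega> = (\<lambda>u. u)"
  by (rule AI_\<Omega>_hat[OF A.M_id])

text \<open>Left linearity comes from a \<Omega> = \<Omega> a together with balancedness; isometry
  from <\<Omega>, \<Omega>>_A = 1.\<close>

lemma insert_left_isometry: "bimod_isometry A Y T (t \<Omega>)"
  unfolding bimod_isometry_def
proof (intro conjI ballI)
  show "blin (hspace Y) (hspace T) (t \<Omega>)" by (rule t_blin[OF bv_\<Omega>])
  show "cinner (t \<Omega> x) (t \<Omega> y) = cinner x y" if "x \<in> hspace Y" "y \<in> hspace Y" for x y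
    using that by (simp add: t_cinner bv_\<Omega> AI_\<Omega>_\<Omega> bimod_lact_id[OF Y])
  fix a x assume a: "a \<in> A" and x: "x \<in> hspace Y"
  have "t \<Omega> (lact Y a x) = t (R a \<Omega>) x" by (rule t_balanced[OF a bv_\<Omega> x, symmetric])
  also have "R a \<Omega> = L a \<Omega>" using a by (simp add: R_\<Omega> L_\<Omega> A_B)
  also have "t (L a \<Omega>) x = lact T a (t \<Omega> x)" by (rule T_lact[OF a bv_\<Omega> x, symmetric])
  finally show "t \<Omega> (lact Y a x) = lact T a (t \<Omega> x)" .
  show "t \<Omega> (ract Y a x) = ract T a (t \<Omega> x)" by (rule T_ract[OF a bv_\<Omega> x, symmetric])
qed

text \<open>As eA u = hat a with a in \<open>A\<close>, balancedness rewrites eA u \<otimes> v as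
  \<Omega> \<otimes> a v, which lies in the range of the insertion. The rest, (u - eA u) \<otimes>
  v, is orthogonal to it by \<open>AI_\<Omega>_orth\<close>.\<close>

lemma op_tensor_left: "slot_proj Y T t eA (\<lambda>v. v) (op_tensor A \<tau> X Y T t eA (\<lambda>u\<in>hspace Y. u))"
proof -
  note r = bimod_isometry_range[OF Y insert_left_isometry]
  have i: "t (eA u) ((\<lambda>u\<in>hspace Y. u) v) \<in> t \<Omega> ` hspace Y" if xi: "u \<in> bv" and eta: "v \<in> hspace Y"
      for u v
  proof -
    obtain a where a: "a \<in> A" "eA u = hat a" by (rule eA_hat[OF xi]) (rule that)
    have "t (eA u) v = t \<Omega> (lact Y a v)"
      using t_balanced[OF a(1) bv_\<Omega> eta] a by (simp add: R_\<Omega> A_B)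
    then show ?thesis using bimod_lact_in[OF Y a(1) eta] eta by simp
  qed
  have o: "cinner (t u v - t (eA u) ((\<lambda>u\<in>hspace Y. u) v)) \<zeta> = 0"
    if xi: "u \<in> bv" and eta: "v \<in> hspace Y" and z: "\<zeta> \<in> t \<Omega> ` hspace Y" for u v \<zeta>
  proof -
    obtain v' where v': "\<zeta> = t \<Omega> v'" "v' \<in> hspace Y" using z by (rule imageE)
    have d: "u - eA u \<in> bv" by (rule csubspace_diff[OF bv_csub xi bv_eA[OF xi]])
    have "t u v = t (u - eA u) v + t (eA u) v" using t_add_left[OF d bv_eA[OF xi] eta] by simp
    then show ?thesis
      using eta v' by (simp add: t_cinner[OF d bv_\<Omega>] AI_\<Omega>_orth[OF xi] bimod_lact_0[OF Y])
  qed
  show ?thesis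
    unfolding slot_proj_def
  proof (intro conjI ballI exI[of _ "t \<Omega>"] insert_left_isometry)
    show "op_tensor A \<tau> X Y T t eA (\<lambda>u\<in>hspace Y. u) = oproj (hspace T) (t \<Omega> ` hspace Y)"
      by (rule op_tensor_eq_oproj(1)[OF r i o])
    show "op_tensor A \<tau> X Y T t eA (\<lambda>u\<in>hspace Y. u) (t u v) = t (eA u) v"
        if "u \<in> bv" "v \<in> hspace Y" for u v
      using op_tensor_eq_oproj(2)[OF r i o that] by (simp only: restrict_apply'[OF that(2)])
  qed
qed

end

text \<open>Insertion on the right, u -> u \<otimes> \<Omega>, makes sense at first only for bounded
  u; by \<open>\<tau>_AI\<close> it preserves inner products and extends to all of
  \<open>L^2(B)\<close>. Its right linearity again uses \<Omega> a = a \<Omega>.\<close>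

lemma (in inclusion) op_tensor_right_base:
  assumes ct: "is_connes_tensor A \<tau> X X T t"
  shows "slot_proj X T t (\<lambda>u. u) eA (op_tensor A \<tau> X X T t (\<lambda>u\<in>S. u) eA)"
proof -
  interpret tensor A B \<tau> X hat X T t by unfold_locales (rule X_bimodule, rule ct)
  let ?q = "\<lambda>u. t u \<Omega>"
  obtain W where W: "blin (closure (span ((\<lambda>u. u) ` bv))) (closure (span (?q ` bv))) W"
    "\<And>u. u \<in> bv \<Longrightarrow> W u = t u \<Omega>"
    "\<And>x y. x \<in> closure (span ((\<lambda>u. u) ` bv)) \<Longrightarrow> y \<in> closure (span ((\<lambda>u. u) ` bv)) \<Longrightarrow> cinner (W x)
        (W y) = cinner x y"
  proof (rule isometry_extension[of bv ?q "\<lambda>u. u"])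
    show "cinner (t i \<Omega>) (t j \<Omega>) = cinner i j" if "i \<in> bv" "j \<in> bv" for i j
      using that \<tau>_AI[of j i] by (simp add: t_cinner \<Omega>_in)
    show "\<exists>j\<in>bv. j = c *\<^sub>C i \<and> t j \<Omega> = c *\<^sub>C t i \<Omega>" if "i \<in> bv" for c i
      using csubspace_scaleC[OF bv_csub that, of c] t_scale_left[OF that \<Omega>_in, of c] by blast
  qed (use that in blast)
  have "span bv = bv" by (rule span_eq_iff[THEN iffD2, OF csubspace_subspace[OF bv_csub]])
  moreover have "closure bv = S"
    using bv_dense(1) closure_minimal[OF bv_S_sub] S_hilbert by (auto simp: hilbert_iff)
  ultimately have cS: "closure (span ((\<lambda>u. u) ` bv)) = S" by (simp only: image_ident)
  note W = W[unfolded cS]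
  have qT: "closure (span (?q ` bv)) \<subseteq> hspace T"
    using T_hilbert T_csub by (intro closure_minimal span_minimal csubspace_subspace)
        (auto simp: hilbert_iff t_in \<Omega>_in)
  have Wb: "blin S (hspace T) W"
    using W(1) qT unfolding blin_def by (meson subsetD)
  have tT: "blin (hspace T) (hspace T) (lact T a)" "blin (hspace T) (hspace T) (ract T a)"
      if "a \<in> A" for a
    using T_lact_bop[OF that] T_ract_bop[OF that] by (simp_all add: bop_blin)
  have iso: "bimod_isometry A X T W"
    unfolding bimod_isometry_def
  proof (intro conjI ballI)
    show "blin S (hspace T) W" by (rule Wb)
    show "cinner (W x) (W y) = cinner x y" if "x \<in> S" "y \<in> S" for x y by (rule W(3)[OF that])
    fix a x assume a: "a \<in> A" and x: "x \<in> S"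
    show "W (L a x) = lact T a (W x)"
      by (rule blin_eq_dense[OF S_csub blin_compose[OF L_blin Wb] blin_compose[OF Wb tT(1)]
          bv_S_sub bv_dense(1) _ x])
         (use a in \<open>auto simp: A_B W(2) bv_L T_lact \<Omega>_in\<close>)
    show "W (R a x) = ract T a (W x)"
    proof (rule blin_eq_dense[OF S_csub blin_compose[OF R_blin Wb] blin_compose[OF Wb tT(2)]
        bv_S_sub bv_dense(1) _ x])
      fix u assume xi: "u \<in> bv"
      have "W (R a u) = t (R a u) \<Omega>" by (rule W(2)[OF bv_R[OF a xi]])
      also have "\<dots> = t u (L a \<Omega>)" by (rule t_balanced[OF a xi \<Omega>_in])
      also have "L a \<Omega> = R a \<Omega>" using a by (simp add: R_\<Omega> L_\<Omega> A_B)
      also have "t u (R a \<Omega>) = ract T a (W u)" using T_ract[OF a xi \<Omega>_in] W(2)[OF xi] by simp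
      finally show "W (R a u) = ract T a (W u)" .
    qed (use a in \<open>auto simp: A_B\<close>)
  qed
  note r = bimod_isometry_range[OF X_bimodule iso]
  \<comment> \<open>For \<zeta> = hat a one has u \<otimes> hat a = u a \<otimes> \<Omega>, and the
    range is closed.\<close>
  have i: "t u \<zeta> \<in> W ` S" if xi: "u \<in> bv" and z: "\<zeta> \<in> SA" for u \<zeta>
  proof -
    obtain s where s: "\<And>n. s n \<in> hat ` A" "s \<longlonglongrightarrow> \<zeta>"
      using z unfolding SA_def closure_sequential by (elim exE conjE) (rule that, auto)
    have sS: "s n \<in> S" for n using s(1)[of n] hat_in[OF A_B] by auto
    have l: "(\<lambda>n. t u (s n)) \<longlonglongrightarrow> t u \<zeta>"
      by (rule blin_tendsto[OF S_csub t_blin[OF xi] sS subsetD[OF SA_S z] s(2)])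
    have m: "t u (s n) \<in> W ` S" for n
    proof -
      obtain a where a: "s n = hat a" "a \<in> A" using s(1)[of n] by (rule imageE)
      have "t u (s n) = W (R a u)"
        using t_balanced[OF a(2) xi \<Omega>_in] W(2)[OF bv_R[OF a(2) xi]] a by (simp add: L_\<Omega> A_B)
      then show ?thesis using R_in[OF A_B[OF a(2)] bv_S[OF xi]] by simp
    qed
    have "closed (W ` S)" using r(1) by (simp add: hilbert_iff)
    from closed_sequentially[OF this m l] show ?thesis .
  qed
  have "?q ` bv \<subseteq> {t u \<zeta> | u \<zeta>. u \<in> bv \<and> \<zeta> \<in> SA}" using hat_SA[OF A.M_id] by auto
  then have QD: "W ` S \<subseteq> closure (span {t u \<zeta> | u \<zeta>. u \<in> bv \<and> \<zeta> \<in> SA})"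
    using blin_in[OF W(1)] by (intro image_subsetI) (meson closure_mono span_mono subsetD)
  show ?thesis
    unfolding slot_proj_def
    by (intro conjI ballI exI[of _ W] iso; rule op_tensor_right[OF SA_hilbert SA_S L_SA r QD i])
qed

text \<open>Here W is the identity tensored with V. It preserves inner products because V is left
  linear and isometric, and it is indexed by pairs because different pairs may give the same
  tensor.\<close>

lemma (in inclusion) op_tensor_right_step:
  assumes Y: "hilbert_bimodule A Y"
    and ct: "is_connes_tensor A \<tau> X Y Y' t" and ct': "is_connes_tensor A \<tau> X Y' T' t'"
    and V: "bimod_isometry A Y Y' V" and P: "P = oproj (hspace Y') (V ` hspace Y)"
  shows "slot_proj Y' T' t' (\<lambda>u. u) P (op_tensor A \<tau> X Y' T' t' (\<lambda>u\<in>S. u) P)"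
proof -
  interpret T: tensor A B \<tau> X hat Y Y' t by unfold_locales (rule Y, rule ct)
  note Y' = T.T_bimodule
  interpret T': tensor A B \<tau> X hat Y' T' t' by unfold_locales (rule Y', rule ct')
  note Vb = bimod_isometry_blin[OF V]
  note VY = blin_in[OF Vb]
  let ?I = "bv \<times> hspace Y"
  let ?p = "\<lambda>(u, v). t u v"
  let ?q = "\<lambda>(u, v). t' u (V v)"
  have "?p ` ?I = T.tensors" by (auto simp: image_iff)
  then have cp: "closure (span (?p ` ?I)) = hspace Y'" using T.T_closure by simp
  obtain W where W: "blin (closure (span (?p ` ?I))) (closure (span (?q ` ?I))) W"
    "\<And>i. i \<in> ?I \<Longrightarrow> W (?p i) = ?q i"
    "\<And>x y. x \<in> closure (span (?p ` ?I)) \<Longrightarrow> y \<in> closure (span (?p ` ?I)) \<Longrightarrow> cinner (W x) (W y) =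
        cinner x y"
  proof (rule isometry_extension[of ?I ?q ?p])
    fix i assume "i \<in> ?I"
    then obtain u v where i: "i = (u, v)" "u \<in> bv" "v \<in> hspace Y" by (rule SigmaE)
    show "\<exists>j\<in>?I. ?p j = c *\<^sub>C ?p i \<and> ?q j = c *\<^sub>C ?q i" for c
      using i csubspace_scaleC[OF bv_csub i(2), of c]
      by (intro bexI[of _ "(c *\<^sub>C u, v)"]) (auto simp: T.t_scale_left T'.t_scale_left VY)
    fix j assume "j \<in> ?I"
    then obtain u' v' where j: "j = (u', v')" "u' \<in> bv" "v' \<in> hspace Y" by (rule SigmaE)
    have c: "AI u' u \<in> A" by (rule AI_in[OF j(2) i(2)])
    show "cinner (?q i) (?q j) = cinner (?p i) (?p j)"
      using i j c by (simp add: T.t_cinner T'.t_cinner VY bimod_isometry_lact[OF V, symmetric]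
          bimod_isometry_cinner[OF V] bimod_lact_in[OF Y])
  qed (use that in blast)
  note W = W[unfolded cp]
  have Wt: "W (t u v) = t' u (V v)" if "u \<in> bv" "v \<in> hspace Y" for u v
    using W(2)[of "(u, v)"] that by simp
  have qT: "closure (span (?q ` ?I)) \<subseteq> hspace T'"
    using T'.T_hilbert T'.T_csub
    by (intro closure_minimal span_minimal csubspace_subspace) (auto simp: hilbert_iff T'.t_in VY)
  have Wb: "blin (hspace Y') (hspace T') W"
    using W(1) qT unfolding blin_def by (meson subsetD)
  note b = bimod_lact[OF T.T_bimodule] bimod_ract[OF T.T_bimodule] bimod_lact[OF T'.T_bimodule]
      bimod_ract[OF T'.T_bimodule]
  have iso: "bimod_isometry A Y' T' W"
    unfolding bimod_isometry_def
  proof (intro conjI ballI)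
    show "blin (hspace Y') (hspace T') W" by (rule Wb)
    show "cinner (W x) (W y) = cinner x y" if "x \<in> hspace Y'" "y \<in> hspace Y'" for x y
        by (rule W(3)[OF that])
    fix a x assume a: "a \<in> A" and x: "x \<in> hspace Y'"
    show "W (lact Y' a x) = lact T' a (W x)"
      by (rule T.T_blin_eqI[OF blin_compose[OF b(1)[OF a] Wb] blin_compose[OF Wb b(3)[OF a]] _ x])
         (use a in \<open>simp add: Wt T.T_lact T'.T_lact bv_L VY\<close>)
    show "W (ract Y' a x) = ract T' a (W x)"
      by (rule T.T_blin_eqI[OF blin_compose[OF b(2)[OF a] Wb] blin_compose[OF Wb b(4)[OF a]] _ x])
         (use a in \<open>simp add: Wt T.T_ract T'.T_ract VY bimod_ract_in[OF Y]
             bimod_isometry_ract[OF V]\<close>)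
  qed
  note r = bimod_isometry_range[OF T.T_bimodule iso]
  note rV = bimod_isometry_range[OF Y V]
  have i: "t' u \<zeta> \<in> W ` hspace Y'" if xi: "u \<in> bv" and z: "\<zeta> \<in> V ` hspace Y" for u \<zeta>
  proof -
    obtain y where y: "\<zeta> = V y" "y \<in> hspace Y" using z by (rule imageE)
    show ?thesis using imageI[OF T.t_in[OF xi y(2)], of W] by (simp add: Wt xi y)
  qed
  have inv: "lact Y' a \<zeta> \<in> V ` hspace Y" if a: "a \<in> A" and z: "\<zeta> \<in> V ` hspace Y" for a \<zeta>
  proof -
    obtain y where y: "\<zeta> = V y" "y \<in> hspace Y" using z by (rule imageE)
    show ?thesis
      using imageI[OF bimod_lact_in[OF Y a y(2)], of V] bimod_isometry_lact[OF V a y(2)]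
          by (simp add: y)
  qed
  have "?q ` ?I \<subseteq> {t' u \<zeta> | u \<zeta>. u \<in> bv \<and> \<zeta> \<in> V ` hspace Y}" by auto
  then have QD: "W ` hspace Y' \<subseteq> closure (span {t' u \<zeta> | u \<zeta>. u \<in> bv \<and> \<zeta> \<in> V ` hspace Y})"
    using blin_in[OF W(1)] by (intro image_subsetI) (meson closure_mono span_mono subsetD)
  show ?thesis
    unfolding slot_proj_def P
    by (intro conjI ballI exI[of _ W] iso; rule T'.op_tensor_right[OF rV inv r QD i])
qed

section \<open>Jones projections on the tensor powers\<close>

context inclusion
begin

abbreviation "JP H t \<equiv> jones_proj A \<tau> H hat t"

lemma eA_centralizer: "eA \<in> centralizer A X"
  by (rule centralizerI[OF oproj_bop[OF S_csub SA_hilbert SA_S]]) (simp_all add: eA_L eA_R)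

lemma jones_proj_Suc:
  assumes "H 1 = X" "1 \<le> m"
  shows "JP H t (Suc m) 1 = op_tensor A \<tau> X (H m) (H (Suc m)) (t m) eA (\<lambda>u\<in>hspace (H m). u)"
    and "i \<noteq> 1 \<Longrightarrow>
      JP H t (Suc m) i = op_tensor A \<tau> X (H m) (H (Suc m)) (t m) (\<lambda>u\<in>S. u) (JP H t m (i - 1))"
  unfolding jones_proj.simps(2)[of A \<tau> H hat t m] assms(1) SA_def[symmetric] Let_def
      using assms(2) by simp_all

lemma jones_proj_1: "H 1 = X \<Longrightarrow> JP H t 1 i = eA"
  by (simp add: SA_def Let_def)

text \<open>Slot 1 is handled by \<open>op_tensor_left\<close>, and slot i > 1 by tensoring slot i -
  1 of the shorter power with the identity. At m = 1 the projection in the second factor is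
  \<open>eA\<close> itself, which is not presented as the range of an isometry between powers, so
  slot 2 needs \<open>op_tensor_right_base\<close>.\<close>

lemma jones_proj_step:
  assumes tp: "tensor_powers A B \<tau> H hat t n" and H1: "H 1 = X" and m: "1 \<le> m" "m < n"
  shows "hilbert_bimodule A (H m) \<and> hilbert_bimodule A (H (Suc m)) \<and>
    slot_proj (H m) (H (Suc m)) (t m) eA (\<lambda>v. v) (JP H t (Suc m) 1) \<and>
    (\<forall>i\<in>{2..Suc m}. slot_proj (H m) (H (Suc m)) (t m) (\<lambda>u. u) (JP H t m (i - 1)) (JP H t (Suc m)
        i))"
  using m
proof (induction m rule: nat_induct_at_least)
  case base
  have ct1: "is_connes_tensor A \<tau> X X (H (Suc 1)) (t 1)"
    using tp base unfolding tensor_powers_def H1[symmetric] by blast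
  interpret tensor A B \<tau> X hat X "H (Suc 1)" "t 1" by unfold_locales (rule X_bimodule, rule ct1)
  note j = jones_proj_Suc[where H=H and t=t
      and m=1, OF H1 order_refl, unfolded H1 jones_proj_1[of H t, OF H1]]
  show ?case
    unfolding H1 jones_proj_1[of H t, OF H1]
  proof (intro conjI ballI X_bimodule T_bimodule)
    show "slot_proj X (H (Suc 1)) (t 1) eA (\<lambda>v. v) (JP H t (Suc 1) 1)"
      unfolding j(1) by (rule op_tensor_left)
    fix i :: nat assume "i \<in> {2..Suc 1}"
    then have "i \<noteq> 1" by simp
    then show "slot_proj X (H (Suc 1)) (t 1) (\<lambda>u. u) eA (JP H t (Suc 1) i)"
      by (subst j(2)) (simp, rule op_tensor_right_base[OF ct1])
  qed
next
  case (Suc m)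
  let ?Y = "H m" and ?Y' = "H (Suc m)" and ?T' = "H (Suc (Suc m))"
  have mn: "m < n" using Suc.prems by simp
  note ih = Suc.IH[OF mn]
  have IH: "hilbert_bimodule A ?Y" "hilbert_bimodule A ?Y'" using ih by blast+
  have ct1: "is_connes_tensor A \<tau> X ?Y ?Y' (t m)"
      and ct2: "is_connes_tensor A \<tau> X ?Y' ?T' (t (Suc m))"
    using tp Suc unfolding tensor_powers_def H1[symmetric] by auto
  interpret tensor A B \<tau> X hat ?Y' ?T' "t (Suc m)" by unfold_locales (rule IH(2), rule ct2)
  note j = jones_proj_Suc[where H=H and t=t and m="Suc m", OF H1]
  show ?case
  proof (intro conjI ballI IH T_bimodule)
    show "slot_proj ?Y' ?T' (t (Suc m)) eA (\<lambda>v. v) (JP H t (Suc (Suc m)) 1)"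
      by (subst j(1)) (simp, rule op_tensor_left)
    fix i :: nat assume i: "i \<in> {2..Suc (Suc m)}"
    then have i1: "i - 1 \<in> {1..Suc m}" "i \<noteq> 1" by auto
    \<comment> \<open>The induction hypothesis records slot 1 and the later slots separately, hence
      the case split on i - 1.\<close>
    have "\<exists>V. bimod_isometry A ?Y ?Y' V \<and> JP H t (Suc m) (i - 1) = oproj (hspace ?Y')
        (V ` hspace ?Y)"
    proof (cases "i - 1 = 1")
      case True
      then show ?thesis using ih unfolding slot_proj_def by metis
    next
      case False
      then have "i - 1 \<in> {2..Suc m}" using i1 by auto
      then show ?thesis using ih unfolding slot_proj_def by blast
    qed
    then obtain V where V: "bimod_isometry A ?Y ?Y' V"
      "JP H t (Suc m) (i - 1) = oproj (hspace ?Y') (V ` hspace ?Y)" by (elim exE conjE)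
    show "slot_proj ?Y' ?T' (t (Suc m)) (\<lambda>u. u) (JP H t (Suc m) (i - 1)) (JP H t (Suc (Suc m)) i)"
      using op_tensor_right_step[OF IH(1) ct1 ct2 V] i1(2) by (subst j(2)) simp_all
  qed
qed

lemma jones_proj_isometry:
  assumes "tensor_powers A B \<tau> H hat t n" "H 1 = X" "1 \<le> m" "m < n" "i \<in> {1..Suc m}"
  obtains W where "bimod_isometry A (H m) (H (Suc m)) W"
    "JP H t (Suc m) i = oproj (hspace (H (Suc m))) (W ` hspace (H m))"
proof (cases "i = 1")
  case True
  then show ?thesis using jones_proj_step[OF assms(1-4)] that unfolding slot_proj_def by blast
next
  case False
  then have "i \<in> {2..Suc m}" using assms(5) by auto
  then show ?thesis using jones_proj_step[OF assms(1-4)] that unfolding slot_proj_def by blast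
qed

text \<open>The vector is \<open>\<Omega> \<otimes> \<dots> \<otimes> \<Omega>\<close>.\<close>

lemma vacuum_vector:
  assumes tp: "tensor_powers A B \<tau> H hat t n" and H1: "H 1 = X" and m: "1 \<le> m" "m \<le> n"
  shows "\<exists>v\<in>hspace (H m). JP H t m 1 v = v \<and>
    (\<forall>c\<in>A. cinner (lact (H m) c v) v = \<tau> c)"
  using m
proof (induction m rule: nat_induct_at_least)
  case base
  show ?case
    unfolding H1 jones_proj_1[of H t, OF H1]
  proof (intro bexI[of _ \<Omega>] conjI ballI)
    show "eA \<Omega> = \<Omega>" by (rule oproj_same[OF SA_hilbert SA_S hat_SA[OF A.M_id]])
    show "cinner (L c \<Omega>) \<Omega> = \<tau> c" if "c \<in> A" for c
      using that by (simp add: L_\<Omega> A_B \<tau>_eq_cinner)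
  qed (rule \<Omega>_in)
next
  case (Suc m)
  then obtain v where eta: "v \<in> hspace (H m)" "\<And>c. c \<in> A \<Longrightarrow> cinner (lact (H m) c v) v = \<tau> c" by auto
  have mn: "1 \<le> m" "m < n" using Suc by auto
  note step = jones_proj_step[OF tp H1 mn]
  have ct: "is_connes_tensor A \<tau> X (H m) (H (Suc m)) (t m)"
    using tp mn unfolding tensor_powers_def H1[symmetric] by blast
  interpret tensor A B \<tau> X hat "H m" "H (Suc m)" "t m"
      by unfold_locales (rule step[THEN conjunct1], rule ct)
  have e\<Omega>: "eA \<Omega> = \<Omega>" by (rule oproj_same[OF SA_hilbert SA_S hat_SA[OF A.M_id]])
  have j: "\<forall>u\<in>bv. \<forall>v\<in>hspace (H m). JP H t (Suc m) 1 (t m u v) = t m (eA u) v"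
    using step unfolding slot_proj_def by blast
  show ?case
  proof (intro bexI[of _ "t m \<Omega> v"] conjI ballI)
    show "JP H t (Suc m) 1 (t m \<Omega> v) = t m \<Omega> v"
      using j bv_\<Omega> eta(1) e\<Omega> by simp
    \<comment> \<open>The first legs c \<Omega> and \<Omega> have \<open>A\<close>-valued product c,
      which reduces the claim to the one for v.\<close>
    show "cinner (lact (H (Suc m)) c (t m \<Omega> v)) (t m \<Omega> v) = \<tau> c" if "c \<in> A" for c
      using that eta by (simp add: T_lact bv_\<Omega> L_\<Omega> A_B t_cinner bv_hat AI_\<Omega>_hat)
  qed (rule t_in[OF bv_\<Omega> eta(1)])
qed

lemma mvn_equiv_jones_proj:
  assumes tp: "tensor_powers A B \<tau> H hat t n" and H1: "H 1 = X" and n: "1 \<le> n"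
    and i: "i \<in> {1..n}" and j: "j \<in> {1..n}"
  shows "mvn_equiv (hspace (H n)) (centralizer A (H n)) (JP H t n i) (JP H t n j)"
proof (cases "n = 1")
  case True
  show ?thesis
    unfolding True H1 jones_proj_1[of H t, OF H1]
    by (rule mvn_equiv_refl[OF eA_centralizer oproj_is_projection[OF S_hilbert SA_hilbert SA_S]])
next
  case False
  then obtain m where m: "n = Suc m" "1 \<le> m" "m < n" using n by (cases n) auto
  have Y: "hilbert_bimodule A (H m)" "hilbert_bimodule A (H (Suc m))"
    using jones_proj_step[OF tp H1 m(2,3)] by blast+
  obtain U where U: "bimod_isometry A (H m) (H (Suc m)) U"
    "JP H t (Suc m) i = oproj (hspace (H (Suc m))) (U ` hspace (H m))"
    by (rule jones_proj_isometry[OF tp H1 m(2,3) i[unfolded m(1)]]) (rule that)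
  obtain W where W: "bimod_isometry A (H m) (H (Suc m)) W"
    "JP H t (Suc m) j = oproj (hspace (H (Suc m))) (W ` hspace (H m))"
    by (rule jones_proj_isometry[OF tp H1 m(2,3) j[unfolded m(1)]]) (rule that)
  show ?thesis
    unfolding m(1) U(2) W(2)
    by (rule mvn_equiv_bimod_isometry_ranges[OF _ Y U(1) W(1)]) (simp add: A.M_adj)
qed

lemma jones_proj_distinct:
  assumes tp: "tensor_powers A B \<tau> H hat t n" and H1: "H 1 = X" and n: "2 \<le> n" and SA: "SA \<noteq> S"
  shows "JP H t n 1 \<noteq> JP H t n 2"
proof
  assume eq: "JP H t n 1 = JP H t n 2"
  obtain m where m: "n = Suc m" "1 \<le> m" "m < n" using n by (cases n) auto
  note step = jones_proj_step[OF tp H1 m(2,3)]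
  have ct: "is_connes_tensor A \<tau> X (H m) (H (Suc m)) (t m)"
    using tp m unfolding tensor_powers_def H1[symmetric] by blast
  interpret tensor A B \<tau> X hat "H m" "H (Suc m)" "t m"
      by unfold_locales (rule step[THEN conjunct1], rule ct)
  \<comment> \<open>The witness must be bounded to be the first leg of a tensor, so it is taken from
    hat B, which is dense in S.\<close>
  have "\<exists>b\<in>B. hat b \<notin> SA"
  proof (rule ccontr)
    assume "\<not> (\<exists>b\<in>B. hat b \<notin> SA)"
    then have "hat ` B \<subseteq> SA" by (intro image_subsetI) metis
    moreover have "closed SA" using SA_hilbert by (simp add: hilbert_iff)
    ultimately have "S \<subseteq> SA" unfolding S_closure by (rule closure_minimal)
    then show False using SA subset_antisym[OF SA_S] by simp
  qed
  then obtain b where b: "b \<in> B" "hat b \<notin> SA" by (elim bexE) (rule that)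
  define \<xi> where "\<xi> = hat b - eA (hat b)"
  have xi: "\<xi> \<in> bv" unfolding \<xi>_def by (intro csubspace_diff[OF bv_csub] bv_eA bv_hat b)
  have "\<xi> \<noteq> 0" using eA_in[OF hat_in[OF b(1)]] b(2) by (auto simp: \<xi>_def)
  have e\<xi>: "eA \<xi> = 0"
    by (rule oproj_eqI[OF SA_hilbert bv_S[OF xi] csubspace_0[OF SA_csub]])
       (use oproj_orth[OF SA_hilbert hat_in[OF b(1)]] in \<open>simp add: \<xi>_def\<close>)
  obtain v where eta: "v \<in> hspace (H m)" "JP H t m 1 v = v"
    "\<And>c. c \<in> A \<Longrightarrow> cinner (lact (H m) c v) v = \<tau> c"
    using vacuum_vector[OF tp H1 m(2)] m(3) by auto
  have "JP H t (Suc m) 1 (t m \<xi> v) = t m (eA \<xi>) v" using step xi eta(1) unfolding slot_proj_def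
      by blast
  then have "JP H t n 1 (t m \<xi> v) = 0" using t_scale_left[OF bv_\<Omega> eta(1), of 0]
      by (simp add: m(1) e\<xi>)
  \<comment> \<open>Slot 2 of the longer power is slot 1 of its right factor, and that projection
    fixes v.\<close>
  moreover have "slot_proj (H m) (H (Suc m)) (t m) (\<lambda>u. u) (JP H t m (2 - 1)) (JP H t (Suc m) 2)"
    using step m(2) by fastforce
  then have "JP H t (Suc m) 2 (t m \<xi> v) = t m \<xi> (JP H t m (2 - 1) v)"
    using xi eta(1) unfolding slot_proj_def by blast
  then have "JP H t n 2 (t m \<xi> v) = t m \<xi> v" using eta(2) by (simp add: m(1))
  ultimately have "t m \<xi> v = 0" using eq by simp
  \<comment> \<open>The squared norm of the tensor is the trace of <\<xi>, \<xi>>_A, which is the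
    squared norm of \<xi>.\<close>
  then have "\<tau> (AI \<xi> \<xi>) = 0"
    using t_cinner[OF xi xi eta(1) eta(1)] eta(3)[OF AI_in[OF xi xi]] by simp
  then have "cinner \<xi> \<xi> = 0"
    using \<tau>_AI[OF xi xi] AI_in[OF xi xi] by (simp add: L_\<Omega> A_B \<tau>_eq_cinner)
  then show False using \<open>\<xi> \<noteq> 0\<close> by simp
qed

end

theorem theorem1p2:
  fixes A B :: "('h::chilbert_space \<Rightarrow> 'h) set"
    and \<tau> :: "('h \<Rightarrow> 'h) \<Rightarrow> complex"
    and H :: "nat \<Rightarrow> ('h, 'k::chilbert_space) bimod"
    and hat :: "('h \<Rightarrow> 'h) \<Rightarrow> 'k"
    and t :: "nat \<Rightarrow> 'k \<Rightarrow> 'k \<Rightarrow> 'k"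
    and n :: nat
  assumes "II1_factor UNIV A" and "II1_factor UNIV B" and "A \<subseteq> B"
    and "tracial_state UNIV B \<tau>"
    and "1 \<le> n"
    and "tensor_powers A B \<tau> H hat t n"
    and "jones_index A (H 1) = \<infinity>"
  shows "(\<forall>i\<in>{1..n}. \<forall>j\<in>{1..n}.
            mvn_equiv (hspace (H n)) (centralizer A (H n))
              (jones_proj A \<tau> H hat t n i) (jones_proj A \<tau> H hat t n j)) \<and>
         (2 \<le> n \<longrightarrow> \<not> abelian (hspace (H n)) (centralizer A (H n)))"
proof -
  have "von_neumann_algebra UNIV A" "von_neumann_algebra UNIV B"
    using assms(1,2) by (simp_all add: II1_factor_def factor_def)
  moreover have "is_L2 B \<tau> (H 1) hat" using assms(6) by (simp add: tensor_powers_def)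
  ultimately interpret inclusion A B \<tau> "H 1" hat by unfold_locales (use assms(3,4) in auto)
  note equiv = mvn_equiv_jones_proj[OF assms(6) refl assms(5)]
  have "\<not> abelian (hspace (H n)) (centralizer A (H n))" if n: "2 \<le> n"
  proof
    assume ab: "abelian (hspace (H n)) (centralizer A (H n))"
    have "1 \<in> {1..n}" "2 \<in> {1..n}" using n by auto
    from equiv[OF this] obtain v where v: "v \<in> centralizer A (H n)"
      "compose (hspace (H n)) (hadj (hspace (H n)) v) v = jones_proj A \<tau> H hat t n 1"
      "compose (hspace (H n)) v (hadj (hspace (H n)) v) = jones_proj A \<tau> H hat t n 2"
      unfolding mvn_equiv_def by blast
    obtain m where m: "n = Suc m" "1 \<le> m" "m < n" using n by (cases n) auto
    \<comment> \<open>Commutativity can be applied to v and its adjoint only once the adjoint is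
      bilinear, and this follows from the adjoint laws of the two actions.\<close>
    have "hilbert_bimodule A (H n)" using jones_proj_step[OF assms(6) refl m(2,3)] unfolding m(1)
        by blast
    then have "hadj (hspace (H n)) v \<in> centralizer A (H n)"
      by (intro centralizer_hadj v(1)) (auto simp: A.M_adj)
    then have "jones_proj A \<tau> H hat t n 1 = jones_proj A \<tau> H hat t n 2"
      using ab v unfolding abelian_def by metis
    then show False using jones_proj_distinct[OF assms(6) refl n SA_neq_S[OF assms(7)]] by blast
  qed
  then show ?thesis using equiv by blast
qed

end
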